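(* Let $\alpha>-1$, and let $\varphi$ be a nonconstant analytic self-map of $\mathbb{D}$ such that $C_\varphi$ is bounded on $\mathcal{D}_\alpha$. Then $$\|C_\varphi\|_e^2=(1+\alpha)\lim_{R\to1^-}\ \sup_{g\in A_\alpha^2,\ \|g\|_{A_\alpha^2}=1}\ \int_{|w|>R}|g(w)|^2N_{\varphi,\alpha}(w)\,dA(w),$$ where the integral is over $\{w\in\mathbb{D}:|w|>R\}$.
   Context: $\mathbb{D}$ is the open unit disk and $dA$ is normalized area measure on $\mathbb{D}$. For $\alpha>-1$, $dA_\alpha(z)=(1+\alpha)(1-|z|^2)^\alpha dA(z)$. The weighted Bergman space $A_\alpha^2$ consists of analytic $g$ on $\mathbb{D}$ with $\|g\|_{A_\alpha^2}^2=\int_{\mathbb{D}}|g|^2dA_\alpha<\infty$. The weighted Dirichlet space $\mathcal{D}_\alpha$ consists of analytic $f$ on $\mathbb{D}$ with $\|f\|_{\mathcal{D}_\alpha}^2=|f(0)|^2+\int_{\mathbb{D}}|f'|^2dA_\alpha<\infty$. $C_\varphi f=f\circ\varphi$. Counting function: $N_{\varphi,\alpha}(w)=\sum_{\varphi(z)=w}(1-|z|^2)^\alpha\in[0,+\infty]$, preimages counted with multiplicity, and $N_{\varphi,\alpha}(w)=0$ if $w\notin\varphi(\mathbb{D})$. Essential norm of a bounded operator $T:H_1\to H_2$ between Hilbert spaces: $\|T\|_e=\inf\{\|T-K\|:K:H_1\to H_2\text{ compact}\}$; here $C_\varphi$ acts on $\mathcal{D}_\alpha$. *)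

theory Defs
  imports "HOL-Complex_Analysis.Complex_Analysis"
begin

abbreviation unit_disk :: "complex set" where
  "unit_disk \<equiv> ball 0 1"

text \<open>Normalized area measure, so that the disk has measure 1. It lives on the whole plane and
  vanishes outside the disk.\<close>

definition dA :: "complex measure" where
  "dA = uniform_measure lborel unit_disk"

definition dA_weighted :: "real \<Rightarrow> complex measure" where
  "dA_weighted \<alpha> = density dA (\<lambda>z. ennreal ((1 + \<alpha>) * (1 - (cmod z)\<^sup>2) powr \<alpha>))"

text \<open>A function on the disk is represented by its extension by zero to the plane. Thus functions
  that agree on the disk are equal, and the spaces below are complex vector spaces on which the
  norms are definite.\<close>

definition disk_analytic :: "(complex \<Rightarrow> complex) set" where
  "disk_analytic = {f. f holomorphic_on unit_disk \<and> (\<forall>z. z \<notin> unit_disk \<longrightarrow> f z = 0)}"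

definition bergman_space :: "real \<Rightarrow> (complex \<Rightarrow> complex) set" where
  "bergman_space \<alpha> =
     {g \<in> disk_analytic. (\<integral>\<^sup>+z. ennreal ((cmod (g z))\<^sup>2) \<partial>dA_weighted \<alpha>) < \<infinity>}"

definition bergman_norm :: "real \<Rightarrow> (complex \<Rightarrow> complex) \<Rightarrow> real" where
  "bergman_norm \<alpha> g = sqrt (enn2real (\<integral>\<^sup>+z. ennreal ((cmod (g z))\<^sup>2) \<partial>dA_weighted \<alpha>))"

definition dirichlet_space :: "real \<Rightarrow> (complex \<Rightarrow> complex) set" where
  "dirichlet_space \<alpha> =
     {f \<in> disk_analytic. (\<integral>\<^sup>+z. ennreal ((cmod (deriv f z))\<^sup>2) \<partial>dA_weighted \<alpha>) < \<infinity>}"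

definition dirichlet_norm :: "real \<Rightarrow> (complex \<Rightarrow> complex) \<Rightarrow> real" where
  "dirichlet_norm \<alpha> f =
     sqrt ((cmod (f 0))\<^sup>2 + enn2real (\<integral>\<^sup>+z. ennreal ((cmod (deriv f z))\<^sup>2) \<partial>dA_weighted \<alpha>))"

definition composition_op :: "(complex \<Rightarrow> complex) \<Rightarrow> (complex \<Rightarrow> complex) \<Rightarrow> complex \<Rightarrow> complex" where
  "composition_op \<phi> f = (\<lambda>z. if z \<in> unit_disk then f (\<phi> z) else 0)"

text \<open>The multiplicity of \<open>z\<close> as a preimage of \<open>w\<close> is the order of the zero of \<open>\<phi> - w\<close> at \<open>z\<close>, which
  is a positive integer when \<open>\<phi>\<close> is analytic and nonconstant on the disk.\<close>

definition counting_function :: "(complex \<Rightarrow> complex) \<Rightarrow> real \<Rightarrow> complex \<Rightarrow> ennreal" where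
  "counting_function \<phi> \<alpha> w =
     (\<Sum>\<^sub>\<infinity>z\<in>{z \<in> unit_disk. \<phi> z = w}.
        ennreal (of_int (zorder (\<lambda>u. \<phi> u - w) z) * (1 - (cmod z)\<^sup>2) powr \<alpha>))"

text \<open>Operators on a normed space given by a carrier \<open>V\<close> of complex-valued functions and a norm
  \<open>nrm\<close> on it; the values of an operator outside \<open>V\<close> are irrelevant.\<close>

definition linear_op_on ::
  "('a \<Rightarrow> complex) set \<Rightarrow> (('a \<Rightarrow> complex) \<Rightarrow> 'a \<Rightarrow> complex) \<Rightarrow> bool" where
  "linear_op_on V T \<longleftrightarrow>
     (\<forall>f\<in>V. T f \<in> V) \<and>
     (\<forall>f\<in>V. \<forall>g\<in>V. T (\<lambda>z. f z + g z) = (\<lambda>z. T f z + T g z)) \<and>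
     (\<forall>c. \<forall>f\<in>V. T (\<lambda>z. c * f z) = (\<lambda>z. c * T f z))"

definition bounded_op_on ::
  "('a \<Rightarrow> complex) set \<Rightarrow> (('a \<Rightarrow> complex) \<Rightarrow> real) \<Rightarrow> (('a \<Rightarrow> complex) \<Rightarrow> 'a \<Rightarrow> complex) \<Rightarrow> bool" where
  "bounded_op_on V nrm T \<longleftrightarrow> linear_op_on V T \<and> (\<exists>C. \<forall>f\<in>V. nrm (T f) \<le> C * nrm f)"

definition compact_op_on ::
  "('a \<Rightarrow> complex) set \<Rightarrow> (('a \<Rightarrow> complex) \<Rightarrow> real) \<Rightarrow> (('a \<Rightarrow> complex) \<Rightarrow> 'a \<Rightarrow> complex) \<Rightarrow> bool" where
  "compact_op_on V nrm K \<longleftrightarrow> linear_op_on V K \<and>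
     (\<forall>f :: nat \<Rightarrow> 'a \<Rightarrow> complex. (\<forall>k. f k \<in> V) \<and> bounded (range (\<lambda>k. nrm (f k))) \<longrightarrow>
        (\<exists>r h. strict_mono r \<and> h \<in> V \<and>
           (\<lambda>k. nrm (\<lambda>z. K (f (r k)) z - h z)) \<longlonglongrightarrow> 0))"

text \<open>The supremum is a genuine one only for bounded operators.\<close>

definition op_norm_on ::
  "('a \<Rightarrow> complex) set \<Rightarrow> (('a \<Rightarrow> complex) \<Rightarrow> real) \<Rightarrow> (('a \<Rightarrow> complex) \<Rightarrow> 'a \<Rightarrow> complex) \<Rightarrow> real" where
  "op_norm_on V nrm T = (SUP f\<in>{f \<in> V. nrm f \<le> 1}. nrm (T f))"

definition essential_norm_on ::
  "('a \<Rightarrow> complex) set \<Rightarrow> (('a \<Rightarrow> complex) \<Rightarrow> real) \<Rightarrow> (('a \<Rightarrow> complex) \<Rightarrow> 'a \<Rightarrow> complex) \<Rightarrow> real" where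
  "essential_norm_on V nrm T =
     (INF K\<in>{K. compact_op_on V nrm K}. op_norm_on V nrm (\<lambda>f z. T f z - K f z))"

end

theory Submission
  imports Defs
begin

text \<open>
  Differentiation turns \<^term>\<open>dirichlet_space \<alpha>\<close>, up to constants, into the Bergman space, and
  it turns \<open>f \<mapsto> f \<circ> \<phi>\<close> into \<open>g \<mapsto> (g \<circ> \<phi>) \<cdot> \<phi>'\<close>. The area formula for
  holomorphic maps (\<open>area_formula_counting_function\<close>) moves the integral of
  \<open>\<bar>g \<circ> \<phi>\<bar>\<^sup>2 \<bar>\<phi>'\<bar>\<^sup>2\<close> to the target side: there is a measure \<open>\<nu>\<close>, whose density
  with respect to normalized area is \<open>1 + \<alpha>\<close> times the counting function, such that
  \<open>\<parallel>C f\<parallel>\<^sup>2 = \<bar>f (\<phi> 0)\<bar>\<^sup>2 + \<integral> \<bar>f'\<bar>\<^sup>2 d\<nu>\<close>. So the operator is governed by the inclusion of the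
  Bergman space into \<open>L\<^sup>2(\<nu>)\<close>, and the claim is that its essential norm is the limit of the norms of
  the inclusions into \<open>L\<^sup>2\<close> of \<open>\<nu>\<close> restricted to the annuli \<open>\<bar>w\<bar> > R\<close>. Call the square of such a
  norm \<open>S(R)\<close>; it decreases in \<open>R\<close>. The locale \<open>carleson_composition\<close> isolates exactly this situation.

  Upper bound. Subtract the finite-rank operator \<open>f \<mapsto> C (P\<^sub>n f)\<close>, where \<open>P\<^sub>n\<close> is Taylor truncation.
  Truncation is an orthogonal projection, since monomials are orthogonal for every radial
  measure; hence the remainder of a function in the unit ball stays in the unit ball, and on
  \<open>\<bar>w\<bar> \<le> R\<close> it is uniformly small for large \<open>n\<close> (\<open>taylor_tail_uniformly_small\<close>). As \<open>\<nu>\<close> has finite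
  mass on the disk, the part \<open>\<bar>w\<bar> \<le> R\<close> contributes arbitrarily little and the annulus at most
  \<open>S(R)\<close>. This gives \<open>ess_norm_upper\<close>.

  Lower bound. Choose \<open>g\<close> in the unit ball with large energy in a thin annulus. Polynomials of
  bounded degree and norm have little energy there, so by the triangle inequality in \<open>L\<^sup>2(\<nu>)\<close> the Taylor tail
  of \<open>g\<close> still carries nearly all of it, and by Fatou's lemma so does a finite piece of that tail
  (\<open>concentrated_block\<close>). Repeating this beyond the degrees already used yields polynomials with
  pairwise disjoint sets of exponents, that is, an orthogonal sequence in the unit ball on which the
  operator stays large. A compact operator tends to zero in norm along a subsequence of such a sequence, because
  the norm of a sum of \<open>N\<close> orthogonal elements of the unit ball is at most \<open>\<surd>N\<close> and not of order \<open>N\<close>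
  (\<open>compact_op_vanishes_on_orthogonal_sequence\<close>), so it cannot reduce the norm.
\<close>

section \<open>Change of variables for holomorphic maps\<close>

text \<open>Change of variables for multidimensional integrals is stated for \<^typ>\<open>real ^ 'n\<close>. This map and its inverse transport it to the complex plane, which has the same Lebesgue measure.\<close>

definition plane_to_complex :: "real ^ 2 \<Rightarrow> complex" where
  "plane_to_complex v = Complex (v $ 1) (v $ 2)"

definition complex_to_plane :: "complex \<Rightarrow> real ^ 2" where
  "complex_to_plane z = vector [Re z, Im z]"

lemma plane_complex_inverse [simp]:
  "plane_to_complex (complex_to_plane z) = z" "complex_to_plane (plane_to_complex v) = v"
  by (auto simp: plane_to_complex_def complex_to_plane_def vec_eq_iff forall_2)

lemma bounded_linear_plane_to_complex: "bounded_linear plane_to_complex"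
proof -
  have "linear plane_to_complex"
    by (rule linearI) (auto simp: plane_to_complex_def complex_eq_iff)
  then show ?thesis by (rule linear_conv_bounded_linear[THEN iffD1])
qed

lemma bounded_linear_complex_to_plane: "bounded_linear complex_to_plane"
proof -
  have "linear complex_to_plane"
    by (rule linearI) (auto simp: complex_to_plane_def vec_eq_iff forall_2)
  then show ?thesis by (rule linear_conv_bounded_linear[THEN iffD1])
qed

lemma measurable_plane_to_complex [measurable]: "plane_to_complex \<in> borel_measurable borel"
  by (intro borel_measurable_continuous_onI bounded_linear.continuous_on[OF bounded_linear_plane_to_complex] continuous_intros)

lemma lborel_complex_eq_distr: "(lborel :: complex measure) = distr lborel borel plane_to_complex"
proof (rule lborel_eqI)
  fix l u :: complex
  assume le: "\<And>b. b \<in> Basis \<Longrightarrow> l \<bullet> b \<le> u \<bullet> b"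
  have lu: "Re l \<le> Re u" "Im l \<le> Im u"
    using le[of 1] le[of \<i>] by (auto simp: Basis_complex_def inner_complex_def)
  have vim: "plane_to_complex -` box l u = box (complex_to_plane l) (complex_to_plane u)"
    by (auto simp: plane_to_complex_def complex_to_plane_def in_box_complex_iff mem_box_cart forall_2)
  have "emeasure (distr lborel borel plane_to_complex) (box l u)
      = emeasure lborel (box (complex_to_plane l) (complex_to_plane u))"
    by (simp add: emeasure_distr vim)
  also have "\<dots> = ennreal (\<Prod>b\<in>Basis. (complex_to_plane u - complex_to_plane l) \<bullet> b)"
  proof (rule emeasure_lborel_box)
    have "complex_to_plane l $ i \<le> complex_to_plane u $ i" for i
      using lu exhaust_2[of i] by (auto simp: complex_to_plane_def)
    then show "complex_to_plane l \<bullet> b \<le> complex_to_plane u \<bullet> b" if "b \<in> Basis" for b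
      using that by (auto simp: Basis_vec_def inner_axis)
  qed
  also have "(\<Prod>b\<in>Basis. (complex_to_plane u - complex_to_plane l) \<bullet> b) = (Re u - Re l) * (Im u - Im l)"
  proof -
    have B: "(Basis :: (real^2) set) = (\<lambda>i. axis i 1) ` UNIV" by (auto simp: Basis_vec_def)
    have "inj_on (\<lambda>i::2. axis i (1::real)) UNIV" by (auto simp: inj_on_def axis_eq_axis)
    then show ?thesis
      unfolding B by (subst prod.reindex) (auto simp: inner_axis UNIV_2 complex_to_plane_def)
  qed
  also have "\<dots> = (\<Prod>b\<in>Basis. (u - l) \<bullet> b)"
    by (simp add: Basis_complex_def inner_complex_def)
  finally show "emeasure (distr lborel borel plane_to_complex) (box l u) = ennreal (\<Prod>b\<in>Basis. (u - l) \<bullet> b)" .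
qed simp

lemma nn_integral_lborel_plane:
  assumes [measurable]: "f \<in> borel_measurable borel"
  shows "(\<integral>\<^sup>+v. f (plane_to_complex v) \<partial>lborel) = (\<integral>\<^sup>+z. f z \<partial>lborel)"
  by (subst lborel_complex_eq_distr, subst nn_integral_distr) auto

text \<open>The real Jacobian determinant of a holomorphic map is \<open>\<bar>\<phi>'\<bar>\<^sup>2\<close>, by the Cauchy-Riemann equations. The bounds on area and derivative make the integral finite, so that it can be identified with a Henstock-Kurzweil integral.\<close>

lemma emeasure_holomorphic_image:
  assumes U: "open U" and hol: "\<phi> holomorphic_on U" and inj: "inj_on \<phi> U"
    and B: "B \<in> sets borel" "B \<subseteq> U" and fin: "emeasure lborel B < \<infinity>"
    and bd: "\<And>z. z \<in> B \<Longrightarrow> cmod (deriv \<phi> z) \<le> M"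
    and im: "\<phi> ` B \<in> sets borel"
  shows "emeasure lborel (\<phi> ` B) = (\<integral>\<^sup>+z. ennreal ((cmod (deriv \<phi> z))\<^sup>2) * indicator B z \<partial>lborel)"
proof -
  define S where "S = plane_to_complex -` B"
  define g where "g = (\<lambda>v. complex_to_plane (\<phi> (plane_to_complex v)))"
  define g' where "g' = (\<lambda>v h. complex_to_plane (deriv \<phi> (plane_to_complex v) * plane_to_complex h))"
  have Sb: "S \<in> sets borel" unfolding S_def using measurable_sets[OF measurable_plane_to_complex B(1)] by simp
  then have S: "S \<in> sets lebesgue" by auto
  have der: "(g has_derivative g' v) (at v within S)" if "v \<in> S" for v
  proof -
    have "plane_to_complex v \<in> U" using that B(2) by (auto simp: S_def)
    then have "(\<phi> has_derivative (*) (deriv \<phi> (plane_to_complex v))) (at (plane_to_complex v))"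
      using holomorphic_derivI[OF hol U] by (simp add: has_field_derivative_def)
    moreover have "(plane_to_complex has_derivative plane_to_complex) (at v within S)"
      by (rule bounded_linear_imp_has_derivative[OF bounded_linear_plane_to_complex])
    ultimately have "((\<lambda>v. \<phi> (plane_to_complex v)) has_derivative (\<lambda>h. deriv \<phi> (plane_to_complex v) * plane_to_complex h)) (at v within S)"
      by (rule has_derivative_compose[rotated])
    from bounded_linear.has_derivative[OF bounded_linear_complex_to_plane this]
    show ?thesis by (simp add: g_def g'_def)
  qed
  have det: "det (matrix (g' v)) = (cmod (deriv \<phi> (plane_to_complex v)))\<^sup>2" for v
  proof -
    have "det (matrix (g' v)) = (Re (deriv \<phi> (plane_to_complex v)))\<^sup>2 + (Im (deriv \<phi> (plane_to_complex v)))\<^sup>2"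
      by (simp add: det_2 matrix_def g'_def complex_to_plane_def plane_to_complex_def axis_def power2_eq_square)
    then show ?thesis by (simp only: cmod_power2)
  qed
  have injg: "inj_on g S"
  proof (rule inj_onI)
    fix v w assume "v \<in> S" "w \<in> S" "g v = g w"
    then have "\<phi> (plane_to_complex v) = \<phi> (plane_to_complex w)"
      by (metis g_def plane_complex_inverse(1))
    then have "plane_to_complex v = plane_to_complex w"
      using inj \<open>v \<in> S\<close> \<open>w \<in> S\<close> B(2) by (auto simp: S_def inj_on_def)
    then show "v = w" by (metis plane_complex_inverse(2))
  qed
  have finS: "emeasure lborel S < \<infinity>"
    using fin B(1) by (subst (asm) lborel_complex_eq_distr) (simp add: emeasure_distr S_def)
  have "(\<lambda>z. deriv \<phi> z) holomorphic_on U" using hol U by (rule holomorphic_deriv)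
  then have "continuous_on B (deriv \<phi>)" using B(2) holomorphic_on_imp_continuous_on continuous_on_subset by blast
  then have "(\<lambda>z. indicator B z *\<^sub>R deriv \<phi> z) \<in> borel_measurable borel"
    by (intro borel_measurable_continuous_on_indicator B(1))
  then have meas0: "(\<lambda>z. (cmod (indicator B z *\<^sub>R deriv \<phi> z))\<^sup>2) \<in> borel_measurable borel" by measurable
  define k where "k z = (cmod (indicator B z *\<^sub>R deriv \<phi> z))\<^sup>2" for z
  have [measurable]: "k \<in> borel_measurable borel" using meas0 unfolding k_def .
  have kint: "(\<lambda>v. k (plane_to_complex v)) integrable_on S"
  proof (rule measurable_bounded_by_integrable_imp_integrable)
    show "(\<lambda>v. k (plane_to_complex v)) \<in> borel_measurable (lebesgue_on S)"
      by (intro measurable_restrict_space1 measurable_completion) simp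
    show "(\<lambda>v. max M 0 ^ 2) integrable_on S"
      using finS Sb by (intro integrable_on_const) (auto simp: fmeasurable_def)
    show "norm (k (plane_to_complex v)) \<le> (max M 0)\<^sup>2" if "v \<in> S" for v
    proof -
      have "cmod (deriv \<phi> (plane_to_complex v)) \<le> max M 0" using bd[of "plane_to_complex v"] that by (auto simp: S_def)
      then show ?thesis using that by (auto simp: k_def S_def intro!: power_mono)
    qed
  qed (use S in auto)
  have kdet: "k (plane_to_complex v) = \<bar>det (matrix (g' v))\<bar>" if "v \<in> S" for v
    using that by (simp add: k_def det S_def)
  have int: "((\<lambda>v. \<bar>det (matrix (g' v))\<bar>) has_integral integral S (\<lambda>v. k (plane_to_complex v))) S"
    using kint kdet by (metis (no_types, lifting) has_integral_eq integrable_integral)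
  then have "g ` S \<in> lmeasurable \<and> measure lebesgue (g ` S) = integral S (\<lambda>v. k (plane_to_complex v))"
    using has_measure_differentiable_image[OF S der injg] by blast
  then have gS: "emeasure lebesgue (g ` S) = ennreal (integral S (\<lambda>v. k (plane_to_complex v)))"
    using emeasure_eq_measure2[of "g ` S" lebesgue] by metis
  have gS_eq: "g ` S = plane_to_complex -` (\<phi> ` B)"
  proof -
    have "v \<in> g ` S" if "plane_to_complex v = \<phi> z" "z \<in> B" for v z
    proof (rule image_eqI)
      have "complex_to_plane (plane_to_complex v) = complex_to_plane (\<phi> z)" using that(1) by metis
      then show "v = g (complex_to_plane z)" unfolding g_def plane_complex_inverse .
      show "complex_to_plane z \<in> S" using that(2) by (simp add: S_def)
    qed
    moreover have "plane_to_complex (g v) \<in> \<phi> ` B" if "v \<in> S" for v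
      using that unfolding g_def S_def plane_complex_inverse by blast
    ultimately show ?thesis by blast
  qed
  have "emeasure lborel (\<phi> ` B) = emeasure lborel (plane_to_complex -` (\<phi> ` B))"
    by (subst lborel_complex_eq_distr) (simp add: emeasure_distr im)
  also have "\<dots> = emeasure lebesgue (g ` S)"
    unfolding gS_eq using measurable_sets[OF measurable_plane_to_complex im] by simp
  also have "\<dots> = (\<integral>\<^sup>+v. ennreal (k (plane_to_complex v)) * indicator S v \<partial>lborel)"
    unfolding gS by (subst nn_integral_has_integral_lebesgue'[OF _ integrable_integral[OF kint]]) (auto simp: k_def)
  also have "\<dots> = (\<integral>\<^sup>+v. ennreal (k (plane_to_complex v)) \<partial>lborel)"
    by (intro nn_integral_cong) (auto simp: S_def k_def indicator_def)
  also have "\<dots> = (\<integral>\<^sup>+z. ennreal (k z) \<partial>lborel)" by (rule nn_integral_lborel_plane) simp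
  also have "\<dots> = (\<integral>\<^sup>+z. ennreal ((cmod (deriv \<phi> z))\<^sup>2) * indicator B z \<partial>lborel)"
    by (intro nn_integral_cong) (auto simp: k_def indicator_def)
  finally show ?thesis .
qed

text \<open>The inverse is extended by zero to the whole plane, which keeps it Borel. It serves to express functions of the preimage as functions of the image point.\<close>

lemma holomorphic_injective_inverse_borel:
  assumes U: "open U" and hol: "\<phi> holomorphic_on U" and inj: "inj_on \<phi> U"
  obtains \<psi> where "\<psi> \<in> borel_measurable borel" "\<And>z. z \<in> U \<Longrightarrow> \<psi> (\<phi> z) = z" "open (\<phi> ` U)"
proof -
  obtain h where h: "h holomorphic_on (\<phi> ` U)" "\<And>z. z \<in> U \<Longrightarrow> h (\<phi> z) = z"
    using holomorphic_has_inverse[OF hol U inj] by metis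
  have op: "open (\<phi> ` U)" using open_mapping_thm3[OF hol U inj] .
  have "continuous_on (\<phi> ` U) h" using h(1) holomorphic_on_imp_continuous_on by blast
  then have "(\<lambda>w. indicator (\<phi> ` U) w *\<^sub>R h w) \<in> borel_measurable borel"
    using op by (intro borel_measurable_continuous_on_indicator) auto
  moreover have "indicator (\<phi> ` U) (\<phi> z) *\<^sub>R h (\<phi> z) = z" if "z \<in> U" for z
    using that h(2) by simp
  ultimately show ?thesis using op that by blast
qed

text \<open>The formula for images of sets says that \<open>\<phi>\<close> pushes the measure \<open>\<bar>\<phi>'\<bar>\<^sup>2 dA\<close> on \<open>U\<close> forward to area measure on \<open>\<phi>(U)\<close>; integrating \<open>F\<close> against both gives the change of variables.\<close>

lemma nn_integral_holomorphic_injective: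
  assumes U: "open U" and hol: "\<phi> holomorphic_on U" and inj: "inj_on \<phi> U"
    and bU: "bounded U" and bd: "\<And>z. z \<in> U \<Longrightarrow> cmod (deriv \<phi> z) \<le> M"
    and [measurable]: "F \<in> borel_measurable borel"
  shows "(\<integral>\<^sup>+z. F (\<phi> z) * ennreal ((cmod (deriv \<phi> z))\<^sup>2) * indicator U z \<partial>lborel)
       = (\<integral>\<^sup>+w. F w * indicator (\<phi> ` U) w \<partial>lborel)"
proof -
  obtain \<psi> where [measurable]: "\<psi> \<in> borel_measurable borel" and \<psi>: "\<And>z. z \<in> U \<Longrightarrow> \<psi> (\<phi> z) = z"
    and op: "open (\<phi> ` U)" using holomorphic_injective_inverse_borel[OF U hol inj] by metis
  define \<phi>0 where "\<phi>0 = (\<lambda>z. indicator U z *\<^sub>R \<phi> z)"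
  define d where "d = (\<lambda>z. (cmod (indicator U z *\<^sub>R deriv \<phi> z))\<^sup>2)"
  have U': "U \<in> sets borel" and fU: "\<phi> ` U \<in> sets borel" using U op by auto
  note [measurable] = U' fU
  have [measurable]: "\<phi>0 \<in> borel_measurable borel" unfolding \<phi>0_def
    using U' hol holomorphic_on_imp_continuous_on by (intro borel_measurable_continuous_on_indicator) auto
  have "(\<lambda>z. indicator U z *\<^sub>R deriv \<phi> z) \<in> borel_measurable borel"
    using U' holomorphic_on_imp_continuous_on[OF holomorphic_deriv[OF hol U]]
    by (intro borel_measurable_continuous_on_indicator) auto
  then have [measurable]: "d \<in> borel_measurable borel" unfolding d_def by measurable
  have eq: "distr (density lborel d) borel \<phi>0 = density lborel (indicator (\<phi> ` U))"
  proof (rule measure_eqI)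
    fix E assume "E \<in> sets (distr (density lborel d) borel \<phi>0)"
    then have [measurable]: "E \<in> sets borel" by simp
    define B where "B = U \<inter> \<phi>0 -` E"
    have [measurable]: "B \<in> sets borel" unfolding B_def
      using measurable_sets_borel[of \<phi>0 borel E] by auto
    have im: "\<phi> ` B = \<phi> ` U \<inter> E" unfolding B_def \<phi>0_def by auto
    have "emeasure lborel U < \<infinity>" using bU by (rule emeasure_bounded_finite)
    then have fin: "emeasure lborel B < \<infinity>"
      by (rule le_less_trans[rotated]) (auto intro!: emeasure_mono simp: B_def)
    have "emeasure (distr (density lborel d) borel \<phi>0) E = emeasure (density lborel d) (\<phi>0 -` E)"
      by (simp add: emeasure_distr)
    also have "\<dots> = (\<integral>\<^sup>+z. ennreal (d z) * indicator (\<phi>0 -` E) z \<partial>lborel)"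
      using measurable_sets_borel[of \<phi>0 borel E] by (intro emeasure_density) auto
    also have "\<dots> = (\<integral>\<^sup>+z. ennreal ((cmod (deriv \<phi> z))\<^sup>2) * indicator B z \<partial>lborel)"
      by (intro nn_integral_cong) (auto simp: d_def B_def indicator_def)
    also have "\<dots> = emeasure lborel (\<phi> ` B)"
    proof (rule emeasure_holomorphic_image[symmetric, OF U hol inj _ _ fin])
      show "\<phi> ` B \<in> sets borel" unfolding im by measurable
      show "cmod (deriv \<phi> z) \<le> M" if "z \<in> B" for z using that bd by (auto simp: B_def)
    qed (auto simp: B_def[symmetric], auto simp: B_def)
    also have "\<dots> = emeasure (density lborel (indicator (\<phi> ` U))) E"
    proof -
      have "emeasure (density lborel (indicator (\<phi> ` U))) E = (\<integral>\<^sup>+w. indicator (\<phi> ` U \<inter> E) w \<partial>lborel)"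
        unfolding indicator_inter_arith by (subst emeasure_density) auto
      then show ?thesis by (simp add: im)
    qed
    finally show "emeasure (distr (density lborel d) borel \<phi>0) E = emeasure (density lborel (indicator (\<phi> ` U))) E" .
  qed simp
  have "(\<integral>\<^sup>+z. F (\<phi> z) * ennreal ((cmod (deriv \<phi> z))\<^sup>2) * indicator U z \<partial>lborel) = (\<integral>\<^sup>+z. d z * F (\<phi>0 z) \<partial>lborel)"
    by (intro nn_integral_cong) (auto simp: d_def \<phi>0_def indicator_def mult.commute)
  also have "\<dots> = (\<integral>\<^sup>+w. F w \<partial>distr (density lborel d) borel \<phi>0)"
    by (simp add: nn_integral_distr nn_integral_density)
  also have "\<dots> = (\<integral>\<^sup>+w. F w * indicator (\<phi> ` U) w \<partial>lborel)"
    unfolding eq by (simp add: nn_integral_density mult.commute)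
  finally show ?thesis .
qed

text \<open>By the Lindelof property, countably many of the neighbourhoods given by the inverse function theorem suffice. They are shrunk so that the derivative is bounded on each.\<close>

lemma locally_injective_cover:
  assumes U: "open U" and hol: "\<phi> holomorphic_on U" and nz: "\<And>z. z \<in> U \<Longrightarrow> deriv \<phi> z \<noteq> 0"
  shows "\<exists>V :: nat \<Rightarrow> complex set. (\<Union>n. V n) = U \<and> (\<forall>n. open (V n) \<and> bounded (V n) \<and>
    inj_on \<phi> (V n) \<and> (\<exists>M. \<forall>z\<in>V n. cmod (deriv \<phi> z) \<le> M))"
proof -
  define P where "P W \<longleftrightarrow> open W \<and> W \<subseteq> U \<and> bounded W \<and> inj_on \<phi> W \<and> (\<exists>M. \<forall>z\<in>W. cmod (deriv \<phi> z) \<le> M)" for W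
  have loc: "\<exists>W. P W \<and> z \<in> W" if zU: "z \<in> U" for z
  proof -
    obtain r where r: "r > 0" "ball z r \<subseteq> U" "inj_on \<phi> (ball z r)"
      using has_complex_derivative_locally_injective[OF hol zU U nz[OF zU]] by metis
    have sub: "cball z (r/2) \<subseteq> ball z r" using r(1) by auto
    have "continuous_on (cball z (r/2)) (deriv \<phi>)"
      using holomorphic_on_imp_continuous_on[OF holomorphic_deriv[OF hol U]] sub r(2)
      by (meson continuous_on_subset subset_trans)
    then have "compact (deriv \<phi> ` cball z (r/2))" by (rule compact_continuous_image) simp
    then obtain M where "\<forall>x\<in>deriv \<phi> ` cball z (r/2). cmod x \<le> M"
      using compact_imp_bounded bounded_iff by blast
    then have "\<forall>x\<in>ball z (r/2). cmod (deriv \<phi> x) \<le> M" by auto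
    moreover have "ball z (r/2) \<subseteq> ball z r" using r(1) by auto
    ultimately have "P (ball z (r/2))" unfolding P_def using r by (auto intro: inj_on_subset)
    then show ?thesis using r(1) by (intro exI[of _ "ball z (r/2)"]) auto
  qed
  have P_empty: "P {}" unfolding P_def by auto
  obtain F' where F': "F' \<subseteq> Collect P" "countable F'" "\<Union>F' = \<Union>(Collect P)"
    using Lindelof[of "Collect P"] unfolding P_def by auto
  \<comment> \<open>the empty set is added so that the enumeration exists even when \<open>U\<close> is empty\<close>
  define V where "V = from_nat_into (insert {} F')"
  have rng: "range V = insert {} F'" unfolding V_def
    using F'(2) by (intro range_from_nat_into) auto
  have PV: "P (V n)" for n using rng F'(1) P_empty by (metis insertE mem_Collect_eq rangeI subsetD)
  have un: "(\<Union>n. V n) = U" using rng F'(3) loc unfolding P_def by auto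
  show ?thesis using un PV unfolding P_def by (intro exI[of _ V]) auto
qed

text \<open>The counting function sums over a fibre. A disjoint family of sets that each meet the fibre at most once enumerates it, which turns the unordered sum into a series of Borel functions.\<close>

lemma infsum_eq_suminf_pieces:
  fixes f :: "'a \<Rightarrow> ennreal"
  assumes dis: "disjoint_family B" and cov: "A \<subseteq> (\<Union>n. B n)"
    and t: "\<And>n z. z \<in> A \<inter> B n \<Longrightarrow> t n = f z" and t0: "\<And>n. A \<inter> B n = {} \<Longrightarrow> t n = 0"
    and one: "\<And>n x y. x \<in> A \<inter> B n \<Longrightarrow> y \<in> A \<inter> B n \<Longrightarrow> x = y"
  shows "infsum f A = (\<Sum>n. t n)"
proof -
  define ix where "ix z = (THE n. z \<in> B n)" for z
  have ix: "ix z = n" if "z \<in> B n" for z n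
    unfolding ix_def using that dis by (intro the_equality) (auto simp: disjoint_family_on_def)
  have bij: "bij_betw ix A {n. A \<inter> B n \<noteq> {}}"
  proof (rule bij_betwI')
    show "(ix x = ix y) = (x = y)" if "x \<in> A" "y \<in> A" for x y
      using that cov ix one by (metis IntI UN_E subsetD)
    show "ix x \<in> {n. A \<inter> B n \<noteq> {}}" if "x \<in> A" for x
      using that cov ix by fastforce
    show "\<exists>x\<in>A. n = ix x" if "n \<in> {n. A \<inter> B n \<noteq> {}}" for n
      using that ix by fastforce
  qed
  have "infsum f A = infsum (\<lambda>z. t (ix z)) A"
    using cov ix t by (intro infsum_cong) (metis IntI UN_E subsetD)
  also have "\<dots> = infsum t {n. A \<inter> B n \<noteq> {}}" by (rule infsum_reindex_bij_betw[OF bij])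
  also have "\<dots> = infsum t UNIV" by (rule infsum_cong_neutral) (auto simp: t0)
  also have "\<dots> = (\<Sum>n. t n)"
  proof -
    have "t summable_on UNIV" by (rule nonneg_summable_on_complete) simp
    then show ?thesis using has_sum_imp_sums[OF has_sum_infsum] sums_unique by blast
  qed
  finally show ?thesis .
qed

text \<open>Zeros of a nonconstant \<open>\<phi>'\<close> are isolated, and a constant \<open>\<phi>'\<close> is not zero because \<open>\<phi>\<close> is not constant.\<close>

lemma countable_critical_points:
  assumes U: "open U" "connected U" and hol: "\<phi> holomorphic_on U" and nc: "\<not> \<phi> constant_on U"
  shows "countable {z \<in> U. deriv \<phi> z = 0}"
proof (cases "deriv \<phi> constant_on U")
  case False
  obtain C :: "nat \<Rightarrow> complex set" where "\<And>n. compact (C n)" "\<Union>(range C) = U"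
    using open_Union_compact_subsets[OF U(1)] by metis
  then have "fsigma U" by (metis compact_imp_closed fsigma.intros)
  then show ?thesis
    using holomorphic_countable_zeros[OF holomorphic_deriv[OF hol U(1)] U] False by blast
next
  case True
  have "\<exists>z\<in>U. deriv \<phi> z \<noteq> 0"
  proof (rule ccontr)
    assume "\<not> ?thesis"
    then have "(\<phi> has_field_derivative 0) (at z)" if "z \<in> U" for z
      using holomorphic_derivI[OF hol U(1) that] that by metis
    then have "\<phi> constant_on U"
      using has_field_derivative_0_imp_constant_on U by blast
    then show False using nc by blast
  qed
  then have "{z \<in> U. deriv \<phi> z = 0} = {}" using True unfolding constant_on_def by auto
  then show ?thesis by (simp only: countable_empty)
qed

lemma zorder_simple_preimage:
  assumes U: "open U" "z \<in> U" and hol: "\<phi> holomorphic_on U" and "deriv \<phi> z \<noteq> 0"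
  shows "zorder (\<lambda>u. \<phi> u - \<phi> z) z = 1"
proof (rule zorder_zero_eqI[of _ U])
  show "(\<lambda>u. \<phi> u - \<phi> z) holomorphic_on U" using hol by (intro holomorphic_intros)
  have "(\<phi> has_field_derivative deriv \<phi> z) (at z)" using holomorphic_derivI[OF hol U] .
  then have "((\<lambda>u. \<phi> u - \<phi> z) has_field_derivative deriv \<phi> z) (at z)" by (auto intro!: derivative_eq_intros)
  then have "deriv (\<lambda>u. \<phi> u - \<phi> z) z = deriv \<phi> z" by (rule DERIV_imp_deriv)
  then show "(deriv ^^ nat 1) (\<lambda>u. \<phi> u - \<phi> z) z \<noteq> 0" using assms by simp
qed (use U in auto)

text \<open>Off the countable set of critical points the disk splits into countably many Borel pieces on which \<open>\<phi>\<close> is injective. Summing the change of variables over the pieces produces at \<open>w\<close> the sum of the weights of the simple preimages of \<open>w\<close>. This is the counting function, except on the countable, hence null, set of critical values. The Borel version \<open>N\<close> makes the formula meaningful before measurability of the counting function itself is known.\<close>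

lemma area_formula_counting_function:
  fixes \<phi> :: "complex \<Rightarrow> complex" and \<alpha> :: real
  assumes hol: "\<phi> holomorphic_on unit_disk" and nc: "\<not> \<phi> constant_on unit_disk"
  obtains N where "N \<in> borel_measurable borel" "AE w in lborel. counting_function \<phi> \<alpha> w = N w"
    "\<And>F :: complex \<Rightarrow> ennreal. F \<in> borel_measurable borel \<Longrightarrow>
      (\<integral>\<^sup>+z. F (\<phi> z) * ennreal ((cmod (deriv \<phi> z))\<^sup>2) * ennreal ((1 - (cmod z)\<^sup>2) powr \<alpha>) * indicator unit_disk z \<partial>lborel)
      = (\<integral>\<^sup>+w. F w * N w \<partial>lborel)"
proof -
  define Z where "Z = {z \<in> unit_disk. deriv \<phi> z = 0}"
  define G where "G = unit_disk - Z"
  have cZ: "countable Z" unfolding Z_def by (rule countable_critical_points) (use hol nc in auto)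
  have holder: "deriv \<phi> holomorphic_on unit_disk" using hol by (intro holomorphic_deriv) auto
  have oG: "open G"
  proof -
    have "G = unit_disk \<inter> deriv \<phi> -` (- {0})" by (auto simp: G_def Z_def)
    then show ?thesis
      using continuous_open_preimage[OF holomorphic_on_imp_continuous_on[OF holder], of "- {0}"] by auto
  qed
  have GD: "G \<subseteq> unit_disk" by (auto simp: G_def)
  have holG: "\<phi> holomorphic_on G" using hol GD by (rule holomorphic_on_subset)
  have nzG: "deriv \<phi> z \<noteq> 0" if "z \<in> G" for z using that by (simp add: G_def Z_def)
  obtain V :: "nat \<Rightarrow> complex set" where V0: "(\<Union>n. V n) = G \<and> (\<forall>n. open (V n) \<and> bounded (V n) \<and>
    inj_on \<phi> (V n) \<and> (\<exists>M. \<forall>z\<in>V n. cmod (deriv \<phi> z) \<le> M))"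
    using locally_injective_cover[OF oG holG nzG] ..
  then have V: "(\<Union>n. V n) = G" "\<And>n. open (V n)" "\<And>n. bounded (V n)"
    "\<And>n. inj_on \<phi> (V n)" "\<And>n. \<exists>M. \<forall>z\<in>V n. cmod (deriv \<phi> z) \<le> M"
    by simp_all
  have VG: "V n \<subseteq> G" for n using V(1) by blast
  have holV: "\<phi> holomorphic_on V n" for n using holG VG by (rule holomorphic_on_subset)
  have "\<exists>\<psi>. \<psi> \<in> borel_measurable borel \<and> (\<forall>z\<in>V n. \<psi> (\<phi> z) = z) \<and> open (\<phi> ` V n)" for n
    using holomorphic_injective_inverse_borel[OF V(2) holV V(4)] by metis
  then obtain \<psi> where \<psi>: "\<And>n. \<psi> n \<in> borel_measurable borel" "\<And>n z. z \<in> V n \<Longrightarrow> \<psi> n (\<phi> z) = z" "\<And>n. open (\<phi> ` V n)"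
    by metis
  note [measurable] = \<psi>(1)
  have [measurable]: "\<phi> ` V n \<in> sets borel" for n using \<psi>(3) by auto
  define B where "B = disjointed V"
  have dB: "disjoint_family B" unfolding B_def by (rule disjoint_family_disjointed)
  have BV: "B n \<subseteq> V n" for n unfolding B_def by (rule disjointed_subset)
  have UB: "(\<Union>n. B n) = G" unfolding B_def using V(1) by (simp add: UN_disjointed_eq)
  have "range V \<subseteq> sets borel" using V(2) by auto
  then have rB: "range B \<subseteq> sets borel" unfolding B_def by (rule sets.range_disjointed_sets)
  then have [measurable]: "B n \<in> sets borel" for n by auto
  define \<rho> where "\<rho> = (\<lambda>z. ennreal ((1 - (cmod z)\<^sup>2) powr \<alpha>))"
  have [measurable]: "\<rho> \<in> borel_measurable borel" unfolding \<rho>_def by measurable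
  define t where "t = (\<lambda>n w. \<rho> (\<psi> n w) * indicator (B n) (\<psi> n w) * indicator (\<phi> ` V n) w)"
  have [measurable]: "t n \<in> borel_measurable borel" for n unfolding t_def by measurable
  define N where "N = (\<lambda>w. \<Sum>n. t n w)"
  have Nm: "N \<in> borel_measurable borel" unfolding N_def by measurable
  have cf: "counting_function \<phi> \<alpha> w = N w" if w: "w \<notin> \<phi> ` Z" for w
    unfolding counting_function_def N_def
  proof (rule infsum_eq_suminf_pieces[OF dB])
    show "{z \<in> unit_disk. \<phi> z = w} \<subseteq> (\<Union>n. B n)" using w unfolding UB by (auto simp: G_def)
    fix n
    show "x = y" if "x \<in> {z \<in> unit_disk. \<phi> z = w} \<inter> B n" "y \<in> {z \<in> unit_disk. \<phi> z = w} \<inter> B n" for x y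
      using that BV[of n] V(4)[of n] by (auto dest: inj_onD)
    show "t n w = ennreal (of_int (zorder (\<lambda>u. \<phi> u - w) z) * (1 - (cmod z)\<^sup>2) powr \<alpha>)"
      if "z \<in> {z \<in> unit_disk. \<phi> z = w} \<inter> B n" for z
    proof -
      have z: "z \<in> unit_disk" "\<phi> z = w" "z \<in> B n" "z \<in> V n" "z \<in> G" using that BV[of n] VG[of n] by auto
      then have "zorder (\<lambda>u. \<phi> u - w) z = 1"
        using zorder_simple_preimage[of unit_disk z \<phi>] hol by (auto simp: G_def Z_def)
      moreover have "\<psi> n w = z" "w \<in> \<phi> ` V n" using z \<psi>(2) by auto
      ultimately show ?thesis using z by (simp add: t_def \<rho>_def)
    qed
    show "t n w = 0" if "{z \<in> unit_disk. \<phi> z = w} \<inter> B n = {}"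
    proof (cases "w \<in> \<phi> ` V n")
      case True
      then obtain z where z: "z \<in> V n" "w = \<phi> z" by blast
      then have "z \<in> unit_disk" using VG[of n] GD by blast
      then have "z \<notin> B n" using that z(2) by blast
      then show ?thesis using z \<psi>(2) by (simp add: t_def)
    qed (simp add: t_def)
  qed
  have "\<phi> ` Z \<in> null_sets lborel" using cZ by (intro countable_imp_null_set_lborel) auto
  then have AE: "AE w in lborel. counting_function \<phi> \<alpha> w = N w"
    by (rule AE_I') (use cf in auto)
  have main: "(\<integral>\<^sup>+z. F (\<phi> z) * ennreal ((cmod (deriv \<phi> z))\<^sup>2) * ennreal ((1 - (cmod z)\<^sup>2) powr \<alpha>) * indicator unit_disk z \<partial>lborel)
      = (\<integral>\<^sup>+w. F w * N w \<partial>lborel)" if [measurable]: "F \<in> borel_measurable borel" for F :: "complex \<Rightarrow> ennreal"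
  proof -
    define \<phi>0 where "\<phi>0 = (\<lambda>z. indicator unit_disk z *\<^sub>R \<phi> z)"
    define d where "d = (\<lambda>z. indicator unit_disk z *\<^sub>R deriv \<phi> z)"
    have [measurable]: "\<phi>0 \<in> borel_measurable borel" unfolding \<phi>0_def
      using hol holomorphic_on_imp_continuous_on by (intro borel_measurable_continuous_on_indicator) auto
    have [measurable]: "d \<in> borel_measurable borel" unfolding d_def
      using holder holomorphic_on_imp_continuous_on by (intro borel_measurable_continuous_on_indicator) auto
    define f where "f = (\<lambda>z. F (\<phi>0 z) * ennreal ((cmod (d z))\<^sup>2) * \<rho> z)"
    have [measurable]: "f \<in> borel_measurable borel" unfolding f_def by measurable
    have piece: "(\<integral>\<^sup>+z\<in>B n. f z \<partial>lborel) = (\<integral>\<^sup>+w. F w * t n w \<partial>lborel)" for n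
    proof -
      obtain M where M: "\<forall>z\<in>V n. cmod (deriv \<phi> z) \<le> M" using V(5) by blast
      have "(\<integral>\<^sup>+z\<in>B n. f z \<partial>lborel) = (\<integral>\<^sup>+z. (F (\<phi> z) * (\<rho> (\<psi> n (\<phi> z)) * indicator (B n) (\<psi> n (\<phi> z))))
          * ennreal ((cmod (deriv \<phi> z))\<^sup>2) * indicator (V n) z \<partial>lborel)"
      proof (intro nn_integral_cong)
        fix z
        have "z \<in> unit_disk" if "z \<in> V n" using that VG[of n] GD by blast
        then show "f z * indicator (B n) z = F (\<phi> z) * (\<rho> (\<psi> n (\<phi> z)) * indicator (B n) (\<psi> n (\<phi> z)))
          * ennreal ((cmod (deriv \<phi> z))\<^sup>2) * indicator (V n) z"
          using BV[of n] \<psi>(2)[of z n] by (auto simp: f_def \<phi>0_def d_def mult_ac indicator_def)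
      qed
      also have "\<dots> = (\<integral>\<^sup>+w. F w * (\<rho> (\<psi> n w) * indicator (B n) (\<psi> n w)) * indicator (\<phi> ` V n) w \<partial>lborel)"
        by (rule nn_integral_holomorphic_injective[where M=M]) (use V(2,3,4) holV M in auto)
      also have "\<dots> = (\<integral>\<^sup>+w. F w * t n w \<partial>lborel)" by (simp add: t_def mult_ac)
      finally show ?thesis .
    qed
    have "(\<integral>\<^sup>+z. F (\<phi> z) * ennreal ((cmod (deriv \<phi> z))\<^sup>2) * ennreal ((1 - (cmod z)\<^sup>2) powr \<alpha>) * indicator unit_disk z \<partial>lborel)
        = (\<integral>\<^sup>+z\<in>G. f z \<partial>lborel)"
      by (intro nn_integral_cong) (auto simp: f_def \<phi>0_def d_def \<rho>_def G_def Z_def indicator_def)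
    also have "\<dots> = (\<Sum>n. \<integral>\<^sup>+z\<in>B n. f z \<partial>lborel)"
      unfolding UB[symmetric] using rB dB by (intro nn_integral_disjoint_family) auto
    also have "\<dots> = (\<Sum>n. \<integral>\<^sup>+w. F w * t n w \<partial>lborel)" unfolding piece ..
    also have "\<dots> = (\<integral>\<^sup>+w. (\<Sum>n. F w * t n w) \<partial>lborel)" by (rule nn_integral_suminf[symmetric]) measurable
    also have "\<dots> = (\<integral>\<^sup>+w. F w * N w \<partial>lborel)" unfolding N_def by simp
    finally show ?thesis .
  qed
  show ?thesis using that[OF Nm AE main] .
qed

section \<open>Square-integrable functions\<close>

lemma ball_borel [measurable]: "ball (x :: complex) r \<in> sets borel" by auto

definition l2_norm :: "complex measure \<Rightarrow> (complex \<Rightarrow> complex) \<Rightarrow> real" where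
  "l2_norm M g = sqrt (enn2real (\<integral>\<^sup>+z. ennreal ((cmod (g z))\<^sup>2) \<partial>M))"

lemma l2_norm_nonneg [simp]: "0 \<le> l2_norm M g" by (simp add: l2_norm_def)

lemma l2_norm_sq:
  assumes "(\<integral>\<^sup>+z. ennreal ((cmod (g z))\<^sup>2) \<partial>M) < \<infinity>"
  shows "(\<integral>\<^sup>+z. ennreal ((cmod (g z))\<^sup>2) \<partial>M) = ennreal ((l2_norm M g)\<^sup>2)"
  using assms by (simp add: l2_norm_def)

lemma l2_norm_cmult: "l2_norm M (\<lambda>z. c * g z) = cmod c * l2_norm M g" if "g \<in> borel_measurable M"
proof -
  have "(\<integral>\<^sup>+z. ennreal ((cmod (c * g z))\<^sup>2) \<partial>M) = ennreal ((cmod c)\<^sup>2) * (\<integral>\<^sup>+z. ennreal ((cmod (g z))\<^sup>2) \<partial>M)"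
    using that by (subst nn_integral_cmult[symmetric]) (auto simp: norm_mult power_mult_distrib ennreal_mult)
  then show ?thesis by (simp add: l2_norm_def enn2real_mult real_sqrt_mult)
qed

text \<open>Minkowski's inequality, by expanding the square and applying the Cauchy-Schwarz inequality to the mixed term.\<close>

lemma l2_norm_triangle:
  assumes [measurable]: "f \<in> borel_measurable M" "g \<in> borel_measurable M"
    and f: "(\<integral>\<^sup>+z. ennreal ((cmod (f z))\<^sup>2) \<partial>M) < \<infinity>" and g: "(\<integral>\<^sup>+z. ennreal ((cmod (g z))\<^sup>2) \<partial>M) < \<infinity>"
  shows "(\<integral>\<^sup>+z. ennreal ((cmod (f z + g z))\<^sup>2) \<partial>M) < \<infinity>" "l2_norm M (\<lambda>z. f z + g z) \<le> l2_norm M f + l2_norm M g"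
proof -
  define a where "a = l2_norm M f"
  define b where "b = l2_norm M g"
  have ab: "0 \<le> a" "0 \<le> b" by (auto simp: a_def b_def)
  define P where "P = (\<integral>\<^sup>+z. ennreal (cmod (f z)) * ennreal (cmod (g z)) \<partial>M)"
  have "P\<^sup>2 \<le> (\<integral>\<^sup>+z. ennreal (cmod (f z)) ^ 2 \<partial>M) * (\<integral>\<^sup>+z. ennreal (cmod (g z)) ^ 2 \<partial>M)"
    unfolding P_def by (rule Cauchy_Schwarz_nn_integral) auto
  also have "\<dots> = ennreal ((a * b)\<^sup>2)"
    unfolding a_def b_def using l2_norm_sq[OF f] l2_norm_sq[OF g]
    by (simp add: ennreal_power power_mult_distrib flip: ennreal_mult)
  finally have P2: "P\<^sup>2 \<le> ennreal ((a * b)\<^sup>2)" .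
  have P: "P \<le> ennreal (a * b)"
  proof (cases P)
    case (real p)
    then have "p\<^sup>2 \<le> (a * b)\<^sup>2" using P2 by (simp add: ennreal_power)
    then have "p \<le> a * b" by (rule power2_le_imp_le) (use ab in auto)
    then show ?thesis using real by (simp add: ennreal_leI)
  next
    case top
    then show ?thesis using P2 by (simp add: power2_eq_square top_unique ennreal_top_mult)
  qed
  have "(\<integral>\<^sup>+z. ennreal ((cmod (f z + g z))\<^sup>2) \<partial>M) \<le> (\<integral>\<^sup>+z. ennreal ((cmod (f z))\<^sup>2) + ennreal ((cmod (g z))\<^sup>2) + 2 * (ennreal (cmod (f z)) * ennreal (cmod (g z))) \<partial>M)"
  proof (rule nn_integral_mono)
    fix z
    have "(cmod (f z + g z))\<^sup>2 \<le> (cmod (f z) + cmod (g z))\<^sup>2" by (intro power_mono norm_triangle_ineq) auto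
    also have "\<dots> = (cmod (f z))\<^sup>2 + (cmod (g z))\<^sup>2 + 2 * (cmod (f z) * cmod (g z))" by (simp add: power2_sum)
    finally have "ennreal ((cmod (f z + g z))\<^sup>2) \<le> ennreal ((cmod (f z))\<^sup>2 + (cmod (g z))\<^sup>2 + 2 * (cmod (f z) * cmod (g z)))"
      by (rule ennreal_leI)
    also have "\<dots> = ennreal ((cmod (f z))\<^sup>2) + ennreal ((cmod (g z))\<^sup>2) + 2 * (ennreal (cmod (f z)) * ennreal (cmod (g z)))"
      by (simp add: ennreal_plus ennreal_mult)
    finally show "ennreal ((cmod (f z + g z))\<^sup>2) \<le> ennreal ((cmod (f z))\<^sup>2) + ennreal ((cmod (g z))\<^sup>2) + 2 * (ennreal (cmod (f z)) * ennreal (cmod (g z)))" .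
  qed
  also have "\<dots> = ennreal (a\<^sup>2) + ennreal (b\<^sup>2) + 2 * P"
    unfolding a_def b_def P_def l2_norm_sq[OF f, symmetric] l2_norm_sq[OF g, symmetric]
    by (simp add: nn_integral_add nn_integral_cmult)
  also have "\<dots> \<le> ennreal (a\<^sup>2) + ennreal (b\<^sup>2) + 2 * ennreal (a * b)" using P by (intro add_left_mono mult_left_mono) auto
  also have "\<dots> = ennreal ((a + b)\<^sup>2)" using ab by (simp add: power2_sum ennreal_plus ennreal_mult mult_ac)
  finally have le: "(\<integral>\<^sup>+z. ennreal ((cmod (f z + g z))\<^sup>2) \<partial>M) \<le> ennreal ((a + b)\<^sup>2)" .
  show fin: "(\<integral>\<^sup>+z. ennreal ((cmod (f z + g z))\<^sup>2) \<partial>M) < \<infinity>" using le by (rule le_less_trans) simp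
  have "(l2_norm M (\<lambda>z. f z + g z))\<^sup>2 \<le> (a + b)\<^sup>2" using le unfolding l2_norm_sq[OF fin] by simp
  then show "l2_norm M (\<lambda>z. f z + g z) \<le> l2_norm M f + l2_norm M g"
    using ab unfolding a_def b_def by (meson add_nonneg_nonneg power2_le_imp_le)
qed

section \<open>The weighted area measure\<close>

lemma sets_dA [simp, measurable_cong]: "sets dA = sets borel" by (simp add: dA_def)
lemma sets_dA_weighted [simp, measurable_cong]: "sets (dA_weighted \<alpha>) = sets borel" by (simp add: dA_weighted_def)
lemma space_dA_weighted [simp]: "space (dA_weighted \<alpha>) = UNIV"
  by (simp add: dA_weighted_def dA_def)

lemma emeasure_disk: "r \<ge> 0 \<Longrightarrow> emeasure lborel (ball (0::complex) r) = ennreal (pi * r\<^sup>2)"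
  by (simp add: emeasure_ball unit_ball_vol_2)

lemma nn_integral_dA:
  assumes [measurable]: "f \<in> borel_measurable borel"
  shows "(\<integral>\<^sup>+z. f z \<partial>dA) = (\<integral>\<^sup>+z. f z * indicator unit_disk z \<partial>lborel) / ennreal pi"
  unfolding dA_def by (subst nn_integral_uniform_measure) (auto simp: emeasure_disk)

lemma nn_integral_dA_weighted:
  assumes [measurable]: "f \<in> borel_measurable borel"
  shows "(\<integral>\<^sup>+z. f z \<partial>dA_weighted \<alpha>)
    = (\<integral>\<^sup>+z. ennreal ((1 + \<alpha>) * (1 - (cmod z)\<^sup>2) powr \<alpha>) * f z * indicator unit_disk z \<partial>lborel) / ennreal pi"
  unfolding dA_weighted_def by (subst nn_integral_density) (auto simp: nn_integral_dA)

lemma AE_dA_disk: "AE z in dA. z \<in> unit_disk"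
  unfolding dA_def by (rule AE_uniform_measureI) auto

lemma AE_dA_weighted_disk: "AE z in dA_weighted \<alpha>. z \<in> unit_disk"
  unfolding dA_weighted_def using AE_dA_disk by (subst AE_density) auto

text \<open>Where \<open>1 - \<bar>z\<bar>\<close> lies between \<open>(1/2)\<^sup>n\<^sup>+\<^sup>1\<close> and \<open>(1/2)\<^sup>n\<close>, the weight is at most \<open>2 powr (\<beta> * (n + 1))\<close> with \<open>\<beta> = max 0 (- \<alpha>) < 1\<close>, and this region lies in an annulus of area at most \<open>2 \<pi> (1/2)\<^sup>n\<close>. The integral is thus dominated by a geometric series of ratio \<open>2 powr (\<beta> - 1)\<close>.\<close>

lemma nn_integral_weight_finite:
  assumes "\<alpha> > -1"
  shows "(\<integral>\<^sup>+z. ennreal ((1 - (cmod z)\<^sup>2) powr \<alpha>) * indicator unit_disk z \<partial>lborel) < \<infinity>"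
proof -
  \<comment> \<open>for \<open>\<alpha> \<ge> 0\<close> the weight is bounded, which is the case \<open>\<beta> = 0\<close> of the estimate\<close>
  define \<beta> where "\<beta> = max 0 (- \<alpha>)"
  have \<beta>: "0 \<le> \<beta>" "\<beta> < 1" "- \<beta> \<le> \<alpha>" using assms by (auto simp: \<beta>_def)
  define E where "E n = ball (0::complex) 1 - ball 0 (1 - (1/2) ^ n)" for n :: nat
  have [measurable]: "E n \<in> sets borel" for n unfolding E_def by auto
  have eE: "emeasure lborel (E n) \<le> ennreal (2 * pi * (1/2) ^ n)" for n
  proof -
    have h: "0 \<le> 1 - (1/2::real) ^ n" by (simp add: power_le_one)
    have "emeasure lborel (E n) = emeasure lborel (ball (0::complex) 1) - emeasure lborel (ball (0::complex) (1 - (1/2) ^ n))"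
      unfolding E_def
    proof (rule emeasure_Diff)
      show "emeasure lborel (ball (0::complex) (1 - (1/2) ^ n)) \<noteq> \<infinity>" unfolding emeasure_disk[OF h] by simp
      show "ball (0::complex) (1 - (1/2) ^ n) \<subseteq> ball 0 1" by (intro subset_ball) simp
    qed auto
    also have "\<dots> = ennreal (pi - pi * (1 - (1/2)^n)\<^sup>2)"
      using h by (simp add: emeasure_disk ennreal_minus)
    also have "\<dots> \<le> ennreal (2 * pi * (1/2) ^ n)"
    proof (rule ennreal_leI)
      have "pi - pi * (1 - (1/2::real)^n)\<^sup>2 = 2 * pi * (1/2)^n - pi * ((1/2::real)^n)\<^sup>2" by (simp add: power2_diff algebra_simps)
      then show "pi - pi * (1 - (1/2::real)^n)\<^sup>2 \<le> 2 * pi * (1/2) ^ n" by simp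
    qed
    finally show ?thesis .
  qed
  define c where "c n = (2 powr \<beta>) ^ Suc n" for n
  have pt: "ennreal ((1 - (cmod z)\<^sup>2) powr \<alpha>) * indicator unit_disk z \<le> (\<Sum>n. ennreal (c n) * indicator (E n) z)" for z
  proof (cases "z \<in> unit_disk")
    case True
    define s where "s = 1 - cmod z"
    have s: "0 < s" "s \<le> 1" using True by (auto simp: s_def)
    have ex: "\<exists>n. (1/2::real) ^ Suc n < s" 
    proof -
      obtain n where "(1/2::real) ^ n < s" using real_arch_pow_inv[of s "1/2"] s by auto
      moreover have "(1/2::real) ^ Suc n \<le> (1/2) ^ n" by simp
      ultimately show ?thesis by (intro exI[of _ n]) linarith
    qed
    define n where "n = (LEAST n. (1/2::real) ^ Suc n < s)"
    have n1: "(1/2::real) ^ Suc n < s" unfolding n_def using ex by (rule LeastI_ex)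
    have n2: "s \<le> (1/2) ^ n"
    proof (cases n)
      case (Suc m)
      then have "\<not> (1/2::real) ^ Suc m < s" using not_less_Least[of m "\<lambda>n. (1/2::real) ^ Suc n < s"] by (simp add: n_def)
      then show ?thesis using Suc by simp
    qed (use s in simp)
    have zE: "z \<in> E n" using True n2 by (auto simp: E_def s_def)
    have "s \<le> 1 - (cmod z)\<^sup>2"
    proof -
      have "cmod z * cmod z \<le> cmod z * 1" using True by (intro mult_left_mono) auto
      then show ?thesis by (simp add: s_def power2_eq_square)
    qed
    then have b: "0 < 1 - (cmod z)\<^sup>2" "1 - (cmod z)\<^sup>2 \<le> 1" "(1/2) ^ Suc n \<le> 1 - (cmod z)\<^sup>2" using s n1 by auto
    have "(1 - (cmod z)\<^sup>2) powr \<alpha> \<le> (1 - (cmod z)\<^sup>2) powr (- \<beta>)"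
      using b \<beta> by (intro powr_mono') auto
    also have "\<dots> \<le> ((1/2) ^ Suc n) powr (- \<beta>)"
      using b \<beta> by (intro powr_mono2') auto
    also have "\<dots> = c n"
    proof -
      have "(1/2::real) ^ Suc n = 2 powr (- real (Suc n))"
        unfolding powr_minus by (subst powr_realpow) (simp_all add: power_one_over inverse_eq_divide)
      moreover have "c n = (2 powr \<beta>) powr real (Suc n)" unfolding c_def by (subst powr_realpow) simp_all
      ultimately show ?thesis unfolding powr_powr by (simp only: powr_powr mult.commute minus_mult_minus)
    qed
    finally have "ennreal ((1 - (cmod z)\<^sup>2) powr \<alpha>) * indicator unit_disk z \<le> ennreal (c n) * indicator (E n) z"
      using True zE by (simp add: ennreal_leI)
    also have "\<dots> \<le> (\<Sum>n. ennreal (c n) * indicator (E n) z)"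
      using sum_le_suminf[of "\<lambda>n. ennreal (c n) * indicator (E n) z" "{n}"] zE by (simp del: sum_mult_indicator)
    finally show ?thesis .
  qed simp
  have "(\<integral>\<^sup>+z. ennreal ((1 - (cmod z)\<^sup>2) powr \<alpha>) * indicator unit_disk z \<partial>lborel)
      \<le> (\<integral>\<^sup>+z. (\<Sum>n. ennreal (c n) * indicator (E n) z) \<partial>lborel)" by (intro nn_integral_mono pt)
  also have "\<dots> = (\<Sum>n. ennreal (c n) * emeasure lborel (E n))"
    by (subst nn_integral_suminf) (auto simp: nn_integral_cmult_indicator)
  also have "\<dots> \<le> (\<Sum>n. ennreal (2 * pi * 2 powr \<beta> * (2 powr (\<beta> - 1)) ^ n))"
  proof (intro suminf_le allI)
    fix n
    have "ennreal (c n) * emeasure lborel (E n) \<le> ennreal (c n) * ennreal (2 * pi * (1/2) ^ n)"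
      using eE by (rule mult_left_mono) simp
    also have "\<dots> = ennreal (2 * pi * 2 powr \<beta> * (2 powr (\<beta> - 1)) ^ n)"
      by (simp add: c_def powr_diff power_divide power_one_over divide_simps flip: ennreal_mult)
    finally show "ennreal (c n) * emeasure lborel (E n) \<le> \<dots>" .
  qed auto
  also have "\<dots> < \<infinity>"
  proof -
    have "2 powr (\<beta> - 1) < (1::real)" using \<beta> by (simp add: powr_less_one)
    then have "summable (\<lambda>n. 2 * pi * 2 powr \<beta> * (2 powr (\<beta> - 1)) ^ n)"
      by (intro summable_mult summable_geometric) simp
    then show ?thesis by (subst suminf_ennreal2) auto
  qed
  finally show ?thesis .
qed

lemma finite_dA_weighted:
  assumes "\<alpha> > -1" shows "finite_measure (dA_weighted \<alpha>)"
proof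
  have "emeasure (dA_weighted \<alpha>) (space (dA_weighted \<alpha>)) = (\<integral>\<^sup>+z. 1 \<partial>dA_weighted \<alpha>)" by simp
  also have "\<dots> = ennreal (1 + \<alpha>) * (\<integral>\<^sup>+z. ennreal ((1 - (cmod z)\<^sup>2) powr \<alpha>) * indicator unit_disk z \<partial>lborel) / ennreal pi"
    using assms by (subst nn_integral_cmult[symmetric], measurable, subst nn_integral_dA_weighted)
      (auto simp: ennreal_mult' mult.assoc)
  also have "\<dots> < \<infinity>"
    using nn_integral_weight_finite[OF assms] by (auto simp: ennreal_divide_eq_top_iff ennreal_mult_eq_top_iff less_top[symmetric])
  finally show "emeasure (dA_weighted \<alpha>) (space (dA_weighted \<alpha>)) \<noteq> \<infinity>" by simp
qed

lemma dA_weighted_annulus_pos: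
  assumes "\<alpha> > -1" "0 < \<rho>" "\<rho> < 1"
  shows "0 < emeasure (dA_weighted \<alpha>) (- ball 0 \<rho>)"
proof (rule ccontr)
  have [measurable]: "- ball (0::complex) \<rho> \<in> sets borel" by auto
  assume "\<not> ?thesis"
  then have "(\<integral>\<^sup>+z. indicator (- ball 0 \<rho>) z \<partial>dA_weighted \<alpha>) = 0" by simp
  then have "(\<integral>\<^sup>+z. ennreal ((1 + \<alpha>) * (1 - (cmod z)\<^sup>2) powr \<alpha>) * indicator (- ball 0 \<rho>) z * indicator unit_disk z \<partial>lborel) = 0"
    by (subst (asm) nn_integral_dA_weighted) (auto simp: ennreal_divide_eq_0_iff)
  moreover have "(\<lambda>z. ennreal ((1 + \<alpha>) * (1 - (cmod z)\<^sup>2) powr \<alpha>) * indicator (- ball 0 \<rho>) z * indicator unit_disk z) \<in> borel_measurable lborel"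
    by measurable
  ultimately have "AE z in lborel. ennreal ((1 + \<alpha>) * (1 - (cmod z)\<^sup>2) powr \<alpha>) * indicator (- ball 0 \<rho>) z * indicator unit_disk z = 0"
    by (simp only: nn_integral_0_iff_AE)
  then have "AE z in lborel. z \<notin> unit_disk - ball 0 \<rho>"
  proof eventually_elim
    case (elim z)
    show ?case
    proof
      assume z: "z \<in> unit_disk - ball 0 \<rho>"
      then have "(cmod z)\<^sup>2 < 1" by (auto simp: power_less_one_iff abs_square_less_1)
      then have "0 < (1 + \<alpha>) * (1 - (cmod z)\<^sup>2) powr \<alpha>" using assms by simp
      then show False using elim z by (auto simp: ennreal_eq_0_iff)
    qed
  qed
  then have "emeasure lborel (unit_disk - ball 0 \<rho>) = 0"
    using AE_iff_measurable[of "unit_disk - ball 0 \<rho>" lborel "\<lambda>z. z \<notin> unit_disk - ball 0 \<rho>"]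
    by (simp del: mem_ball_0 Diff_iff)
  moreover have "emeasure lborel (unit_disk - ball (0::complex) \<rho>) = ennreal (pi - pi * \<rho>\<^sup>2)"
  proof -
    have "emeasure lborel (unit_disk - ball (0::complex) \<rho>) = emeasure lborel (ball (0::complex) 1) - emeasure lborel (ball (0::complex) \<rho>)"
      by (rule emeasure_Diff) (use assms in \<open>auto simp: emeasure_disk\<close>)
    then show ?thesis using assms by (simp add: emeasure_disk ennreal_minus)
  qed
  moreover have "0 < pi - pi * \<rho>\<^sup>2"
    using assms by (simp add: abs_square_less_1 power_less_one_iff)
  ultimately show False by simp
qed

text \<open>Rotations are injective holomorphic maps with derivative of modulus one, and the weight is radial.\<close>

lemma dA_weighted_rotation:
  assumes c: "cmod c = 1"
  shows "distr (dA_weighted \<alpha>) borel (\<lambda>z. c * z) = dA_weighted \<alpha>"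
proof (rule measure_eqI)
  fix A assume "A \<in> sets (distr (dA_weighted \<alpha>) borel (\<lambda>z. c * z))"
  then have [measurable]: "A \<in> sets borel" by simp
  define w where "w = (\<lambda>z. ennreal ((1 + \<alpha>) * (1 - (cmod z)\<^sup>2) powr \<alpha>) * indicator A z)"
  have [measurable]: "w \<in> borel_measurable borel" unfolding w_def by measurable
  have im: "(\<lambda>z. c * z) ` unit_disk = unit_disk"
  proof (intro equalityI subsetI)
    fix z assume "z \<in> unit_disk"
    moreover have "c \<noteq> 0" using c by auto
    ultimately show "z \<in> (\<lambda>z. c * z) ` unit_disk" using c
      by (intro image_eqI[of _ _ "z / c"]) (auto simp: norm_divide)
  qed (use c in \<open>auto simp: norm_mult\<close>)
  have d: "deriv (\<lambda>z. c * z) z = c" for z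
    by (rule DERIV_imp_deriv) (auto intro!: derivative_eq_intros)
  have c0: "c \<noteq> 0" using c by auto
  have "emeasure (distr (dA_weighted \<alpha>) borel (\<lambda>z. c * z)) A = (\<integral>\<^sup>+z. indicator A z \<partial>distr (dA_weighted \<alpha>) borel (\<lambda>z. c * z))" by simp
  also have "\<dots> = (\<integral>\<^sup>+z. indicator A (c * z) \<partial>dA_weighted \<alpha>)" by (subst nn_integral_distr) auto
  also have "\<dots> = (\<integral>\<^sup>+z. w (c * z) * indicator unit_disk z \<partial>lborel) / ennreal pi"
    by (subst nn_integral_dA_weighted) (auto simp: w_def norm_mult c)
  also have "(\<integral>\<^sup>+z. w (c * z) * indicator unit_disk z \<partial>lborel) = (\<integral>\<^sup>+z. w z * indicator ((\<lambda>z. c * z) ` unit_disk) z \<partial>lborel)"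
    by (subst nn_integral_holomorphic_injective[where \<phi>="\<lambda>z. c * z" and U=unit_disk and M=1 and F=w, symmetric])
       (auto simp: d c c0 inj_on_def intro!: holomorphic_intros)
  also have "\<dots> / ennreal pi = (\<integral>\<^sup>+z. indicator A z \<partial>dA_weighted \<alpha>)"
    by (subst nn_integral_dA_weighted) (auto simp: w_def im)
  finally show "emeasure (distr (dA_weighted \<alpha>) borel (\<lambda>z. c * z)) A = emeasure (dA_weighted \<alpha>) A" by simp
qed simp

section \<open>Orthogonality in the Bergman space\<close>

text \<open>Expansions are used without reference to how the coefficients arise: for a function with some coefficients removed, or for a polynomial, the new sequence is explicit, whereas higher derivatives would have to be computed.\<close>

definition has_coeffs :: "(nat \<Rightarrow> complex) \<Rightarrow> (complex \<Rightarrow> complex) \<Rightarrow> bool" where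
  "has_coeffs e h \<longleftrightarrow> (\<forall>z\<in>unit_disk. (\<lambda>k. e k * z ^ k) sums h z)"

text \<open>The square of the Bergman norm, with values in the extended reals so that it is defined for all functions. It depends only on the values on the disk.\<close>

definition energy :: "real \<Rightarrow> (complex \<Rightarrow> complex) \<Rightarrow> ennreal" where
  "energy \<alpha> g = (\<integral>\<^sup>+z. ennreal ((cmod (g z))\<^sup>2) \<partial>dA_weighted \<alpha>)"

lemma energy_cong: "(\<And>z. z \<in> unit_disk \<Longrightarrow> f z = g z) \<Longrightarrow> energy \<alpha> f = energy \<alpha> g"
  unfolding energy_def using AE_dA_weighted_disk[of \<alpha>] by (intro nn_integral_cong_AE) (auto elim!: eventually_mono)

lemma borel_measurable_cnj [measurable (raw)]:
  "f \<in> borel_measurable M \<Longrightarrow> (\<lambda>x. cnj (f x)) \<in> borel_measurable M"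
  by (rule measurable_compose[OF _ borel_measurable_continuous_onI]) (auto intro!: continuous_intros)

lemma has_coeffs_holomorphic: "has_coeffs e h \<Longrightarrow> h holomorphic_on unit_disk"
  unfolding has_coeffs_def by (rule power_series_holomorphic[where z=0 and a=e]) simp

lemma holomorphic_has_coeffs:
  assumes "g holomorphic_on unit_disk"
  shows "has_coeffs (\<lambda>k. (deriv ^^ k) g 0 / fact k) g"
  using holomorphic_power_series[OF assms] unfolding has_coeffs_def by simp

lemma has_coeffs_remove:
  assumes "has_coeffs e g" "finite A"
  shows "has_coeffs (\<lambda>k. if k \<in> A then 0 else e k) (\<lambda>z. g z - (\<Sum>k\<in>A. e k * z ^ k))"
  unfolding has_coeffs_def
proof
  fix z :: complex assume "z \<in> unit_disk"
  then have "(\<lambda>k. e k * z ^ k) sums g z" using assms by (auto simp: has_coeffs_def)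
  from sums_diff[OF this sums_If_finite_set[OF assms(2), of "\<lambda>k. e k * z ^ k"]]
  show "(\<lambda>k. (if k \<in> A then 0 else e k) * z ^ k) sums (g z - (\<Sum>k\<in>A. e k * z ^ k))"
    by (rule sums_cong[THEN iffD1, rotated]) simp
qed

lemma has_coeffs_poly:
  assumes "finite A" shows "has_coeffs (\<lambda>k. if k \<in> A then b k else 0) (\<lambda>z. \<Sum>k\<in>A. b k * z ^ k)"
  unfolding has_coeffs_def
proof
  fix z :: complex
  show "(\<lambda>k. (if k \<in> A then b k else 0) * z ^ k) sums (\<Sum>k\<in>A. b k * z ^ k)"
    using sums_If_finite_set[OF assms, of "\<lambda>k. b k * z ^ k"] by (rule sums_cong[THEN iffD1, rotated]) simp
qed

lemma has_coeffs_summable: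
  assumes "has_coeffs e h" "0 \<le> r" "r < 1"
  shows "summable (\<lambda>k. cmod (e k) * r ^ k)"
proof -
  define x where "x = complex_of_real ((1 + r) / 2)"
  have nx: "cmod x = (1 + r) / 2" unfolding x_def norm_of_real using assms by simp
  then have "x \<in> unit_disk" using assms by simp
  then have "summable (\<lambda>k. e k * x ^ k)" using assms by (auto simp: has_coeffs_def sums_iff)
  then have "summable (\<lambda>k. norm (e k * complex_of_real r ^ k))"
    by (rule powser_insidea) (use assms nx in auto)
  then show ?thesis using assms by (simp add: norm_mult norm_power)
qed

lemma has_coeffs_norm_bound:
  assumes "has_coeffs e h" "0 \<le> r" "r < 1" "cmod z \<le> r"
  shows "cmod (h z) \<le> (\<Sum>k. cmod (e k) * r ^ k)"
proof -
  have "z \<in> unit_disk" using assms by auto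
  then have h: "h z = (\<Sum>k. e k * z ^ k)" using assms by (auto simp: has_coeffs_def sums_iff)
  have le: "norm (e k * z ^ k) \<le> cmod (e k) * r ^ k" for k
    using assms by (auto simp: norm_mult norm_power intro!: mult_left_mono power_mono)
  have s: "summable (\<lambda>k. norm (e k * z ^ k))"
    by (rule summable_comparison_test'[OF has_coeffs_summable[OF assms(1-3)]]) (use le in auto)
  have "norm (\<Sum>k. e k * z ^ k) \<le> (\<Sum>k. norm (e k * z ^ k))" by (rule summable_norm[OF s])
  also have "\<dots> \<le> (\<Sum>k. cmod (e k) * r ^ k)"
    by (rule suminf_le[OF le s has_coeffs_summable[OF assms(1-3)]])
  finally show ?thesis unfolding h .
qed

lemma holomorphic_on_disk_borel:
  "h holomorphic_on unit_disk \<Longrightarrow> (\<lambda>z. indicator unit_disk z *\<^sub>R h z) \<in> borel_measurable borel"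
  using holomorphic_on_imp_continuous_on by (intro borel_measurable_continuous_on_indicator) auto

lemma holomorphic_on_ball_borel:
  assumes "h holomorphic_on unit_disk" "r \<le> 1"
  shows "(\<lambda>z. indicator (ball 0 r) z *\<^sub>R h z) \<in> borel_measurable borel"
proof -
  have "ball (0::complex) r \<subseteq> unit_disk" using assms by auto
  then show ?thesis
    using holomorphic_on_imp_continuous_on[OF holomorphic_on_subset[OF assms(1)]]
    by (intro borel_measurable_continuous_on_indicator) auto
qed

text \<open>Rotation by \<open>c\<close> multiplies the integral by \<open>c\<^sup>m\<^sup>-\<^sup>k\<close> and leaves it unchanged; \<open>c\<close> can be chosen with \<open>c\<^sup>m\<^sup>-\<^sup>k = -1\<close>.\<close>

lemma monomials_orthogonal:
  fixes r \<alpha> :: real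
  assumes "k \<noteq> m"
  shows "(\<integral>z. indicator (ball 0 r) z *\<^sub>R (cnj (z ^ k) * z ^ m) \<partial>dA_weighted \<alpha>) = 0"
proof -
  define f where "f = (\<lambda>z::complex. indicator (ball 0 r) z *\<^sub>R (cnj (z ^ k) * z ^ m))"
  have [measurable]: "f \<in> borel_measurable borel"
    unfolding f_def by (intro borel_measurable_continuous_on_indicator continuous_intros) auto
  define d where "d = real m - real k"
  have d: "d \<noteq> 0" using assms by (simp add: d_def)
  \<comment> \<open>\<open>d\<close> may be negative; all that matters is \<open>c\<^sup>m\<^sup>-\<^sup>k = cis \<pi> = -1\<close>\<close>
  define c where "c = cis (pi / d)"
  have c1: "cmod c = 1" by (simp add: c_def)
  have cm: "c ^ m = cis (real m * (pi / d))" unfolding c_def by (rule Complex.DeMoivre)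
  have ck: "cnj (c ^ k) = cis (- (real k * (pi / d)))" unfolding c_def Complex.DeMoivre by (rule cis_cnj)
  have "cnj (c ^ k) * c ^ m = cis (real m * (pi / d) - real k * (pi / d))"
    unfolding cm ck cis_mult by (rule arg_cong[of _ _ cis]) simp
  also have "real m * (pi / d) - real k * (pi / d) = d * (pi / d)" by (simp only: left_diff_distrib[symmetric] d_def)
  also have "d * (pi / d) = pi" using d by simp
  finally have cc: "cnj (c ^ k) * c ^ m = - 1" by simp
  have fc: "f (c * z) = - f z" for z
  proof -
    have "cnj ((c * z) ^ k) * (c * z) ^ m = (cnj (c ^ k) * c ^ m) * (cnj (z ^ k) * z ^ m)"
      by (simp add: power_mult_distrib mult_ac)
    moreover have "(c * z \<in> ball 0 r) = (z \<in> ball 0 r)" using c1 by (simp add: norm_mult)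
    ultimately show ?thesis unfolding f_def cc by (simp add: indicator_def)
  qed
  have "(\<integral>z. f z \<partial>dA_weighted \<alpha>) = (\<integral>z. f z \<partial>distr (dA_weighted \<alpha>) borel (\<lambda>z. c * z))"
    by (simp add: dA_weighted_rotation[OF c1])
  also have "\<dots> = (\<integral>z. f (c * z) \<partial>dA_weighted \<alpha>)" by (rule integral_distr) auto
  also have "\<dots> = - (\<integral>z. f z \<partial>dA_weighted \<alpha>)" unfolding fc by simp
  finally show ?thesis unfolding f_def by simp
qed

context
  fixes \<alpha> :: real assumes \<alpha>: "\<alpha> > -1"
begin

interpretation finite_measure "dA_weighted \<alpha>" by (rule finite_dA_weighted[OF \<alpha>])

text \<open>On a disk of radius below one the power series converges absolutely and uniformly, so it may be integrated term by term.\<close>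

lemma monomial_orthogonal_series:
  assumes h: "has_coeffs e h" and ek: "e k = 0" and r: "0 \<le> r" "r < 1"
  shows "(\<integral>z. indicator (ball 0 r) z *\<^sub>R (cnj (z ^ k) * h z) \<partial>dA_weighted \<alpha>) = 0"
proof -
  define f where "f = (\<lambda>i z. indicator (ball 0 r) z *\<^sub>R (cnj (z ^ k) * (e i * z ^ i)))"
  have meas: "f i \<in> borel_measurable (dA_weighted \<alpha>)" for i
  proof -
    have "f i \<in> borel_measurable borel"
      unfolding f_def by (intro borel_measurable_continuous_on_indicator continuous_intros) auto
    then show ?thesis by simp
  qed
  have bd: "norm (f i z) \<le> cmod (e i) * r ^ i" for i z
  proof (cases "z \<in> ball 0 r")
    case True
    then have "cmod z ^ k \<le> 1" "cmod z ^ i \<le> r ^ i" using r by (auto intro!: power_le_one power_mono)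
    then have "cmod z ^ k * (cmod (e i) * cmod z ^ i) \<le> 1 * (cmod (e i) * r ^ i)"
      by (intro mult_mono) auto
    then show ?thesis using True by (simp add: f_def norm_mult norm_power)
  qed (use r in \<open>simp add: f_def\<close>)
  have int: "integrable (dA_weighted \<alpha>) (f i)" for i
    using bd by (intro integrable_const_bound[OF _ meas]) auto
  have s: "summable (\<lambda>i. cmod (e i) * r ^ i)" by (rule has_coeffs_summable[OF h r])
  have "(\<lambda>i. integral\<^sup>L (dA_weighted \<alpha>) (f i)) sums (\<integral>z. (\<Sum>i. f i z) \<partial>dA_weighted \<alpha>)"
  proof (rule sums_integral[OF int])
    show "AE z in dA_weighted \<alpha>. summable (\<lambda>i. norm (f i z))"
      using bd by (intro AE_I2 summable_comparison_test'[OF s]) auto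
    show "summable (\<lambda>i. \<integral>z. norm (f i z) \<partial>dA_weighted \<alpha>)"
    proof (rule summable_comparison_test'[OF summable_mult[OF s, of "measure (dA_weighted \<alpha>) UNIV"]])
      fix i
      have "(\<integral>z. norm (f i z) \<partial>dA_weighted \<alpha>) \<le> (\<integral>z. cmod (e i) * r ^ i \<partial>dA_weighted \<alpha>)"
        using int bd by (intro integral_mono) auto
      then show "norm (\<integral>z. norm (f i z) \<partial>dA_weighted \<alpha>) \<le> measure (dA_weighted \<alpha>) UNIV * (cmod (e i) * r ^ i)"
        by (simp add: mult_ac)
    qed
  qed
  moreover have "integral\<^sup>L (dA_weighted \<alpha>) (f i) = 0" for i
  proof (cases "i = k")
    case False
    have "f i = (\<lambda>z. e i * (indicator (ball 0 r) z *\<^sub>R (cnj (z ^ k) * z ^ i)))"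
      by (auto simp: f_def indicator_def)
    then have "integral\<^sup>L (dA_weighted \<alpha>) (f i) = e i * (\<integral>z. indicator (ball 0 r) z *\<^sub>R (cnj (z ^ k) * z ^ i) \<partial>dA_weighted \<alpha>)"
      by (simp only: integral_mult_right_zero)
    then show ?thesis using monomials_orthogonal[of k i \<alpha> r] False by simp
  qed (simp add: f_def ek)
  ultimately have "(\<integral>z. (\<Sum>i. f i z) \<partial>dA_weighted \<alpha>) = 0" by (simp add: sums_iff)
  also have "(\<integral>z. (\<Sum>i. f i z) \<partial>dA_weighted \<alpha>) = (\<integral>z. indicator (ball 0 r) z *\<^sub>R (cnj (z ^ k) * h z) \<partial>dA_weighted \<alpha>)"
  proof (rule Bochner_Integration.integral_cong[OF refl])
    fix z
    show "(\<Sum>i. f i z) = indicator (ball 0 r) z *\<^sub>R (cnj (z ^ k) * h z)"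
    proof (cases "z \<in> ball 0 r")
      case True
      then have "z \<in> unit_disk" using r by auto
      then have "(\<lambda>i. e i * z ^ i) sums h z" using h by (auto simp: has_coeffs_def)
      from sums_mult[OF this, of "cnj (z ^ k)"] show ?thesis using True by (simp add: f_def sums_iff)
    qed (simp add: f_def)
  qed
  finally show ?thesis .
qed

text \<open>The mixed term in the expansion of \<open>\<bar>p + h\<bar>\<^sup>2\<close> is a finite combination of the integrals that vanish by orthogonality.\<close>

lemma pythagoras_ball:
  fixes b :: "nat \<Rightarrow> complex"
  assumes A: "finite A" and h: "has_coeffs e h" and e: "\<And>k. k \<in> A \<Longrightarrow> e k = 0" and r: "0 \<le> r" "r < 1"
  defines "p \<equiv> (\<lambda>z. \<Sum>k\<in>A. b k * z ^ k)"
  shows "(\<integral>\<^sup>+z. ennreal ((cmod (p z + h z))\<^sup>2) * indicator (ball 0 r) z \<partial>dA_weighted \<alpha>)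
    = (\<integral>\<^sup>+z. ennreal ((cmod (p z))\<^sup>2) * indicator (ball 0 r) z \<partial>dA_weighted \<alpha>)
      + (\<integral>\<^sup>+z. ennreal ((cmod (h z))\<^sup>2) * indicator (ball 0 r) z \<partial>dA_weighted \<alpha>)"
proof -
  define P where "P = (\<lambda>z. indicator (ball 0 r) z *\<^sub>R p z)"
  define H where "H = (\<lambda>z. indicator (ball 0 r) z *\<^sub>R h z)"
  have pc: "has_coeffs (\<lambda>k. if k \<in> A then b k else 0) p" unfolding p_def by (rule has_coeffs_poly[OF A])
  have "P \<in> borel_measurable borel" "H \<in> borel_measurable borel" unfolding P_def H_def
    using holomorphic_on_ball_borel has_coeffs_holomorphic pc h r by auto
  then have [measurable]: "P \<in> borel_measurable (dA_weighted \<alpha>)" "H \<in> borel_measurable (dA_weighted \<alpha>)" by auto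
  have "\<exists>C. \<forall>z. cmod (P z) \<le> C"
    using has_coeffs_norm_bound[OF pc r]
    by (intro exI[of _ "\<Sum>k. cmod (if k \<in> A then b k else 0) * r ^ k"])
       (auto simp: P_def indicator_def intro!: suminf_nonneg has_coeffs_summable[OF pc r] mult_nonneg_nonneg zero_le_power r)
  then obtain C where C: "\<And>z. cmod (P z) \<le> C" by blast
  have "\<exists>C. \<forall>z. cmod (H z) \<le> C"
    using has_coeffs_norm_bound[OF h r]
    by (intro exI[of _ "\<Sum>k. cmod (e k) * r ^ k"])
       (auto simp: H_def indicator_def intro!: suminf_nonneg has_coeffs_summable[OF h r] mult_nonneg_nonneg zero_le_power r)
  then obtain C' where C': "\<And>z. cmod (H z) \<le> C'" by blast
  have C0: "0 \<le> C" using C[of 0] norm_ge_zero order_trans by blast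
  have i1: "integrable (dA_weighted \<alpha>) (\<lambda>z. (cmod (P z))\<^sup>2)"
    by (rule integrable_const_bound[of _ "C\<^sup>2"]) (auto intro!: AE_I2 power_mono C)
  have i2: "integrable (dA_weighted \<alpha>) (\<lambda>z. (cmod (H z))\<^sup>2)"
    by (rule integrable_const_bound[of _ "C'\<^sup>2"]) (auto intro!: AE_I2 power_mono C')
  have i3: "integrable (dA_weighted \<alpha>) (\<lambda>z. cnj (P z) * H z)"
    by (rule integrable_const_bound[of _ "C * C'"]) (auto simp: norm_mult intro!: AE_I2 mult_mono C C' C0)
  have i3': "integrable (dA_weighted \<alpha>) (\<lambda>z. cnj (b k) * (indicator (ball 0 r) z *\<^sub>R (cnj (z ^ k) * h z)))" if "k \<in> A" for k
  proof (rule integrable_mult_right, rule integrable_const_bound[of _ C'])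
    show "AE z in dA_weighted \<alpha>. norm (indicator (ball 0 r) z *\<^sub>R (cnj (z ^ k) * h z)) \<le> C'"
    proof (rule AE_I2)
      fix z
      have "norm (indicator (ball 0 r) z *\<^sub>R (cnj (z ^ k) * h z)) \<le> cmod (H z)"
      proof (cases "z \<in> ball 0 r")
        case True
        then have "cmod z ^ k \<le> 1" using r by (auto intro!: power_le_one)
        then have "cmod z ^ k * cmod (h z) \<le> 1 * cmod (h z)" by (intro mult_right_mono) auto
        then show ?thesis using True by (simp add: H_def norm_mult norm_power)
      qed simp
      then show "norm (indicator (ball 0 r) z *\<^sub>R (cnj (z ^ k) * h z)) \<le> C'" using C' order_trans by blast
    qed
    have "(\<lambda>z. indicator (ball 0 r) z *\<^sub>R (cnj (z ^ k) * h z)) = (\<lambda>z. cnj (z ^ k) * H z)" by (auto simp: H_def indicator_def)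
    then show "(\<lambda>z. indicator (ball 0 r) z *\<^sub>R (cnj (z ^ k) * h z)) \<in> borel_measurable (dA_weighted \<alpha>)" by simp
  qed
  have "(\<integral>z. cnj (P z) * H z \<partial>dA_weighted \<alpha>) = (\<integral>z. (\<Sum>k\<in>A. cnj (b k) * (indicator (ball 0 r) z *\<^sub>R (cnj (z ^ k) * h z))) \<partial>dA_weighted \<alpha>)"
    by (intro Bochner_Integration.integral_cong[OF refl]) (auto simp: P_def H_def p_def indicator_def sum_distrib_right sum_distrib_left mult_ac)
  also have "\<dots> = (\<Sum>k\<in>A. cnj (b k) * (\<integral>z. indicator (ball 0 r) z *\<^sub>R (cnj (z ^ k) * h z) \<partial>dA_weighted \<alpha>))"
    by (simp only: Bochner_Integration.integral_sum[OF i3'] integral_mult_right_zero)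
  also have "\<dots> = 0" using monomial_orthogonal_series[OF h e r] by (intro sum.neutral) auto
  finally have cross: "(\<integral>z. cnj (P z) * H z \<partial>dA_weighted \<alpha>) = 0" .
  have eq: "(cmod (P z + H z))\<^sup>2 = (cmod (P z))\<^sup>2 + (cmod (H z))\<^sup>2 + 2 * Re (cnj (P z) * H z)" for z
    unfolding cmod_power2 by (simp add: power2_eq_square algebra_simps)
  have "(\<integral>z. (cmod (P z + H z))\<^sup>2 \<partial>dA_weighted \<alpha>) = (\<integral>z. (cmod (P z))\<^sup>2 \<partial>dA_weighted \<alpha>) + (\<integral>z. (cmod (H z))\<^sup>2 \<partial>dA_weighted \<alpha>)
     + 2 * Re (\<integral>z. cnj (P z) * H z \<partial>dA_weighted \<alpha>)"
    unfolding eq Bochner_Integration.integral_add[OF Bochner_Integration.integrable_add[OF i1 i2] integrable_mult_right[OF integrable_Re[OF i3], of 2]]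
      Bochner_Integration.integral_add[OF i1 i2] integral_mult_right_zero integral_Re[OF i3] ..
  then have main: "(\<integral>z. (cmod (P z + H z))\<^sup>2 \<partial>dA_weighted \<alpha>) = (\<integral>z. (cmod (P z))\<^sup>2 \<partial>dA_weighted \<alpha>) + (\<integral>z. (cmod (H z))\<^sup>2 \<partial>dA_weighted \<alpha>)"
    unfolding cross by simp
  have i4: "integrable (dA_weighted \<alpha>) (\<lambda>z. (cmod (P z + H z))\<^sup>2)" unfolding eq using i1 i2 i3 by (intro Bochner_Integration.integrable_add integrable_mult_right integrable_Re)
  have conv: "(\<integral>\<^sup>+z. ennreal ((cmod (f z))\<^sup>2) * indicator (ball 0 r) z \<partial>dA_weighted \<alpha>) = (\<integral>\<^sup>+z. ennreal ((cmod (indicator (ball 0 r) z *\<^sub>R f z))\<^sup>2) \<partial>dA_weighted \<alpha>)" for f :: "complex \<Rightarrow> complex"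
    by (intro nn_integral_cong) (auto simp: indicator_def)
  have PH: "indicator (ball 0 r) z *\<^sub>R (p z + h z) = P z + H z" for z by (simp add: P_def H_def scaleR_add_right)
  have Pz: "indicator (ball 0 r) z *\<^sub>R p z = P z" and Hz: "indicator (ball 0 r) z *\<^sub>R h z = H z" for z
    by (simp_all add: P_def H_def)
  show ?thesis unfolding conv PH Pz Hz
    using main by (simp add: nn_integral_eq_integral i1 i2 i4 flip: ennreal_plus)
qed

end

text \<open>On smaller disks holomorphic functions are bounded; monotone convergence carries identities between energies from there to the whole disk.\<close>

lemma energy_exhaustion:
  assumes g: "g holomorphic_on unit_disk"
  shows "(\<lambda>n. \<integral>\<^sup>+z. ennreal ((cmod (g z))\<^sup>2) * indicator (ball 0 (1 - 1 / real (n + 2))) z \<partial>dA_weighted \<alpha>) \<longlonglongrightarrow> energy \<alpha> g"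
proof -
  define r where "r n = 1 - 1 / real (n + 2)" for n
  have r: "r n < 1" "r n \<le> 1" for n by (auto simp: r_def)
  have rm: "r m \<le> r n" if "m \<le> n" for m n using that by (auto simp: r_def frac_le)
  have rl: "r \<longlonglongrightarrow> 1"
    using tendsto_diff[OF tendsto_const[of 1] LIMSEQ_ignore_initial_segment[OF lim_1_over_n, of 2]]
    unfolding r_def by simp
  have "(\<lambda>n. \<integral>\<^sup>+z. ennreal ((cmod (indicator (ball 0 (r n)) z *\<^sub>R g z))\<^sup>2) \<partial>dA_weighted \<alpha>) \<longlonglongrightarrow> (\<integral>\<^sup>+z. ennreal ((cmod (indicator unit_disk z *\<^sub>R g z))\<^sup>2) \<partial>dA_weighted \<alpha>)"
  proof (rule nn_integral_LIMSEQ)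
    show "incseq (\<lambda>n z. ennreal ((cmod (indicator (ball 0 (r n)) z *\<^sub>R g z))\<^sup>2))"
    proof (intro incseq_SucI le_funI)
      fix n z
      show "ennreal ((cmod (indicator (ball 0 (r n)) z *\<^sub>R g z))\<^sup>2) \<le> ennreal ((cmod (indicator (ball 0 (r (Suc n))) z *\<^sub>R g z))\<^sup>2)"
        using rm[of n "Suc n"] by (auto simp: indicator_def intro!: ennreal_leI)
    qed
    show "(\<lambda>z. ennreal ((cmod (indicator (ball 0 (r n)) z *\<^sub>R g z))\<^sup>2)) \<in> borel_measurable (dA_weighted \<alpha>)" for n
    proof -
      have [measurable]: "(\<lambda>z. indicator (ball 0 (r n)) z *\<^sub>R g z) \<in> borel_measurable (dA_weighted \<alpha>)"
        using holomorphic_on_ball_borel[OF g r(2)] by simp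
      show ?thesis by measurable
    qed
    show "(\<lambda>n. ennreal ((cmod (indicator (ball 0 (r n)) z *\<^sub>R g z))\<^sup>2)) \<longlonglongrightarrow> ennreal ((cmod (indicator unit_disk z *\<^sub>R g z))\<^sup>2)" for z
    proof (cases "z \<in> unit_disk")
      case True
      then have "eventually (\<lambda>n. cmod z < r n) sequentially" using order_tendstoD(1)[OF rl, of "cmod z"] by simp
      then have "eventually (\<lambda>n. ennreal ((cmod (indicator (ball 0 (r n)) z *\<^sub>R g z))\<^sup>2) = ennreal ((cmod (indicator unit_disk z *\<^sub>R g z))\<^sup>2)) sequentially"
        by eventually_elim (use True in auto)
      then show ?thesis by (rule tendsto_eventually)
    next
      case False
      have "z \<notin> ball 0 (r n)" for n using r(1)[of n] False by auto
      then show ?thesis using False by simp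
    qed
  qed
  moreover have "energy \<alpha> g = (\<integral>\<^sup>+z. ennreal ((cmod (indicator unit_disk z *\<^sub>R g z))\<^sup>2) \<partial>dA_weighted \<alpha>)"
    unfolding energy_def[symmetric] by (rule energy_cong) simp
  moreover have "ennreal ((cmod (g z))\<^sup>2) * indicator (ball 0 (r n)) z = ennreal ((cmod (indicator (ball 0 (r n)) z *\<^sub>R g z))\<^sup>2)" for z n
    by (auto simp: indicator_def)
  ultimately show ?thesis unfolding r_def by simp
qed

lemma energy_cmult: "g \<in> borel_measurable borel \<Longrightarrow> energy \<alpha> (\<lambda>z. c * g z) = ennreal ((cmod c)\<^sup>2) * energy \<alpha> g"
  unfolding energy_def by (subst nn_integral_cmult[symmetric]) (auto simp: norm_mult power_mult_distrib ennreal_mult)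

context
  fixes \<alpha> :: real assumes \<alpha>: "\<alpha> > -1"
begin

text \<open>The source of all estimates on Taylor expansions below: coefficient bounds, contractivity of truncation, and the energy of sums of polynomials with disjoint sets of exponents.\<close>

lemma pythagoras:
  fixes b :: "nat \<Rightarrow> complex"
  assumes A: "finite A" and h: "has_coeffs e h" and e: "\<And>k. k \<in> A \<Longrightarrow> e k = 0"
  shows "energy \<alpha> (\<lambda>z. (\<Sum>k\<in>A. b k * z ^ k) + h z) = energy \<alpha> (\<lambda>z. \<Sum>k\<in>A. b k * z ^ k) + energy \<alpha> h"
proof (rule LIMSEQ_unique)
  have p: "(\<lambda>z. \<Sum>k\<in>A. b k * z ^ k) holomorphic_on unit_disk" by (intro holomorphic_intros)
  have hh: "h holomorphic_on unit_disk" using has_coeffs_holomorphic[OF h] .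
  define I where "I f n = (\<integral>\<^sup>+z. ennreal ((cmod (f z))\<^sup>2) * indicator (ball 0 (1 - 1 / real (n + 2))) z \<partial>dA_weighted \<alpha>)" for f n
  show "I (\<lambda>z. (\<Sum>k\<in>A. b k * z ^ k) + h z) \<longlonglongrightarrow> energy \<alpha> (\<lambda>z. (\<Sum>k\<in>A. b k * z ^ k) + h z)"
    unfolding I_def by (rule energy_exhaustion) (intro holomorphic_intros p hh)
  have "I (\<lambda>z. (\<Sum>k\<in>A. b k * z ^ k) + h z) n = I (\<lambda>z. \<Sum>k\<in>A. b k * z ^ k) n + I h n" for n
    unfolding I_def by (rule pythagoras_ball[OF \<alpha> A h e]) auto
  then have "I (\<lambda>z. (\<Sum>k\<in>A. b k * z ^ k) + h z) = (\<lambda>n. I (\<lambda>z. \<Sum>k\<in>A. b k * z ^ k) n + I h n)" by auto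
  moreover have "(\<lambda>n. I (\<lambda>z. \<Sum>k\<in>A. b k * z ^ k) n + I h n) \<longlonglongrightarrow> energy \<alpha> (\<lambda>z. \<Sum>k\<in>A. b k * z ^ k) + energy \<alpha> h"
    unfolding I_def by (intro tendsto_add energy_exhaustion p hh)
  ultimately show "I (\<lambda>z. (\<Sum>k\<in>A. b k * z ^ k) + h z) \<longlonglongrightarrow> energy \<alpha> (\<lambda>z. \<Sum>k\<in>A. b k * z ^ k) + energy \<alpha> h" by simp
qed

lemma energy_split:
  assumes g: "has_coeffs e g" and A: "finite A"
  shows "energy \<alpha> g = energy \<alpha> (\<lambda>z. \<Sum>k\<in>A. e k * z ^ k) + energy \<alpha> (\<lambda>z. g z - (\<Sum>k\<in>A. e k * z ^ k))"
  using pythagoras[OF A has_coeffs_remove[OF g A], of e] by simp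

lemma energy_monomial_finite: "energy \<alpha> (\<lambda>z. z ^ k) < \<infinity>"
proof -
  interpret finite_measure "dA_weighted \<alpha>" by (rule finite_dA_weighted[OF \<alpha>])
  have "energy \<alpha> (\<lambda>z. z ^ k) \<le> (\<integral>\<^sup>+z. 1 \<partial>dA_weighted \<alpha>)"
    unfolding energy_def
  proof (rule nn_integral_mono_AE)
    show "AE z in dA_weighted \<alpha>. ennreal ((cmod (z ^ k))\<^sup>2) \<le> 1"
      using AE_dA_weighted_disk[of \<alpha>]
    proof eventually_elim
      case (elim z)
      then have "(cmod (z ^ k))\<^sup>2 \<le> 1" by (simp add: norm_power power_le_one)
      then show ?case by (simp add: ennreal_le_1)
    qed
  qed
  also have "\<dots> < \<infinity>" using emeasure_finite[of UNIV] by (simp add: less_top[symmetric])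
  finally show ?thesis .
qed

definition monomial_energy :: "nat \<Rightarrow> real" where
  "monomial_energy k = enn2real (energy \<alpha> (\<lambda>z. z ^ k))"

lemma energy_monomial: "energy \<alpha> (\<lambda>z. z ^ k) = ennreal (monomial_energy k)"
  using energy_monomial_finite by (simp add: monomial_energy_def)

text \<open>On the annulus \<open>\<bar>z\<bar> \<ge> \<rho>\<close>, which has positive measure, \<open>\<bar>z\<^sup>k\<bar> \<ge> \<rho>\<^sup>k\<close>. So the energies of monomials decay slower than any geometric sequence of ratio below one.\<close>

lemma monomial_energy_lower:
  assumes \<rho>: "0 < \<rho>" "\<rho> < 1"
  obtains m where "0 < m" "\<And>k. m * (\<rho> ^ k)\<^sup>2 \<le> monomial_energy k"
proof -
  interpret finite_measure "dA_weighted \<alpha>" by (rule finite_dA_weighted[OF \<alpha>])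
  define m where "m = measure (dA_weighted \<alpha>) (- ball 0 \<rho>)"
  have m: "emeasure (dA_weighted \<alpha>) (- ball 0 \<rho>) = ennreal m" by (simp add: m_def emeasure_eq_measure)
  have m0: "0 < m" using dA_weighted_annulus_pos[OF \<alpha> \<rho>] m by simp
  have "m * (\<rho> ^ k)\<^sup>2 \<le> monomial_energy k" for k
  proof -
    have "ennreal (m * (\<rho> ^ k)\<^sup>2) = (\<integral>\<^sup>+z. ennreal ((\<rho> ^ k)\<^sup>2) * indicator (- ball 0 \<rho>) z \<partial>dA_weighted \<alpha>)"
      using m0 m by (subst nn_integral_cmult_indicator) (auto simp: ennreal_mult mult.commute)
    also have "\<dots> \<le> energy \<alpha> (\<lambda>z. z ^ k)"
      unfolding energy_def using \<rho>
      by (intro nn_integral_mono) (auto simp: indicator_def norm_power intro!: ennreal_leI power_mono)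
    finally show ?thesis using m0 unfolding energy_monomial by (simp add: monomial_energy_def)
  qed
  then show ?thesis using that m0 by blast
qed

lemma monomial_energy_pos: "0 < monomial_energy k"
proof -
  obtain m :: real where "0 < m" "\<And>k. m * ((1/2) ^ k)\<^sup>2 \<le> monomial_energy k"
    by (rule monomial_energy_lower[of "1/2"]) auto
  then have "0 < m" "m * ((1/2) ^ k)\<^sup>2 \<le> monomial_energy k" by auto
  moreover from this(1) have "0 < m * ((1/2) ^ k)\<^sup>2" by simp
  ultimately show ?thesis by linarith
qed

lemma energy_poly:
  assumes "finite A"
  shows "energy \<alpha> (\<lambda>z. \<Sum>k\<in>A. b k * z ^ k) = ennreal (\<Sum>k\<in>A. (cmod (b k))\<^sup>2 * monomial_energy k)"
  using assms
proof (induction A rule: finite_induct)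
  case empty
  then show ?case by (simp add: energy_def)
next
  case (insert j A)
  have hc: "has_coeffs (\<lambda>k. if k \<in> A then b k else 0) (\<lambda>z. \<Sum>k\<in>A. b k * z ^ k)" by (rule has_coeffs_poly[OF insert(1)])
  have "energy \<alpha> (\<lambda>z. (\<Sum>k\<in>{j}. b k * z ^ k) + (\<Sum>k\<in>A. b k * z ^ k))
      = energy \<alpha> (\<lambda>z. \<Sum>k\<in>{j}. b k * z ^ k) + energy \<alpha> (\<lambda>z. \<Sum>k\<in>A. b k * z ^ k)"
    by (rule pythagoras[OF _ hc]) (use insert in auto)
  also have "energy \<alpha> (\<lambda>z. \<Sum>k\<in>{j}. b k * z ^ k) = ennreal ((cmod (b j))\<^sup>2 * monomial_energy j)"
    by (simp add: energy_cmult energy_monomial ennreal_mult')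
  finally show ?case using insert monomial_energy_pos
    by (simp add: less_imp_le sum_nonneg flip: ennreal_plus)
qed

text \<open>A single Taylor term has at most the energy of the whole function. The result is an estimate of Cauchy type whose constant depends only on the norm and on \<open>\<rho>\<close>.\<close>

lemma coefficient_bound:
  assumes \<rho>: "0 < \<rho>" "\<rho> < 1"
  obtains C where "0 < C" "\<And>e g s k. has_coeffs e g \<Longrightarrow> 0 \<le> s \<Longrightarrow> energy \<alpha> g \<le> ennreal (s\<^sup>2) \<Longrightarrow> cmod (e k) \<le> C * s / \<rho> ^ k"
proof -
  obtain m where m: "0 < m" "\<And>k. m * (\<rho> ^ k)\<^sup>2 \<le> monomial_energy k" using monomial_energy_lower[OF \<rho>] by metis
  have "cmod (e k) \<le> 1 / sqrt m * s / \<rho> ^ k" if g: "has_coeffs e g" "0 \<le> s" "energy \<alpha> g \<le> ennreal (s\<^sup>2)" for e g s k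
  proof -
    have "ennreal ((cmod (e k))\<^sup>2 * monomial_energy k) = energy \<alpha> (\<lambda>z. \<Sum>k\<in>{k}. e k * z ^ k)"
      by (subst energy_poly) auto
    also have "\<dots> \<le> energy \<alpha> g" using energy_split[OF g(1), of "{k}"] by simp
    also have "\<dots> \<le> ennreal (s\<^sup>2)" by fact
    finally have "(cmod (e k))\<^sup>2 * monomial_energy k \<le> s\<^sup>2" by simp
    moreover have "(cmod (e k))\<^sup>2 * (m * (\<rho> ^ k)\<^sup>2) \<le> (cmod (e k))\<^sup>2 * monomial_energy k" using m(2) by (rule mult_left_mono) simp
    ultimately have "(cmod (e k) * (sqrt m * \<rho> ^ k))\<^sup>2 \<le> s\<^sup>2" using m(1) by (simp add: power_mult_distrib)
    then have "cmod (e k) * (sqrt m * \<rho> ^ k) \<le> s" using g(2) by (rule power2_le_imp_le)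
    then show ?thesis using m(1) \<rho> by (simp add: field_simps)
  qed
  then show ?thesis using that[of "1 / sqrt m"] m(1) by auto
qed

text \<open>The coefficients grow slower than \<open>\<rho>\<^sup>-\<^sup>k\<close> for some \<open>\<rho>\<close> between \<open>R\<close> and \<open>1\<close>, uniformly on the unit ball of the Bergman space, so the tails are dominated by a geometric series of ratio \<open>R / \<rho>\<close>.\<close>

lemma taylor_tail_uniformly_small:
  assumes R: "0 \<le> R" "R < 1" and \<epsilon>: "0 < \<epsilon>"
  obtains N where "\<And>n e g w. N \<le> n \<Longrightarrow> has_coeffs e g \<Longrightarrow> energy \<alpha> g \<le> 1 \<Longrightarrow> cmod w \<le> R \<Longrightarrow>
    cmod (g w - (\<Sum>k<n. e k * w ^ k)) \<le> \<epsilon>"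
proof -
  \<comment> \<open>a radius strictly between \<open>R\<close> and \<open>1\<close>\<close>
  define \<rho> where "\<rho> = (1 + R) / 2"
  have \<rho>: "0 < \<rho>" "\<rho> < 1" "R < \<rho>" using R by (auto simp: \<rho>_def)
  obtain C where C: "0 < C" "\<And>e g s k. has_coeffs e g \<Longrightarrow> 0 \<le> s \<Longrightarrow> energy \<alpha> g \<le> ennreal (s\<^sup>2) \<Longrightarrow> cmod (e k) \<le> C * s / \<rho> ^ k"
    using coefficient_bound[OF \<rho>(1,2)] by metis
  define q where "q = R / \<rho>"
  have q: "0 \<le> q" "q < 1" using R \<rho> by (auto simp: q_def)
  have lim: "(\<lambda>n. C * q ^ n / (1 - q)) \<longlonglongrightarrow> 0"
    using tendsto_divide[OF tendsto_mult[OF tendsto_const LIMSEQ_realpow_zero[OF q]] tendsto_const, of "1 - q" C] q by simp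
  obtain N where N: "\<And>n. N \<le> n \<Longrightarrow> C * q ^ n / (1 - q) < \<epsilon>"
    using order_tendstoD(2)[OF lim \<epsilon>] by (auto simp: eventually_sequentially)
  have "cmod (g w - (\<Sum>k<n. e k * w ^ k)) \<le> \<epsilon>" if "N \<le> n" and g: "has_coeffs e g" and E: "energy \<alpha> g \<le> 1" and w: "cmod w \<le> R" for n e g w
  proof -
    have ek: "cmod (e k) \<le> C / \<rho> ^ k" for k using C(2)[OF g, of 1 k] E by simp
    have wD: "w \<in> unit_disk" using w R by auto
    then have "(\<lambda>k. e k * w ^ k) sums g w" using g by (auto simp: has_coeffs_def)
    from sums_split_initial_segment[OF this, of n]
    have s: "(\<lambda>k. e (k + n) * w ^ (k + n)) sums (g w - (\<Sum>k<n. e k * w ^ k))" .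
    have b: "norm (e (k + n) * w ^ (k + n)) \<le> C * q ^ n * q ^ k" for k
    proof -
      have "norm (e (k + n) * w ^ (k + n)) \<le> C / \<rho> ^ (k + n) * R ^ (k + n)"
        unfolding norm_mult norm_power using w ek by (intro mult_mono power_mono) (use C \<rho> in auto)
      also have "\<dots> = C * q ^ n * q ^ k" by (simp add: q_def power_add power_divide mult_ac)
      finally show ?thesis .
    qed
    have gs: "(\<lambda>k. C * q ^ n * q ^ k) sums (C * q ^ n * (1 / (1 - q)))"
      using q by (intro sums_mult geometric_sums) auto
    have "norm (\<Sum>k. e (k + n) * w ^ (k + n)) \<le> (\<Sum>k. C * q ^ n * q ^ k)"
      by (rule norm_suminf_le[OF b sums_summable[OF gs]])
    then have "cmod (g w - (\<Sum>k<n. e k * w ^ k)) \<le> C * q ^ n * (1 / (1 - q))"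
      using s gs by (simp add: sums_iff)
    also have "\<dots> \<le> \<epsilon>" using N[OF that(1)] by simp
    finally show ?thesis .
  qed
  then show ?thesis using that by blast
qed

lemma taylor_poly_bounded:
  obtains B where "0 \<le> B" "\<And>e g w. has_coeffs e g \<Longrightarrow> energy \<alpha> g \<le> 1 \<Longrightarrow> cmod w \<le> 1 \<Longrightarrow> cmod (\<Sum>k<n. e k * w ^ k) \<le> B"
proof -
  obtain C where C: "0 < C" "\<And>e g s k. has_coeffs e g \<Longrightarrow> 0 \<le> s \<Longrightarrow> energy \<alpha> g \<le> ennreal (s\<^sup>2) \<Longrightarrow> cmod (e k) \<le> C * s / (1/2) ^ k"
    using coefficient_bound[of "1/2"] by auto
  have "cmod (\<Sum>k<n. e k * w ^ k) \<le> (\<Sum>k<n. C / (1/2) ^ k)" if g: "has_coeffs e g" "energy \<alpha> g \<le> 1" "cmod w \<le> 1" for e g w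
  proof (rule sum_norm_le)
    fix k
    have "cmod (e k) \<le> C / (1/2) ^ k" using C(2)[OF g(1), of 1 k] g(2) by simp
    moreover have "cmod w ^ k \<le> 1" using g(3) by (simp add: power_le_one)
    ultimately have "cmod (e k) * cmod w ^ k \<le> C / (1/2) ^ k * 1" using C(1) by (intro mult_mono) auto
    then show "norm (e k * w ^ k) \<le> C / (1/2) ^ k" by (simp add: norm_mult norm_power)
  qed
  moreover have "0 \<le> (\<Sum>k<n. C / (1/2) ^ k)" using C(1) by (intro sum_nonneg) auto
  ultimately show ?thesis using that by blast
qed

end

section \<open>Compact operators and the essential norm\<close>

text \<open>A space of functions with a seminorm, in the carrier style of the operator predicates. The Dirichlet space is the instance of interest.\<close>

locale function_norm =
  fixes V :: "('a \<Rightarrow> complex) set" and nrm :: "('a \<Rightarrow> complex) \<Rightarrow> real"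
  assumes zero_in: "(\<lambda>_. 0) \<in> V"
    and add_in: "f \<in> V \<Longrightarrow> g \<in> V \<Longrightarrow> (\<lambda>z. f z + g z) \<in> V"
    and scale_in: "f \<in> V \<Longrightarrow> (\<lambda>z. c * f z) \<in> V"
    and nrm_nonneg: "0 \<le> nrm f"
    and nrm_scale: "f \<in> V \<Longrightarrow> nrm (\<lambda>z. c * f z) = cmod c * nrm f"
    and nrm_triangle: "f \<in> V \<Longrightarrow> g \<in> V \<Longrightarrow> nrm (\<lambda>z. f z + g z) \<le> nrm f + nrm g"
begin

lemma nrm_zero: "nrm (\<lambda>_. 0) = 0"
  using nrm_scale[OF zero_in, of 0] by simp

lemma diff_in: assumes "f \<in> V" "g \<in> V" shows "(\<lambda>z. f z - g z) \<in> V"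
  using add_in[OF assms(1) scale_in[OF assms(2), of "-1"]] by simp

lemma nrm_diff_commute: assumes "f \<in> V" "g \<in> V" shows "nrm (\<lambda>z. f z - g z) = nrm (\<lambda>z. g z - f z)"
  using nrm_scale[OF diff_in[OF assms], of "-1"] by simp

lemma nrm_le_diff: assumes "f \<in> V" "g \<in> V" shows "nrm f \<le> nrm (\<lambda>z. f z - g z) + nrm g"
  using nrm_triangle[OF diff_in[OF assms] assms(2)] by simp

lemma sum_in: "finite F \<Longrightarrow> (\<And>j. j \<in> F \<Longrightarrow> u j \<in> V) \<Longrightarrow> (\<lambda>z. \<Sum>j\<in>F. u j z) \<in> V"
  by (induction F rule: finite_induct) (auto intro: zero_in add_in)

lemma nrm_sum: "finite F \<Longrightarrow> (\<And>j. j \<in> F \<Longrightarrow> u j \<in> V) \<Longrightarrow> nrm (\<lambda>z. \<Sum>j\<in>F. u j z) \<le> (\<Sum>j\<in>F. nrm (u j))"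
proof (induction F rule: finite_induct)
  case (insert x F)
  then have "nrm (\<lambda>z. u x z + (\<Sum>j\<in>F. u j z)) \<le> nrm (u x) + nrm (\<lambda>z. \<Sum>j\<in>F. u j z)"
    by (intro nrm_triangle sum_in) auto
  then show ?case using insert by fastforce
qed (simp add: nrm_zero)

lemma linear_op_in: "linear_op_on V T \<Longrightarrow> f \<in> V \<Longrightarrow> T f \<in> V"
  by (simp add: linear_op_on_def)

lemma linear_op_scale: "linear_op_on V T \<Longrightarrow> f \<in> V \<Longrightarrow> T (\<lambda>z. c * f z) = (\<lambda>z. c * T f z)"
  by (simp add: linear_op_on_def)

lemma linear_op_zero: "linear_op_on V T \<Longrightarrow> T (\<lambda>_. 0) = (\<lambda>_. 0)"
  using linear_op_scale[OF _ zero_in, of T 0] by simp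

lemma linear_op_sum:
  assumes T: "linear_op_on V T"
  shows "finite F \<Longrightarrow> (\<And>j. j \<in> F \<Longrightarrow> u j \<in> V) \<Longrightarrow> T (\<lambda>z. \<Sum>j\<in>F. u j z) = (\<lambda>z. \<Sum>j\<in>F. T (u j) z)"
proof (induction F rule: finite_induct)
  case empty
  then show ?case using linear_op_zero[OF T] by simp
next
  case (insert x F)
  have "T (\<lambda>z. u x z + (\<Sum>j\<in>F. u j z)) = (\<lambda>z. T (u x) z + T (\<lambda>z. \<Sum>j\<in>F. u j z) z)"
    using T insert.prems sum_in[OF insert.hyps(1), of u] by (auto simp: linear_op_on_def)
  then show ?case using insert by simp
qed

text \<open>If \<open>K\<close> were unbounded, there would be \<open>g\<^sub>n\<close> of norm at most one with \<open>\<parallel>K g\<^sub>n\<parallel> = n\<close>, and no subsequence of \<open>K g\<^sub>n\<close> could converge.\<close>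

lemma compact_op_bounded:
  assumes K: "compact_op_on V nrm K"
  obtains C where "0 \<le> C" "\<And>f. f \<in> V \<Longrightarrow> nrm (K f) \<le> C * nrm f"
proof -
  have lin: "linear_op_on V K" using K by (simp add: compact_op_on_def)
  have "\<exists>C::nat. \<forall>f\<in>V. nrm (K f) \<le> C * nrm f"
  proof (rule ccontr)
    assume "\<not> ?thesis"
    then have "\<forall>n::nat. \<exists>f\<in>V. n * nrm f < nrm (K f)" by (auto simp: not_le)
    then obtain f where f: "\<And>n::nat. f n \<in> V" "\<And>n::nat. n * nrm (f n) < nrm (K (f n))" by metis
    define t where "t n = nrm (K (f n))" for n
    have t: "0 < t n" for n
      using f(2)[of n] nrm_nonneg[of "f n"] by (smt (verit) mult_nonneg_nonneg of_nat_0_le_iff t_def)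
    \<comment> \<open>scaled by \<open>\<parallel>K (f n)\<parallel>\<close>, which is positive, and not by \<open>\<parallel>f n\<parallel>\<close>, which may be zero\<close>
    define g where "g n = (\<lambda>z. complex_of_real (n / t n) * f n z)" for n
    have gV: "g n \<in> V" for n unfolding g_def by (rule scale_in[OF f(1)])
    have "nrm (g n) \<le> 1" for n
    proof -
      have "nrm (g n) = n * nrm (f n) / t n"
        unfolding g_def nrm_scale[OF f(1)] using t[of n] by (simp add: norm_divide)
      also have "\<dots> \<le> 1" using f(2)[of n] t[of n] by (simp add: t_def)
      finally show ?thesis .
    qed
    then have "bounded (range (\<lambda>n. nrm (g n)))"
      using nrm_nonneg by (intro boundedI[of _ 1]) auto
    then obtain r h where rh: "strict_mono r" "h \<in> V" "(\<lambda>k. nrm (\<lambda>z. K (g (r k)) z - h z)) \<longlonglongrightarrow> 0"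
      using K gV unfolding compact_op_on_def by meson
    have Kg: "nrm (K (g n)) = n" for n
      unfolding g_def linear_op_scale[OF lin f(1)] nrm_scale[OF linear_op_in[OF lin f(1)]]
      using t[of n] by (simp add: norm_divide t_def)
    have "eventually (\<lambda>k. nrm (\<lambda>z. K (g (r k)) z - h z) < 1) sequentially"
      using order_tendstoD(2)[OF rh(3), of 1] by simp
    moreover have "eventually (\<lambda>k. nrm h + 1 < real k) sequentially"
      using eventually_gt_at_top[of "nat \<lceil>nrm h + 1\<rceil>"] by eventually_elim linarith
    ultimately have "eventually (\<lambda>k. False) sequentially"
    proof eventually_elim
      case (elim k)
      have "real k \<le> real (r k)" using seq_suble[OF rh(1)] by simp
      also have "\<dots> \<le> nrm (\<lambda>z. K (g (r k)) z - h z) + nrm h"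
        using nrm_le_diff[OF linear_op_in[OF lin gV] rh(2), of "r k"] by (simp add: Kg)
      finally show ?case using elim by linarith
    qed
    then show False by simp
  qed
  then obtain C :: nat where "\<forall>f\<in>V. nrm (K f) \<le> C * nrm f" ..
  then show ?thesis using that[of "real C"] by simp
qed

lemma compact_op_zero: "compact_op_on V nrm (\<lambda>f z. 0)"
proof -
  have "\<exists>(r :: nat \<Rightarrow> nat) h. strict_mono r \<and> h \<in> V \<and> (\<lambda>k::nat. nrm (\<lambda>z. 0 - h z)) \<longlonglongrightarrow> 0"
    using zero_in nrm_zero by (intro exI[of _ id] exI[of _ "\<lambda>_. 0"]) (simp add: strict_mono_def)
  then show ?thesis unfolding compact_op_on_def linear_op_on_def using zero_in by simp
qed

lemma compact_op_add:
  assumes K: "compact_op_on V nrm K" and L: "compact_op_on V nrm L"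
  shows "compact_op_on V nrm (\<lambda>f z. K f z + L f z)"
  unfolding compact_op_on_def
proof (intro conjI allI impI)
  have linK: "linear_op_on V K" and linL: "linear_op_on V L" using K L by (auto simp: compact_op_on_def)
  show "linear_op_on V (\<lambda>f z. K f z + L f z)"
    using linK linL unfolding linear_op_on_def by (auto intro!: add_in simp: fun_eq_iff algebra_simps)
  fix f :: "nat \<Rightarrow> 'a \<Rightarrow> complex"
  assume f: "(\<forall>k. f k \<in> V) \<and> bounded (range (\<lambda>k. nrm (f k)))"
  then obtain r h where rh: "strict_mono r" "h \<in> V" "(\<lambda>k. nrm (\<lambda>z. K (f (r k)) z - h z)) \<longlonglongrightarrow> 0"
    using K unfolding compact_op_on_def by meson
  have "bounded (range (\<lambda>k. nrm (f (r k))))" using f by (auto elim!: bounded_subset)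
  then have fr: "(\<forall>k. f (r k) \<in> V) \<and> bounded (range (\<lambda>k. nrm (f (r k))))" using f by blast
  have "\<forall>f :: nat \<Rightarrow> 'a \<Rightarrow> complex. (\<forall>k. f k \<in> V) \<and> bounded (range (\<lambda>k. nrm (f k))) \<longrightarrow>
        (\<exists>r h. strict_mono r \<and> h \<in> V \<and> (\<lambda>k. nrm (\<lambda>z. L (f (r k)) z - h z)) \<longlonglongrightarrow> 0)"
    using L unfolding compact_op_on_def by blast
  from this[rule_format, OF fr] obtain s g
    where sg: "strict_mono s" "g \<in> V" "(\<lambda>k. nrm (\<lambda>z. L (f (r (s k))) z - g z)) \<longlonglongrightarrow> 0" by blast
  have "(\<lambda>k. nrm (\<lambda>z. (K (f (r (s k))) z + L (f (r (s k))) z) - (h z + g z))) \<longlonglongrightarrow> 0"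
  proof (rule tendsto_sandwich[OF _ _ tendsto_const])
    show "eventually (\<lambda>k. 0 \<le> nrm (\<lambda>z. (K (f (r (s k))) z + L (f (r (s k))) z) - (h z + g z))) sequentially"
      using nrm_nonneg by simp
    show "eventually (\<lambda>k. nrm (\<lambda>z. (K (f (r (s k))) z + L (f (r (s k))) z) - (h z + g z))
        \<le> nrm (\<lambda>z. K (f (r (s k))) z - h z) + nrm (\<lambda>z. L (f (r (s k))) z - g z)) sequentially"
    proof (intro always_eventually allI)
      fix k
      have "(\<lambda>z. K (f (r (s k))) z - h z) \<in> V" "(\<lambda>z. L (f (r (s k))) z - g z) \<in> V"
        using f rh(2) sg(2) linear_op_in[OF linK] linear_op_in[OF linL] by (auto intro!: diff_in)
      from nrm_triangle[OF this]
      show "nrm (\<lambda>z. (K (f (r (s k))) z + L (f (r (s k))) z) - (h z + g z))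
        \<le> nrm (\<lambda>z. K (f (r (s k))) z - h z) + nrm (\<lambda>z. L (f (r (s k))) z - g z)" by (simp add: algebra_simps)
    qed
    show "(\<lambda>k. nrm (\<lambda>z. K (f (r (s k))) z - h z) + nrm (\<lambda>z. L (f (r (s k))) z - g z)) \<longlonglongrightarrow> 0"
      using tendsto_add[OF LIMSEQ_subseq_LIMSEQ[OF rh(3) sg(1)] sg(3)] by (simp add: o_def)
  qed
  then show "\<exists>r h. strict_mono r \<and> h \<in> V \<and> (\<lambda>k. nrm (\<lambda>z. K (f (r k)) z + L (f (r k)) z - h z)) \<longlonglongrightarrow> 0"
    using strict_mono_o[OF rh(1) sg(1)] add_in[OF rh(2) sg(2)]
    by (intro exI[of _ "r \<circ> s"] exI[of _ "\<lambda>z. h z + g z"]) (simp add: o_def)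
qed

lemma compact_op_sum:
  assumes "finite F" "\<And>j. j \<in> F \<Longrightarrow> compact_op_on V nrm (K j)"
  shows "compact_op_on V nrm (\<lambda>f z. \<Sum>j\<in>F. K j f z)"
  using assms by (induction F rule: finite_induct) (auto intro: compact_op_zero compact_op_add)

text \<open>Bolzano-Weierstrass for the scalar factor.\<close>

lemma compact_op_rank_one:
  assumes v: "v \<in> V" and add: "\<And>f g. f \<in> V \<Longrightarrow> g \<in> V \<Longrightarrow> l (\<lambda>z. f z + g z) = l f + l g"
    and scale: "\<And>c f. f \<in> V \<Longrightarrow> l (\<lambda>z. c * f z) = c * l f"
    and bd: "\<And>f. f \<in> V \<Longrightarrow> cmod (l f) \<le> C * nrm f"
  shows "compact_op_on V nrm (\<lambda>f z. l f * v z)"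
  unfolding compact_op_on_def
proof (intro conjI allI impI)
  show "linear_op_on V (\<lambda>f z. l f * v z)"
    unfolding linear_op_on_def using v by (auto simp: add scale algebra_simps intro!: scale_in)
  fix f :: "nat \<Rightarrow> 'a \<Rightarrow> complex"
  assume f: "(\<forall>k. f k \<in> V) \<and> bounded (range (\<lambda>k. nrm (f k)))"
  then obtain B where "\<forall>x\<in>range (\<lambda>k. nrm (f k)). norm x \<le> B" unfolding bounded_iff by blast
  then have B: "nrm (f k) \<le> B" for k by (auto simp: abs_le_iff)
  have "cmod (l (f k)) \<le> \<bar>C\<bar> * B" for k
  proof -
    have "cmod (l (f k)) \<le> C * nrm (f k)" using bd f by blast
    also have "\<dots> \<le> \<bar>C\<bar> * B" using B[of k] nrm_nonneg[of "f k"] by (intro mult_mono) auto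
    finally show ?thesis .
  qed
  then have "bounded (range (\<lambda>k. l (f k)))" by (intro boundedI[of _ "\<bar>C\<bar> * B"]) auto
  then obtain a r where ar: "strict_mono r" "((\<lambda>k. l (f k)) \<circ> r) \<longlonglongrightarrow> a"
    using bounded_imp_convergent_subsequence by blast
  have "(\<lambda>k. cmod (l (f (r k)) - a) * nrm v) \<longlonglongrightarrow> 0 * nrm v"
    using ar(2) by (intro tendsto_mult tendsto_const) (simp add: LIM_zero_iff tendsto_norm_zero_iff o_def)
  moreover have "nrm (\<lambda>z. l (f (r k)) * v z - a * v z) = cmod (l (f (r k)) - a) * nrm v" for k
    using nrm_scale[OF v, of "l (f (r k)) - a"] by (simp add: algebra_simps)
  ultimately show "\<exists>r h. strict_mono r \<and> h \<in> V \<and> (\<lambda>k. nrm (\<lambda>z. l (f (r k)) * v z - h z)) \<longlonglongrightarrow> 0"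
    using ar(1) scale_in[OF v, of a] by (intro exI[of _ r] exI[of _ "\<lambda>z. a * v z"]) simp
qed

lemma op_norm_ge:
  assumes "\<And>f. f \<in> V \<Longrightarrow> nrm (S f) \<le> C * nrm f" "f \<in> V" "nrm f \<le> 1"
  shows "nrm (S f) \<le> op_norm_on V nrm S"
  unfolding op_norm_on_def
proof (rule cSUP_upper)
  show "bdd_above ((\<lambda>f. nrm (S f)) ` {f \<in> V. nrm f \<le> 1})"
  proof (rule bdd_aboveI2)
    fix g assume g: "g \<in> {f \<in> V. nrm f \<le> 1}"
    have "nrm (S g) \<le> C * nrm g" using assms(1) g by blast
    also have "\<dots> \<le> \<bar>C\<bar> * 1" using g nrm_nonneg[of g] by (intro mult_mono) auto
    finally show "nrm (S g) \<le> \<bar>C\<bar>" by simp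
  qed
qed (use assms in auto)

lemma op_norm_le:
  assumes "\<And>f. f \<in> V \<Longrightarrow> nrm f \<le> 1 \<Longrightarrow> nrm (S f) \<le> M"
  shows "op_norm_on V nrm S \<le> M"
  unfolding op_norm_on_def using assms zero_in nrm_zero by (intro cSUP_least) auto

lemma bounded_diff_compact:
  assumes T: "bounded_op_on V nrm T" and K: "compact_op_on V nrm K"
  obtains C where "\<And>f. f \<in> V \<Longrightarrow> nrm (\<lambda>z. T f z - K f z) \<le> C * nrm f"
proof -
  obtain A where A: "\<And>f. f \<in> V \<Longrightarrow> nrm (T f) \<le> A * nrm f" and lT: "linear_op_on V T"
    using T unfolding bounded_op_on_def by blast
  obtain B where B: "\<And>f. f \<in> V \<Longrightarrow> nrm (K f) \<le> B * nrm f" using compact_op_bounded[OF K] by metis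
  have lK: "linear_op_on V K" using K by (simp add: compact_op_on_def)
  have "nrm (\<lambda>z. T f z - K f z) \<le> (A + B) * nrm f" if f: "f \<in> V" for f
  proof -
    have Tf: "T f \<in> V" and Kf: "K f \<in> V" using linear_op_in lT lK f by auto
    have "nrm (\<lambda>z. T f z + (-1) * K f z) \<le> nrm (T f) + nrm (\<lambda>z. (-1) * K f z)"
      by (intro nrm_triangle scale_in Tf Kf)
    also have "nrm (\<lambda>z. (-1) * K f z) = nrm (K f)" by (subst nrm_scale[OF Kf]) simp
    finally have "nrm (\<lambda>z. T f z - K f z) \<le> nrm (T f) + nrm (K f)" by simp
    then show ?thesis using A[OF f] B[OF f] by (simp add: distrib_right)
  qed
  then show ?thesis using that by blast
qed

lemma op_norm_diff_nonneg:
  assumes T: "bounded_op_on V nrm T" and K: "compact_op_on V nrm K"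
  shows "0 \<le> op_norm_on V nrm (\<lambda>f z. T f z - K f z)"
proof -
  obtain C where "\<And>f. f \<in> V \<Longrightarrow> nrm (\<lambda>z. T f z - K f z) \<le> C * nrm f"
    using bounded_diff_compact[OF T K] by metis
  then have "nrm (\<lambda>z. T (\<lambda>_. 0) z - K (\<lambda>_. 0) z) \<le> op_norm_on V nrm (\<lambda>f z. T f z - K f z)"
    by (rule op_norm_ge) (use zero_in nrm_zero in auto)
  then show ?thesis using nrm_nonneg order_trans by blast
qed

lemma essential_norm_le:
  assumes T: "bounded_op_on V nrm T" and K: "compact_op_on V nrm K"
    and le: "\<And>f. f \<in> V \<Longrightarrow> nrm f \<le> 1 \<Longrightarrow> nrm (\<lambda>z. T f z - K f z) \<le> M"
  shows "essential_norm_on V nrm T \<le> M"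
  unfolding essential_norm_on_def
proof (rule cINF_lower2)
  show "bdd_below ((\<lambda>K. op_norm_on V nrm (\<lambda>f z. T f z - K f z)) ` {K. compact_op_on V nrm K})"
    using op_norm_diff_nonneg[OF T] by (intro bdd_belowI2[of _ 0]) auto
  show "op_norm_on V nrm (\<lambda>f z. T f z - K f z) \<le> M" using le by (rule op_norm_le)
qed (use K in auto)

lemma essential_norm_ge:
  assumes T: "bounded_op_on V nrm T"
    and le: "\<And>K. compact_op_on V nrm K \<Longrightarrow> M \<le> op_norm_on V nrm (\<lambda>f z. T f z - K f z)"
  shows "M \<le> essential_norm_on V nrm T"
  unfolding essential_norm_on_def using compact_op_zero le by (intro cINF_greatest) auto

text \<open>Let \<open>K u\<^sub>j \<rightarrow> h\<close> along a subsequence. The sum of \<open>N\<close> late terms has norm at most \<open>\<surd>N\<close>, so its image has norm at most \<open>C \<surd>N\<close>; but the image is also close to \<open>N h\<close>. Dividing by \<open>N\<close> shows \<open>h = 0\<close> in norm.\<close>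

lemma compact_op_vanishes_on_orthogonal_sequence:
  assumes K: "compact_op_on V nrm K" and u: "\<And>j::nat. u j \<in> V"
    and orth: "\<And>F. finite F \<Longrightarrow> (nrm (\<lambda>z. \<Sum>j\<in>F. u j z))\<^sup>2 \<le> card F"
  obtains r where "strict_mono r" "(\<lambda>k. nrm (K (u (r k)))) \<longlonglongrightarrow> 0"
proof -
  have lK: "linear_op_on V K" using K by (simp add: compact_op_on_def)
  obtain C where C: "0 \<le> C" "\<And>f. f \<in> V \<Longrightarrow> nrm (K f) \<le> C * nrm f" using compact_op_bounded[OF K] by metis
  have u1: "nrm (u j) \<le> 1" for j
    using orth[of "{j}"] nrm_nonneg[of "u j"] by (simp add: power_le_one_iff)
  have "bounded (range (\<lambda>j. nrm (u j)))" using u1 nrm_nonneg by (intro boundedI[of _ 1]) auto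
  then obtain r h where rh: "strict_mono r" "h \<in> V" "(\<lambda>k. nrm (\<lambda>z. K (u (r k)) z - h z)) \<longlonglongrightarrow> 0"
    using K u unfolding compact_op_on_def by meson
  have Ku: "K (u j) \<in> V" for j using linear_op_in[OF lK u] .
  have he: "nrm h \<le> \<epsilon>" if eps: "0 < \<epsilon>" for \<epsilon>
  proof -
    obtain k0 where k0: "\<And>k. k0 \<le> k \<Longrightarrow> nrm (\<lambda>z. K (u (r k)) z - h z) < \<epsilon>"
      using order_tendstoD(2)[OF rh(3) eps] by (auto simp: eventually_sequentially)
    have bound: "nrm h \<le> \<epsilon> + C / sqrt (real (Suc n))" for n
    proof -
      define N where "N = Suc n"
      define F where "F = {k0..<k0 + N}"
      have finF: "finite F" "card F = N" by (auto simp: F_def)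
      have "(nrm (\<lambda>z. \<Sum>k\<in>F. u (r k) z))\<^sup>2 = (nrm (\<lambda>z. \<Sum>j\<in>r ` F. u j z))\<^sup>2"
        using strict_mono_imp_inj_on[OF rh(1)] by (subst sum.reindex) (auto intro: inj_on_subset)
      also have "\<dots> \<le> real N"
        using orth[of "r ` F"] finF card_image_le[OF finF(1), of r] by (simp add: order_trans)
      finally have uF: "nrm (\<lambda>z. \<Sum>k\<in>F. u (r k) z) \<le> sqrt N" by (rule real_le_rsqrt)
      have SF: "(\<lambda>z. \<Sum>k\<in>F. u (r k) z) \<in> V" using u by (intro sum_in finF)
      have Kc: "nrm (\<lambda>z. \<Sum>k\<in>F. K (u (r k)) z) \<le> C * sqrt N"
      proof -
        have "nrm (K (\<lambda>z. \<Sum>k\<in>F. u (r k) z)) \<le> C * nrm (\<lambda>z. \<Sum>k\<in>F. u (r k) z)" by (rule C(2)[OF SF])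
        also have "\<dots> \<le> C * sqrt N" using uF C(1) by (rule mult_left_mono)
        finally show ?thesis using linear_op_sum[OF lK finF(1), of "\<lambda>k. u (r k)"] u by simp
      qed
      have dif: "nrm (\<lambda>z. \<Sum>k\<in>F. h z - K (u (r k)) z) \<le> N * \<epsilon>"
      proof -
        have "nrm (\<lambda>z. \<Sum>k\<in>F. h z - K (u (r k)) z) \<le> (\<Sum>k\<in>F. nrm (\<lambda>z. h z - K (u (r k)) z))"
          using rh(2) Ku by (intro nrm_sum finF diff_in)
        also have "\<dots> \<le> (\<Sum>k\<in>F. \<epsilon>)"
          using k0 nrm_diff_commute[OF rh(2) Ku] by (intro sum_mono) (auto simp: F_def intro: less_imp_le)
        finally show ?thesis using finF by simp
      qed
      have "N * nrm h = nrm (\<lambda>z. of_nat N * h z)" by (subst nrm_scale[OF rh(2)]) simp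
      also have "(\<lambda>z. of_nat N * h z) = (\<lambda>z. (\<Sum>k\<in>F. h z - K (u (r k)) z) + (\<Sum>k\<in>F. K (u (r k)) z))"
        using finF by (simp add: sum_subtractf)
      also have "nrm \<dots> \<le> nrm (\<lambda>z. \<Sum>k\<in>F. h z - K (u (r k)) z) + nrm (\<lambda>z. \<Sum>k\<in>F. K (u (r k)) z)"
        using rh(2) Ku by (intro nrm_triangle sum_in finF diff_in)
      also have "\<dots> \<le> N * \<epsilon> + C * sqrt N" using dif Kc by (rule add_mono)
      finally have "N * nrm h \<le> N * \<epsilon> + C * sqrt N" .
      moreover have "0 < real N" by (simp add: N_def)
      moreover have "sqrt N * sqrt N = N" by simp
      ultimately have "nrm h \<le> \<epsilon> + C * (sqrt N / N)" by (simp add: field_simps)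
      also have "sqrt N / N = 1 / sqrt N" by (simp add: real_div_sqrt divide_simps N_def)
      finally show ?thesis by (simp add: N_def)
    qed
    have "(\<lambda>n. \<epsilon> + C / sqrt (real (Suc n))) \<longlonglongrightarrow> \<epsilon> + 0"
    proof (intro tendsto_add tendsto_const tendsto_divide_0[OF tendsto_const] filterlim_at_top_imp_at_infinity)
      show "filterlim (\<lambda>n. sqrt (real (Suc n))) at_top sequentially"
        by (intro filterlim_compose[OF sqrt_at_top] filterlim_compose[OF filterlim_real_sequentially] filterlim_Suc)
    qed
    then show ?thesis using bound by (intro LIMSEQ_le_const[of "\<lambda>n. \<epsilon> + C / sqrt (real (Suc n))"]) auto
  qed
  then have h0: "nrm h = 0" using nrm_nonneg[of h] by (meson dual_order.antisym field_le_epsilon add_0 order.trans le_less_linear dense not_le)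
  have "(\<lambda>k. nrm (K (u (r k)))) \<longlonglongrightarrow> 0"
  proof (rule tendsto_sandwich[OF _ _ tendsto_const rh(3)])
    show "eventually (\<lambda>k. nrm (K (u (r k))) \<le> nrm (\<lambda>z. K (u (r k)) z - h z)) sequentially"
      using nrm_le_diff[OF Ku rh(2)] h0 by simp
  qed (simp add: nrm_nonneg)
  then show ?thesis using that rh(1) by blast
qed

text \<open>Along a subsequence the compact perturbation disappears and \<open>T\<close> alone remains.\<close>

lemma essential_norm_ge_orthogonal_sequence:
  assumes T: "bounded_op_on V nrm T" and u: "\<And>j::nat. u j \<in> V"
    and orth: "\<And>F. finite F \<Longrightarrow> (nrm (\<lambda>z. \<Sum>j\<in>F. u j z))\<^sup>2 \<le> card F"
    and l: "\<And>j. l \<le> nrm (T (u j))"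
  shows "l \<le> essential_norm_on V nrm T"
proof (rule essential_norm_ge[OF T])
  fix K assume K: "compact_op_on V nrm K"
  have lT: "linear_op_on V T" using T by (simp add: bounded_op_on_def)
  have lK: "linear_op_on V K" using K by (simp add: compact_op_on_def)
  have u1: "nrm (u j) \<le> 1" for j
    using orth[of "{j}"] nrm_nonneg[of "u j"] by (simp add: power_le_one_iff)
  obtain r where r: "strict_mono r" "(\<lambda>k. nrm (K (u (r k)))) \<longlonglongrightarrow> 0"
    using compact_op_vanishes_on_orthogonal_sequence[OF K u orth] by metis
  obtain C where C: "\<And>f. f \<in> V \<Longrightarrow> nrm (\<lambda>z. T f z - K f z) \<le> C * nrm f"
    using bounded_diff_compact[OF T K] by metis
  have "l - nrm (K (u (r k))) \<le> op_norm_on V nrm (\<lambda>f z. T f z - K f z)" for k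
  proof -
    have "l \<le> nrm (T (u (r k)))" by (rule l)
    also have "\<dots> \<le> nrm (\<lambda>z. T (u (r k)) z - K (u (r k)) z) + nrm (K (u (r k)))"
      by (rule nrm_le_diff) (auto intro: linear_op_in[OF lT] linear_op_in[OF lK] u)
    also have "nrm (\<lambda>z. T (u (r k)) z - K (u (r k)) z) \<le> op_norm_on V nrm (\<lambda>f z. T f z - K f z)"
      by (rule op_norm_ge[OF C u u1])
    finally show ?thesis by simp
  qed
  moreover have "(\<lambda>k. l - nrm (K (u (r k)))) \<longlonglongrightarrow> l - 0" by (intro tendsto_diff tendsto_const r)
  ultimately show "l \<le> op_norm_on V nrm (\<lambda>f z. T f z - K f z)"
    by (intro LIMSEQ_le_const2[of "\<lambda>k. l - nrm (K (u (r k)))"]) auto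
qed

end

section \<open>The Dirichlet space\<close>

text \<open>The derivative inside the disk, extended by zero. Derivatives at boundary points of the disk depend on the extension of \<open>f\<close> and would spoil measurability.\<close>

definition disk_deriv :: "(complex \<Rightarrow> complex) \<Rightarrow> complex \<Rightarrow> complex" where
  "disk_deriv f = (\<lambda>z. indicator unit_disk z *\<^sub>R deriv f z)"

lemma disk_analytic_holomorphic: "f \<in> disk_analytic \<Longrightarrow> f holomorphic_on unit_disk"
  by (simp add: disk_analytic_def)

lemma disk_deriv_holomorphic: "f \<in> disk_analytic \<Longrightarrow> disk_deriv f holomorphic_on unit_disk"
  by (rule holomorphic_transform[of "deriv f"])
     (auto simp: disk_deriv_def disk_analytic_def intro!: holomorphic_deriv)

lemma disk_deriv_borel [measurable]: "f \<in> disk_analytic \<Longrightarrow> disk_deriv f \<in> borel_measurable borel"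
  unfolding disk_deriv_def
  by (intro holomorphic_on_disk_borel holomorphic_deriv) (auto simp: disk_analytic_def)

lemma disk_analytic_borel: 
  assumes "g \<in> disk_analytic" shows "g \<in> borel_measurable borel"
proof -
  have "g = (\<lambda>z. indicator unit_disk z *\<^sub>R g z)" using assms by (auto simp: disk_analytic_def indicator_def)
  then show ?thesis using holomorphic_on_disk_borel[of g] assms by (simp add: disk_analytic_def)
qed

lemma disk_deriv_eqI:
  assumes "\<And>z. z \<in> unit_disk \<Longrightarrow> (f has_field_derivative g z) (at z)"
  shows "disk_deriv f = (\<lambda>z. indicator unit_disk z *\<^sub>R g z)"
  using assms DERIV_imp_deriv by (fastforce simp: disk_deriv_def indicator_def)

lemma disk_analytic_derivative:
  "f \<in> disk_analytic \<Longrightarrow> z \<in> unit_disk \<Longrightarrow> (f has_field_derivative disk_deriv f z) (at z)"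
  using holomorphic_derivI[of f unit_disk z UNIV] by (auto simp: disk_deriv_def disk_analytic_def)

lemma disk_analytic_zero: "(\<lambda>_. 0) \<in> disk_analytic" by (simp add: disk_analytic_def)

lemma disk_analytic_add: "f \<in> disk_analytic \<Longrightarrow> g \<in> disk_analytic \<Longrightarrow> (\<lambda>z. f z + g z) \<in> disk_analytic"
  by (auto simp: disk_analytic_def intro!: holomorphic_intros)

lemma disk_analytic_scale: "f \<in> disk_analytic \<Longrightarrow> (\<lambda>z. c * f z) \<in> disk_analytic"
  by (auto simp: disk_analytic_def intro!: holomorphic_intros)

lemma disk_deriv_zero: "disk_deriv (\<lambda>_. 0) = (\<lambda>_. 0)" by (auto simp: disk_deriv_def)

lemma disk_deriv_add:
  assumes "f \<in> disk_analytic" "g \<in> disk_analytic"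
  shows "disk_deriv (\<lambda>z. f z + g z) = (\<lambda>z. disk_deriv f z + disk_deriv g z)"
proof -
  have "disk_deriv (\<lambda>z. f z + g z) = (\<lambda>z. indicator unit_disk z *\<^sub>R (disk_deriv f z + disk_deriv g z))"
    by (intro disk_deriv_eqI DERIV_add disk_analytic_derivative assms)
  then show ?thesis by (auto simp: disk_deriv_def indicator_def)
qed

lemma disk_deriv_scale:
  assumes "f \<in> disk_analytic"
  shows "disk_deriv (\<lambda>z. c * f z) = (\<lambda>z. c * disk_deriv f z)"
proof -
  have "disk_deriv (\<lambda>z. c * f z) = (\<lambda>z. indicator unit_disk z *\<^sub>R (c * disk_deriv f z))"
    by (intro disk_deriv_eqI DERIV_cmult disk_analytic_derivative assms)
  then show ?thesis by (auto simp: disk_deriv_def indicator_def)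
qed

lemma energy_disk_deriv: "energy \<alpha> (deriv f) = energy \<alpha> (disk_deriv f)"
  by (rule energy_cong) (simp add: disk_deriv_def)

lemma dirichlet_space_iff: "f \<in> dirichlet_space \<alpha> \<longleftrightarrow> f \<in> disk_analytic \<and> energy \<alpha> (disk_deriv f) < \<infinity>"
  unfolding dirichlet_space_def energy_disk_deriv[symmetric] by (simp add: energy_def)

lemma dirichlet_norm_eq: "dirichlet_norm \<alpha> f = sqrt ((cmod (f 0))\<^sup>2 + (l2_norm (dA_weighted \<alpha>) (disk_deriv f))\<^sup>2)"
  unfolding dirichlet_norm_def using energy_disk_deriv[of \<alpha> f] by (simp add: energy_def l2_norm_def)

lemma dirichlet_norm_sq:
  assumes "f \<in> dirichlet_space \<alpha>"
  shows "ennreal ((dirichlet_norm \<alpha> f)\<^sup>2) = ennreal ((cmod (f 0))\<^sup>2) + energy \<alpha> (disk_deriv f)"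
  using assms l2_norm_sq[where g="disk_deriv f" and M="dA_weighted \<alpha>"]
  by (simp add: dirichlet_norm_eq dirichlet_space_iff energy_def)

text \<open>The norm is the Euclidean combination of \<open>\<bar>f 0\<bar>\<close> and an \<open>L\<^sup>2\<close> norm of the derivative, so the triangle inequality follows from those in \<open>L\<^sup>2\<close> and in the plane.\<close>

lemma function_norm_dirichlet: "function_norm (dirichlet_space \<alpha>) (dirichlet_norm \<alpha>)"
proof
  fix f g c
  show "(\<lambda>_. 0) \<in> dirichlet_space \<alpha>"
    by (simp add: dirichlet_space_iff disk_analytic_zero disk_deriv_zero energy_def)
  show "0 \<le> dirichlet_norm \<alpha> f" by (simp add: dirichlet_norm_eq)
  assume f: "f \<in> dirichlet_space \<alpha>"
  then have fa: "f \<in> disk_analytic" and ff: "(\<integral>\<^sup>+z. ennreal ((cmod (disk_deriv f z))\<^sup>2) \<partial>dA_weighted \<alpha>) < \<infinity>"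
    by (auto simp: dirichlet_space_iff energy_def)
  have fm: "disk_deriv f \<in> borel_measurable (dA_weighted \<alpha>)" using disk_deriv_borel[OF fa] by simp
  show "(\<lambda>z. c * f z) \<in> dirichlet_space \<alpha>"
    using f energy_cmult[where g="disk_deriv f" and \<alpha>=\<alpha> and c=c] disk_deriv_borel[OF fa]
    by (simp add: dirichlet_space_iff disk_analytic_scale disk_deriv_scale ennreal_mult_less_top)
  have "(cmod (c * f 0))\<^sup>2 + (cmod c * l2_norm (dA_weighted \<alpha>) (disk_deriv f))\<^sup>2
      = (cmod c)\<^sup>2 * ((cmod (f 0))\<^sup>2 + (l2_norm (dA_weighted \<alpha>) (disk_deriv f))\<^sup>2)"
    by (simp add: norm_mult power_mult_distrib distrib_left)
  then show "dirichlet_norm \<alpha> (\<lambda>z. c * f z) = cmod c * dirichlet_norm \<alpha> f"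
    unfolding dirichlet_norm_eq disk_deriv_scale[OF fa] l2_norm_cmult[OF fm]
    by (simp add: real_sqrt_mult)
  assume g: "g \<in> dirichlet_space \<alpha>"
  then have ga: "g \<in> disk_analytic" and gf: "(\<integral>\<^sup>+z. ennreal ((cmod (disk_deriv g z))\<^sup>2) \<partial>dA_weighted \<alpha>) < \<infinity>"
    by (auto simp: dirichlet_space_iff energy_def)
  have gm: "disk_deriv g \<in> borel_measurable (dA_weighted \<alpha>)" using disk_deriv_borel[OF ga] by simp
  note tri = l2_norm_triangle[OF fm gm ff gf]
  show "(\<lambda>z. f z + g z) \<in> dirichlet_space \<alpha>"
    using fa ga tri(1) by (simp add: dirichlet_space_iff disk_analytic_add disk_deriv_add energy_def)
  have "dirichlet_norm \<alpha> (\<lambda>z. f z + g z) \<le> sqrt ((cmod (f 0) + cmod (g 0))\<^sup>2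
      + (l2_norm (dA_weighted \<alpha>) (disk_deriv f) + l2_norm (dA_weighted \<alpha>) (disk_deriv g))\<^sup>2)"
    unfolding dirichlet_norm_eq disk_deriv_add[OF fa ga]
    by (intro real_sqrt_le_mono add_mono power_mono norm_triangle_ineq tri) auto
  also have "\<dots> \<le> dirichlet_norm \<alpha> f + dirichlet_norm \<alpha> g"
    unfolding dirichlet_norm_eq by (rule real_sqrt_sum_squares_triangle_ineq)
  finally show "dirichlet_norm \<alpha> (\<lambda>z. f z + g z) \<le> dirichlet_norm \<alpha> f + dirichlet_norm \<alpha> g" .
qed

lemma bergman_space_iff: "g \<in> bergman_space \<alpha> \<longleftrightarrow> g \<in> disk_analytic \<and> energy \<alpha> g < \<infinity>"
  by (simp add: bergman_space_def energy_def)

lemma bergman_norm_one_iff: "g \<in> bergman_space \<alpha> \<and> bergman_norm \<alpha> g = 1 \<longleftrightarrow> g \<in> disk_analytic \<and> energy \<alpha> g = 1"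
proof -
  have "sqrt (enn2real x) = 1 \<longleftrightarrow> x = 1" if "x < \<infinity>" for x :: ennreal
    using that by (cases x) (auto simp: ennreal_1[symmetric] simp del: ennreal_1)
  then show ?thesis
    by (auto simp: bergman_space_iff bergman_norm_def energy_def)
qed

definition disk_poly :: "nat set \<Rightarrow> (nat \<Rightarrow> complex) \<Rightarrow> complex \<Rightarrow> complex" where
  "disk_poly A b = (\<lambda>z. indicator unit_disk z *\<^sub>R (\<Sum>k\<in>A. b k * z ^ k))"

text \<open>The primitive, vanishing at the origin, of \<open>disk_poly A b\<close>. Its Dirichlet norm is the Bergman norm of that polynomial.\<close>

definition disk_poly_primitive :: "nat set \<Rightarrow> (nat \<Rightarrow> complex) \<Rightarrow> complex \<Rightarrow> complex" where
  "disk_poly_primitive A b = (\<lambda>z. indicator unit_disk z *\<^sub>R (\<Sum>k\<in>A. b k / of_nat (Suc k) * z ^ Suc k))"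

lemma indicator_disk_analytic: "p holomorphic_on unit_disk \<Longrightarrow> (\<lambda>z. indicator unit_disk z *\<^sub>R p z) \<in> disk_analytic"
  unfolding disk_analytic_def by (auto intro!: holomorphic_transform[of p unit_disk])

lemma disk_poly_analytic: "disk_poly A b \<in> disk_analytic"
  unfolding disk_poly_def by (intro indicator_disk_analytic holomorphic_intros)

lemma disk_poly_primitive_analytic: "disk_poly_primitive A b \<in> disk_analytic"
  unfolding disk_poly_primitive_def by (intro indicator_disk_analytic holomorphic_intros) (simp_all del: of_nat_Suc)

lemma has_field_derivative_on_disk:
  assumes "(p has_field_derivative d) (at z)" "z \<in> unit_disk"
  shows "((\<lambda>z. indicator unit_disk z *\<^sub>R p z) has_field_derivative d) (at z)"
  by (rule has_field_derivative_transform_within_open[OF assms(1), of unit_disk]) (use assms in auto)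

lemma disk_deriv_poly_primitive: "disk_deriv (disk_poly_primitive A b) = disk_poly A b"
proof -
  have "((\<lambda>z. \<Sum>k\<in>A. b k / of_nat (Suc k) * z ^ Suc k) has_field_derivative (\<Sum>k\<in>A. b k * z ^ k)) (at z)" for z
  proof (rule DERIV_sum)
    fix k
    have "((\<lambda>z. b k / of_nat (Suc k) * z ^ Suc k) has_field_derivative (b k / of_nat (Suc k) * (of_nat (Suc k) * z ^ k))) (at z)"
      by (rule DERIV_cmult) (use DERIV_power_Suc[OF DERIV_ident, of k z] in simp)
    then show "((\<lambda>z. b k / of_nat (Suc k) * z ^ Suc k) has_field_derivative b k * z ^ k) (at z)" by (simp del: of_nat_Suc)
  qed
  then show ?thesis unfolding disk_poly_primitive_def disk_poly_def
    by (intro disk_deriv_eqI has_field_derivative_on_disk)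
qed

lemma energy_disk_poly: "energy \<alpha> (disk_poly A b) = energy \<alpha> (\<lambda>z. \<Sum>k\<in>A. b k * z ^ k)"
  unfolding disk_poly_def by (rule energy_cong) simp

definition disk_monomial :: "nat \<Rightarrow> complex \<Rightarrow> complex" where
  "disk_monomial k = (\<lambda>z. indicator unit_disk z *\<^sub>R z ^ k)"

lemma disk_monomial_analytic: "disk_monomial k \<in> disk_analytic"
  unfolding disk_monomial_def by (intro indicator_disk_analytic holomorphic_intros)

lemma disk_deriv_monomial: "disk_deriv (disk_monomial k) = (\<lambda>z. indicator unit_disk z *\<^sub>R (of_nat k * z ^ (k - 1)))"
  unfolding disk_monomial_def
  by (intro disk_deriv_eqI has_field_derivative_on_disk) (auto intro!: derivative_eq_intros)

lemma disk_monomial_dirichlet: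
  assumes "\<alpha> > -1" shows "disk_monomial k \<in> dirichlet_space \<alpha>"
proof -
  have "energy \<alpha> (disk_deriv (disk_monomial k)) = energy \<alpha> (\<lambda>z. of_nat k * z ^ (k - 1))"
    unfolding disk_deriv_monomial by (rule energy_cong) simp
  also have "\<dots> < \<infinity>"
    by (subst energy_cmult) (auto simp: ennreal_mult_less_top energy_monomial_finite[OF assms, unfolded infinity_ennreal_def])
  finally show ?thesis by (simp add: dirichlet_space_iff disk_monomial_analytic)
qed

section \<open>The measure induced by a composition operator\<close>

text \<open>The measure \<open>\<nu>\<close> has density \<open>(1 + \<alpha>) N / \<pi>\<close>, with \<open>N\<close> the counting function. The first property is the area formula applied to \<open>\<bar>f'\<bar>\<^sup>2\<close> after the chain rule; the second one identifies the integrals of the counting function over annuli.\<close>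

lemma composition_measure:
  assumes \<alpha>: "\<alpha> > -1" and hol: "\<phi> holomorphic_on unit_disk" and self: "\<phi> ` unit_disk \<subseteq> unit_disk"
    and nc: "\<not> \<phi> constant_on unit_disk"
  obtains \<nu> :: "complex measure" where "sets \<nu> = sets borel"
    "\<And>f. f \<in> disk_analytic \<Longrightarrow> composition_op \<phi> f \<in> disk_analytic \<and>
        energy \<alpha> (disk_deriv (composition_op \<phi> f)) = (\<integral>\<^sup>+w. ennreal ((cmod (disk_deriv f w))\<^sup>2) \<partial>\<nu>)"
    "\<And>g R. g \<in> disk_analytic \<Longrightarrow>
        (\<integral>\<^sup>+w. ennreal ((cmod (g w))\<^sup>2) * indicator {w \<in> unit_disk. R < cmod w} w \<partial>\<nu>)
        = ennreal (1 + \<alpha>) * (\<integral>\<^sup>+w\<in>{w \<in> unit_disk. cmod w > R}. (ennreal ((cmod (g w))\<^sup>2) * counting_function \<phi> \<alpha> w) \<partial>dA)"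
proof -
  obtain N where N [measurable]: "N \<in> borel_measurable borel" and cN: "AE w in lborel. counting_function \<phi> \<alpha> w = N w"
    and area: "\<And>F :: complex \<Rightarrow> ennreal. F \<in> borel_measurable borel \<Longrightarrow>
      (\<integral>\<^sup>+z. F (\<phi> z) * ennreal ((cmod (deriv \<phi> z))\<^sup>2) * ennreal ((1 - (cmod z)\<^sup>2) powr \<alpha>) * indicator unit_disk z \<partial>lborel)
      = (\<integral>\<^sup>+w. F w * N w \<partial>lborel)"
    by (rule area_formula_counting_function[OF hol nc, where \<alpha>=\<alpha>]) (rule that)
  define c where "c = ennreal ((1 + \<alpha>) / pi)"
  have c: "ennreal (1 + \<alpha>) * (x / ennreal pi) = c * x" for x
    using \<alpha> by (simp add: c_def divide_ennreal_def divide_inverse ennreal_mult inverse_ennreal mult_ac)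
  define \<nu> where "\<nu> = density lborel (\<lambda>w. c * N w)"
  have nu: "(\<integral>\<^sup>+w. F w \<partial>\<nu>) = c * (\<integral>\<^sup>+w. F w * N w \<partial>lborel)" if [measurable]: "F \<in> borel_measurable borel" for F
    unfolding \<nu>_def by (simp add: nn_integral_density mult.assoc nn_integral_cmult mult.commute[of "F _"])
  show ?thesis
  proof (rule that)
    show "sets \<nu> = sets borel" by (simp add: \<nu>_def)
  next
    fix f assume f: "f \<in> disk_analytic"
    have der: "(composition_op \<phi> f has_field_derivative disk_deriv f (\<phi> z) * deriv \<phi> z) (at z)" if z: "z \<in> unit_disk" for z
    proof -
      have "(\<phi> has_field_derivative deriv \<phi> z) (at z)" using holomorphic_derivI[OF hol _ z] by simp
      moreover have "(f has_field_derivative disk_deriv f (\<phi> z)) (at (\<phi> z))"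
        using self z by (intro disk_analytic_derivative f) blast
      ultimately have "((\<lambda>z. f (\<phi> z)) has_field_derivative disk_deriv f (\<phi> z) * deriv \<phi> z) (at z)"
        by (rule DERIV_chain2[rotated])
      from has_field_derivative_on_disk[OF this z] show ?thesis
        by (rule has_field_derivative_transform_within_open[of _ _ _ unit_disk]) (use z in \<open>auto simp: composition_op_def\<close>)
    qed
    have Ca: "composition_op \<phi> f \<in> disk_analytic"
    proof -
      have "composition_op \<phi> f holomorphic_on unit_disk" using der by (subst holomorphic_on_open) blast+
      moreover have "\<forall>z. z \<notin> unit_disk \<longrightarrow> composition_op \<phi> f z = 0" by (simp add: composition_op_def)
      ultimately show ?thesis by (simp only: disk_analytic_def mem_Collect_eq)
    qed
    have dC: "disk_deriv (composition_op \<phi> f) = (\<lambda>z. indicator unit_disk z *\<^sub>R (disk_deriv f (\<phi> z) * deriv \<phi> z))"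
      by (rule disk_deriv_eqI[OF der])
    have [measurable]: "disk_deriv f \<in> borel_measurable borel" "disk_deriv (composition_op \<phi> f) \<in> borel_measurable borel"
      using disk_deriv_borel f Ca by auto
    have "energy \<alpha> (disk_deriv (composition_op \<phi> f)) =
       (\<integral>\<^sup>+z. ennreal ((1 + \<alpha>) * (1 - (cmod z)\<^sup>2) powr \<alpha>) * ennreal ((cmod (disk_deriv (composition_op \<phi> f) z))\<^sup>2) * indicator unit_disk z \<partial>lborel) / ennreal pi"
      unfolding energy_def by (rule nn_integral_dA_weighted) measurable
    also have "(\<integral>\<^sup>+z. ennreal ((1 + \<alpha>) * (1 - (cmod z)\<^sup>2) powr \<alpha>) * ennreal ((cmod (disk_deriv (composition_op \<phi> f) z))\<^sup>2) * indicator unit_disk z \<partial>lborel)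
       = (\<integral>\<^sup>+z. ennreal (1 + \<alpha>) * (ennreal ((1 - (cmod z)\<^sup>2) powr \<alpha>) * ennreal ((cmod (disk_deriv (composition_op \<phi> f) z))\<^sup>2) * indicator unit_disk z) \<partial>lborel)"
      using \<alpha> by (simp add: ennreal_mult mult_ac)
    also have "\<dots> = ennreal (1 + \<alpha>) * (\<integral>\<^sup>+z. ennreal ((1 - (cmod z)\<^sup>2) powr \<alpha>) * ennreal ((cmod (disk_deriv (composition_op \<phi> f) z))\<^sup>2) * indicator unit_disk z \<partial>lborel)"
      by (rule nn_integral_cmult) measurable
    also have "(\<integral>\<^sup>+z. ennreal ((1 - (cmod z)\<^sup>2) powr \<alpha>) * ennreal ((cmod (disk_deriv (composition_op \<phi> f) z))\<^sup>2) * indicator unit_disk z \<partial>lborel)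
       = (\<integral>\<^sup>+z. ennreal ((cmod (disk_deriv f (\<phi> z)))\<^sup>2) * ennreal ((cmod (deriv \<phi> z))\<^sup>2) * ennreal ((1 - (cmod z)\<^sup>2) powr \<alpha>) * indicator unit_disk z \<partial>lborel)"
      by (intro nn_integral_cong) (auto simp: dC indicator_def norm_mult power_mult_distrib ennreal_mult mult_ac)
    also have "\<dots> = (\<integral>\<^sup>+w. ennreal ((cmod (disk_deriv f w))\<^sup>2) * N w \<partial>lborel)"
      by (rule area) measurable
    also have "ennreal (1 + \<alpha>) * \<dots> / ennreal pi = (\<integral>\<^sup>+w. ennreal ((cmod (disk_deriv f w))\<^sup>2) \<partial>\<nu>)"
      by (subst nu, measurable) (simp only: c[symmetric] ennreal_times_divide)
    finally show "composition_op \<phi> f \<in> disk_analytic \<and>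
        energy \<alpha> (disk_deriv (composition_op \<phi> f)) = (\<integral>\<^sup>+w. ennreal ((cmod (disk_deriv f w))\<^sup>2) \<partial>\<nu>)"
      using Ca by blast
  next
    fix g :: "complex \<Rightarrow> complex" and R :: real assume g: "g \<in> disk_analytic"
    have [measurable]: "g \<in> borel_measurable borel" using disk_analytic_borel[OF g] .
    have [measurable]: "{w \<in> unit_disk. R < cmod w} \<in> sets borel" by measurable
    have "(\<integral>\<^sup>+w\<in>{w \<in> unit_disk. cmod w > R}. (ennreal ((cmod (g w))\<^sup>2) * counting_function \<phi> \<alpha> w) \<partial>dA)
       = (\<integral>\<^sup>+w. ennreal ((cmod (g w))\<^sup>2) * N w * indicator {w \<in> unit_disk. R < cmod w} w \<partial>dA)"
    proof (rule nn_integral_cong_AE)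
      have "AE w in dA. counting_function \<phi> \<alpha> w = N w"
        unfolding dA_def by (rule AE_uniform_measureI) (use cN in auto)
      then show "AE w in dA. ennreal ((cmod (g w))\<^sup>2) * counting_function \<phi> \<alpha> w * indicator {w \<in> unit_disk. cmod w > R} w
         = ennreal ((cmod (g w))\<^sup>2) * N w * indicator {w \<in> unit_disk. R < cmod w} w" by eventually_elim simp
    qed
    also have "\<dots> = (\<integral>\<^sup>+w. ennreal ((cmod (g w))\<^sup>2) * N w * indicator {w \<in> unit_disk. R < cmod w} w * indicator unit_disk w \<partial>lborel) / ennreal pi"
      by (rule nn_integral_dA) measurable
    also have "(\<integral>\<^sup>+w. ennreal ((cmod (g w))\<^sup>2) * N w * indicator {w \<in> unit_disk. R < cmod w} w * indicator unit_disk w \<partial>lborel)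
        = (\<integral>\<^sup>+w. ennreal ((cmod (g w))\<^sup>2) * indicator {w \<in> unit_disk. R < cmod w} w * N w \<partial>lborel)"
      by (intro nn_integral_cong) (auto simp: indicator_def)
    finally show "(\<integral>\<^sup>+w. ennreal ((cmod (g w))\<^sup>2) * indicator {w \<in> unit_disk. R < cmod w} w \<partial>\<nu>)
        = ennreal (1 + \<alpha>) * (\<integral>\<^sup>+w\<in>{w \<in> unit_disk. cmod w > R}. (ennreal ((cmod (g w))\<^sup>2) * counting_function \<phi> \<alpha> w) \<partial>dA)"
      by (subst nu) (auto simp: c)
  qed
qed

text \<open>The data of the problem after the change of variables: only the measure \<open>\<nu>\<close> and the base point \<open>z0 = \<phi> 0\<close> are left of the self-map.\<close>

locale carleson_composition =
  fixes \<alpha> :: real and \<nu> :: "complex measure" and T :: "(complex \<Rightarrow> complex) \<Rightarrow> complex \<Rightarrow> complex" and z0 :: complex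
  assumes \<alpha>: "\<alpha> > -1" and sets_nu [simp, measurable_cong]: "sets \<nu> = sets borel" and z0: "z0 \<in> unit_disk"
    and T: "bounded_op_on (dirichlet_space \<alpha>) (dirichlet_norm \<alpha>) T"
    and T_norm: "f \<in> dirichlet_space \<alpha> \<Longrightarrow>
      ennreal ((dirichlet_norm \<alpha> (T f))\<^sup>2) = ennreal ((cmod (f z0))\<^sup>2) + (\<integral>\<^sup>+w. ennreal ((cmod (disk_deriv f w))\<^sup>2) \<partial>\<nu>)"
begin

sublocale function_norm "dirichlet_space \<alpha>" "dirichlet_norm \<alpha>" by (rule function_norm_dirichlet)

lemma linear_T: "linear_op_on (dirichlet_space \<alpha>) T" using T by (simp add: bounded_op_on_def)

text \<open>The function \<open>z\<close> has derivative one, so the mass of the disk is at most the squared norm of its image.\<close>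

lemma nu_disk_finite: "emeasure \<nu> unit_disk < \<infinity>"
proof -
  have "emeasure \<nu> unit_disk = (\<integral>\<^sup>+w. indicator unit_disk w \<partial>\<nu>)" by simp
  also have "\<dots> = (\<integral>\<^sup>+w. ennreal ((cmod (disk_deriv (disk_monomial 1) w))\<^sup>2) \<partial>\<nu>)"
    by (intro nn_integral_cong) (auto simp: disk_deriv_monomial indicator_def)
  also have "\<dots> \<le> ennreal ((dirichlet_norm \<alpha> (T (disk_monomial 1)))\<^sup>2)"
    using T_norm[OF disk_monomial_dirichlet[OF \<alpha>, of 1]] by simp
  also have "\<dots> < \<infinity>" by simp
  finally show ?thesis .
qed

definition annulus_energy :: "real \<Rightarrow> (complex \<Rightarrow> complex) \<Rightarrow> ennreal" where
  "annulus_energy R g = (\<integral>\<^sup>+w. ennreal ((cmod (g w))\<^sup>2) * indicator {w \<in> unit_disk. R < cmod w} w \<partial>\<nu>)"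

text \<open>The squared norm of the inclusion of the Bergman space into \<open>L\<^sup>2\<close> of \<open>\<nu>\<close> on the annulus.\<close>

definition annulus_norm :: "real \<Rightarrow> ennreal" where
  "annulus_norm R = (SUP g\<in>{g \<in> disk_analytic. energy \<alpha> g = 1}. annulus_energy R g)"

lemma annulus_borel [measurable]: "{w \<in> unit_disk. R < cmod w} \<in> sets borel" by measurable

text \<open>Both sides are quadratic in \<open>g\<close>, so one rescales to energy one. A function of zero energy has zero Taylor coefficients, hence vanishes on the disk.\<close>

lemma annulus_energy_le_norm:
  assumes g: "g \<in> disk_analytic" and e: "energy \<alpha> g \<le> 1"
  shows "annulus_energy R g \<le> annulus_norm R"
proof -
  have [measurable]: "g \<in> borel_measurable borel" by (rule disk_analytic_borel[OF g])
  obtain c where c: "energy \<alpha> g = ennreal c" "0 \<le> c" "c \<le> 1"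
    using e by (cases "energy \<alpha> g") (auto simp: top_unique)
  show ?thesis
  proof (cases "c = 0")
    case True
    obtain C where C: "0 < C" "\<And>e g s k. has_coeffs e g \<Longrightarrow> 0 \<le> s \<Longrightarrow> energy \<alpha> g \<le> ennreal (s\<^sup>2) \<Longrightarrow> cmod (e k) \<le> C * s / (1/2) ^ k"
      by (rule coefficient_bound[OF \<alpha>, of "1/2"]) auto
    define e where "e = (\<lambda>k. (deriv ^^ k) g 0 / fact k)"
    have hc: "has_coeffs e g"
      unfolding e_def by (rule holomorphic_has_coeffs[OF disk_analytic_holomorphic[OF g]])
    have "e k = 0" for k using C(2)[OF hc, of 0 k] c True by simp
    then have "g w = 0" if "w \<in> unit_disk" for w
      using hc that by (auto simp: has_coeffs_def sums_iff)
    then have "annulus_energy R g = (\<integral>\<^sup>+w. 0 \<partial>\<nu>)" unfolding annulus_energy_def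
      by (intro nn_integral_cong) (auto simp: indicator_def)
    then show ?thesis by simp
  next
    case False
    define h where "h = (\<lambda>z. complex_of_real (1 / sqrt c) * g z)"
    have cp: "0 < c" using c False by simp
    have h: "h \<in> disk_analytic" unfolding h_def by (rule disk_analytic_scale[OF g])
    have n: "(cmod (complex_of_real (1 / sqrt c)))\<^sup>2 = 1 / c"
      using cp unfolding norm_of_real by (simp add: power_divide)
    have "energy \<alpha> h = ennreal (1 / c) * ennreal c" unfolding h_def by (subst energy_cmult) (auto simp only: n c \<open>g \<in> borel_measurable borel\<close>)
    also have "\<dots> = 1" using cp by (simp flip: ennreal_mult)
    finally have eh: "energy \<alpha> h = 1" .
    have "annulus_energy R g \<le> annulus_energy R h"
      unfolding annulus_energy_def
    proof (intro nn_integral_mono mult_right_mono ennreal_leI)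
      fix w
      have "(cmod (h w))\<^sup>2 = 1 / c * (cmod (g w))\<^sup>2" unfolding h_def norm_mult power_mult_distrib n ..
      moreover have "1 * (cmod (g w))\<^sup>2 \<le> 1 / c * (cmod (g w))\<^sup>2" using cp c by (intro mult_right_mono) auto
      ultimately show "(cmod (g w))\<^sup>2 \<le> (cmod (h w))\<^sup>2" by simp
    qed auto
    also have "\<dots> \<le> annulus_norm R" unfolding annulus_norm_def by (rule SUP_upper) (use h eh in simp)
    finally show ?thesis .
  qed
qed

lemma annulus_norm_antimono: "R \<le> S \<Longrightarrow> annulus_norm S \<le> annulus_norm R"
  unfolding annulus_norm_def annulus_energy_def
  by (intro SUP_mono' nn_integral_mono mult_left_mono) (auto simp: indicator_def)

section \<open>The upper bound\<close>

definition taylor_coeff :: "nat \<Rightarrow> (complex \<Rightarrow> complex) \<Rightarrow> complex" where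
  "taylor_coeff k f = (deriv ^^ k) f 0 / fact k"

text \<open>Differentiation lowers degrees by one, so subtracting the terms of \<open>f\<close> of degree at most \<open>n\<close> removes the first \<open>n\<close> terms of \<open>f'\<close>.\<close>

definition taylor_remainder :: "nat \<Rightarrow> (complex \<Rightarrow> complex) \<Rightarrow> complex \<Rightarrow> complex" where
  "taylor_remainder n f = (\<lambda>z. f z - (\<Sum>k<Suc n. taylor_coeff k f * disk_monomial k z))"

lemma has_coeffs_disk_deriv:
  assumes f: "f \<in> disk_analytic"
  shows "has_coeffs (\<lambda>k. of_nat (Suc k) * taylor_coeff (Suc k) f) (disk_deriv f)"
proof -
  have "has_coeffs (\<lambda>k. (deriv ^^ k) (deriv f) 0 / fact k) (deriv f)"
    by (intro holomorphic_has_coeffs holomorphic_deriv disk_analytic_holomorphic[OF f]) auto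
  moreover have "(deriv ^^ k) (deriv f) 0 / fact k = of_nat (Suc k) * taylor_coeff (Suc k) f" for k
  proof -
    have "(deriv ^^ k) (deriv f) = (deriv ^^ Suc k) f" by (simp add: funpow_swap1)
    then show ?thesis by (simp add: taylor_coeff_def fact_Suc del: of_nat_Suc funpow.simps)
  qed
  ultimately show ?thesis by (simp add: has_coeffs_def disk_deriv_def)
qed

lemma taylor_coeff_bound:
  obtains C where "\<And>f. f \<in> dirichlet_space \<alpha> \<Longrightarrow> cmod (taylor_coeff k f) \<le> C * dirichlet_norm \<alpha> f"
proof (cases k)
  case 0
  have "cmod (f 0) \<le> dirichlet_norm \<alpha> f" for f unfolding dirichlet_norm_eq by (rule real_le_rsqrt) simp
  then show ?thesis using that[of 1] by (simp add: taylor_coeff_def 0)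
next
  case (Suc j)
  obtain C where C: "0 < C" "\<And>e g s k. has_coeffs e g \<Longrightarrow> 0 \<le> s \<Longrightarrow> energy \<alpha> g \<le> ennreal (s\<^sup>2) \<Longrightarrow> cmod (e k) \<le> C * s / (1/2) ^ k"
    by (rule coefficient_bound[OF \<alpha>, of "1/2"]) auto
  have "cmod (taylor_coeff k f) \<le> C / (1/2) ^ j * dirichlet_norm \<alpha> f" if f: "f \<in> dirichlet_space \<alpha>" for f
  proof -
    have "energy \<alpha> (disk_deriv f) \<le> ennreal ((dirichlet_norm \<alpha> f)\<^sup>2)" using dirichlet_norm_sq[OF f] by simp
    then have "cmod (of_nat (Suc j) * taylor_coeff (Suc j) f) \<le> C * dirichlet_norm \<alpha> f / (1/2) ^ j"
      using C(2)[OF has_coeffs_disk_deriv _ , of f "dirichlet_norm \<alpha> f" j] f nrm_nonneg by (auto simp: dirichlet_space_iff)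
    moreover have "1 * cmod (taylor_coeff (Suc j) f) \<le> cmod (of_nat (Suc j) * taylor_coeff (Suc j) f)"
      unfolding norm_mult norm_of_nat by (intro mult_right_mono) auto
    ultimately show ?thesis using Suc by simp
  qed
  then show ?thesis using that by blast
qed

text \<open>A finite sum of rank-one operators, each given by a bounded coefficient functional.\<close>

lemma compact_taylor_image:
  "compact_op_on (dirichlet_space \<alpha>) (dirichlet_norm \<alpha>) (\<lambda>f z. \<Sum>k<Suc n. taylor_coeff k f * T (disk_monomial k) z)"
proof (rule compact_op_sum)
  fix k
  obtain C where C: "\<And>f. f \<in> dirichlet_space \<alpha> \<Longrightarrow> cmod (taylor_coeff k f) \<le> C * dirichlet_norm \<alpha> f"
    by (rule taylor_coeff_bound[of k]) (rule that)
  show "compact_op_on (dirichlet_space \<alpha>) (dirichlet_norm \<alpha>) (\<lambda>f z. taylor_coeff k f * T (disk_monomial k) z)"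
  proof (rule compact_op_rank_one[OF _ _ _ C])
    show "T (disk_monomial k) \<in> dirichlet_space \<alpha>" by (rule linear_op_in[OF linear_T disk_monomial_dirichlet[OF \<alpha>]])
    fix f g c assume f: "f \<in> dirichlet_space \<alpha>"
    then have fh: "f holomorphic_on unit_disk" by (auto simp: dirichlet_space_iff disk_analytic_def)
    show "taylor_coeff k (\<lambda>z. c * f z) = c * taylor_coeff k f"
      unfolding taylor_coeff_def using higher_deriv_cmult[OF fh, of 0 k c] by simp
    assume g: "g \<in> dirichlet_space \<alpha>"
    then have gh: "g holomorphic_on unit_disk" by (auto simp: dirichlet_space_iff disk_analytic_def)
    show "taylor_coeff k (\<lambda>z. f z + g z) = taylor_coeff k f + taylor_coeff k g"
      unfolding taylor_coeff_def using higher_deriv_add[OF fh gh, of 0 k] by (simp add: add_divide_distrib)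
  qed
qed simp

lemma taylor_remainder_in: "f \<in> dirichlet_space \<alpha> \<Longrightarrow> taylor_remainder n f \<in> dirichlet_space \<alpha>"
  unfolding taylor_remainder_def by (intro diff_in sum_in scale_in disk_monomial_dirichlet[OF \<alpha>]) auto

lemma T_taylor_remainder:
  assumes f: "f \<in> dirichlet_space \<alpha>"
  shows "T (taylor_remainder n f) = (\<lambda>z. T f z - (\<Sum>k<Suc n. taylor_coeff k f * T (disk_monomial k) z))"
proof -
  define P where "P = (\<lambda>z. \<Sum>k<Suc n. taylor_coeff k f * disk_monomial k z)"
  have mk: "(\<lambda>z. taylor_coeff k f * disk_monomial k z) \<in> dirichlet_space \<alpha>" for k
    by (intro scale_in disk_monomial_dirichlet[OF \<alpha>])
  have P: "P \<in> dirichlet_space \<alpha>" unfolding P_def by (intro sum_in mk) auto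
  have "T P = (\<lambda>z. \<Sum>k<Suc n. T (\<lambda>z. taylor_coeff k f * disk_monomial k z) z)"
    unfolding P_def by (rule linear_op_sum[OF linear_T]) (auto intro: mk)
  also have "\<dots> = (\<lambda>z. \<Sum>k<Suc n. taylor_coeff k f * T (disk_monomial k) z)"
    by (simp only: linear_op_scale[OF linear_T disk_monomial_dirichlet[OF \<alpha>]])
  finally have TP: "T P = (\<lambda>z. \<Sum>k<Suc n. taylor_coeff k f * T (disk_monomial k) z)" .
  have "T (\<lambda>z. taylor_remainder n f z + P z) = (\<lambda>z. T (taylor_remainder n f) z + T P z)"
    using linear_T P taylor_remainder_in[OF f] unfolding linear_op_on_def by blast
  moreover have "(\<lambda>z. taylor_remainder n f z + P z) = f" by (simp add: taylor_remainder_def P_def)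
  ultimately show ?thesis unfolding TP by (simp add: fun_eq_iff)
qed

lemma disk_deriv_taylor_remainder:
  assumes f: "f \<in> disk_analytic"
  shows "disk_deriv (taylor_remainder n f) = (\<lambda>z. indicator unit_disk z *\<^sub>R
    (disk_deriv f z - (\<Sum>k<n. of_nat (Suc k) * taylor_coeff (Suc k) f * z ^ k)))"
proof (rule disk_deriv_eqI)
  fix z :: complex assume z: "z \<in> unit_disk"
  have "(disk_monomial k has_field_derivative of_nat k * z ^ (k - 1)) (at z)" for k
    using disk_analytic_derivative[OF disk_monomial_analytic z, of k] z by (simp add: disk_deriv_monomial)
  then have "((\<lambda>z. f z - (\<Sum>k<Suc n. taylor_coeff k f * disk_monomial k z)) has_field_derivative
      disk_deriv f z - (\<Sum>k<Suc n. taylor_coeff k f * (of_nat k * z ^ (k - 1)))) (at z)"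
    by (intro DERIV_diff disk_analytic_derivative[OF f z] DERIV_sum DERIV_cmult)
  moreover have "(\<Sum>k<Suc n. taylor_coeff k f * (of_nat k * z ^ (k - 1))) = (\<Sum>k<n. of_nat (Suc k) * taylor_coeff (Suc k) f * z ^ k)"
    by (subst sum.lessThan_Suc_shift) (simp add: mult_ac del: of_nat_Suc)
  ultimately show "(taylor_remainder n f has_field_derivative
     disk_deriv f z - (\<Sum>k<n. of_nat (Suc k) * taylor_coeff (Suc k) f * z ^ k)) (at z)"
    unfolding taylor_remainder_def by simp
qed

lemma energy_taylor_remainder_le:
  assumes f: "f \<in> disk_analytic"
  shows "energy \<alpha> (disk_deriv (taylor_remainder n f)) \<le> energy \<alpha> (disk_deriv f)"
proof -
  have "energy \<alpha> (disk_deriv (taylor_remainder n f)) = energy \<alpha> (\<lambda>z. disk_deriv f z - (\<Sum>k\<in>{..<n}. of_nat (Suc k) * taylor_coeff (Suc k) f * z ^ k))"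
    unfolding disk_deriv_taylor_remainder[OF f] by (rule energy_cong) simp
  then show ?thesis using energy_split[OF \<alpha> has_coeffs_disk_deriv[OF f], of "{..<n}"] by simp
qed

lemma taylor_remainder_at_0: "taylor_remainder n f 0 = 0"
  unfolding taylor_remainder_def by (subst sum.lessThan_Suc_shift) (simp add: taylor_coeff_def disk_monomial_def)

text \<open>The three terms come from the point evaluation at \<open>z0\<close>, from the part \<open>\<bar>w\<bar> \<le> R\<close> of the disk, where the derivative of the remainder is at most \<open>\<epsilon>\<close>, and from the annulus.\<close>

lemma T_remainder_bound:
  assumes R: "cmod z0 \<le> R" "R < 1" and \<epsilon>: "0 < \<epsilon>"
  obtains n where "\<And>f. f \<in> dirichlet_space \<alpha> \<Longrightarrow> dirichlet_norm \<alpha> f \<le> 1 \<Longrightarrow>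
    ennreal ((dirichlet_norm \<alpha> (T (taylor_remainder n f)))\<^sup>2) \<le> ennreal (\<epsilon>\<^sup>2) + (ennreal (\<epsilon>\<^sup>2) * emeasure \<nu> unit_disk + annulus_norm R)"
proof -
  have R0: "0 \<le> R" using R norm_ge_zero order_trans by blast
  obtain n where n: "\<And>m e g w. n \<le> m \<Longrightarrow> has_coeffs e g \<Longrightarrow> energy \<alpha> g \<le> 1 \<Longrightarrow> cmod w \<le> R \<Longrightarrow>
    cmod (g w - (\<Sum>k<m. e k * w ^ k)) \<le> \<epsilon>"
    by (rule taylor_tail_uniformly_small[OF \<alpha> R0 R(2) \<epsilon>]) (rule that)
  have "ennreal ((dirichlet_norm \<alpha> (T (taylor_remainder n f)))\<^sup>2) \<le> ennreal (\<epsilon>\<^sup>2) + (ennreal (\<epsilon>\<^sup>2) * emeasure \<nu> unit_disk + annulus_norm R)"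
    if f: "f \<in> dirichlet_space \<alpha>" and f1: "dirichlet_norm \<alpha> f \<le> 1" for f
  proof -
    have fa: "f \<in> disk_analytic" using f by (simp add: dirichlet_space_iff)
    define h where "h = taylor_remainder n f"
    have h: "h \<in> dirichlet_space \<alpha>" unfolding h_def by (rule taylor_remainder_in[OF f])
    then have ha: "h \<in> disk_analytic" by (simp add: dirichlet_space_iff)
    have "energy \<alpha> (disk_deriv f) \<le> ennreal ((dirichlet_norm \<alpha> f)\<^sup>2)" using dirichlet_norm_sq[OF f] by simp
    also have "\<dots> \<le> 1" using f1 nrm_nonneg[of f] by (simp add: ennreal_le_1 power_le_one)
    finally have e1: "energy \<alpha> (disk_deriv f) \<le> 1" .
    have small: "cmod (disk_deriv h w) \<le> \<epsilon>" if "cmod w \<le> R" for w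
      using n[OF order_refl has_coeffs_disk_deriv[OF fa] e1 that] that R \<epsilon>
      by (simp add: h_def disk_deriv_taylor_remainder[OF fa] indicator_def)
    have hz: "cmod (h z0) \<le> \<epsilon>"
    proof -
      have "cmod (h z0 - h 0) \<le> \<epsilon> * cmod (z0 - 0)"
      proof (rule field_differentiable_bound[of "cball 0 R" _ "disk_deriv h"])
        show "(h has_field_derivative disk_deriv h w) (at w within cball 0 R)" if "w \<in> cball 0 R" for w
          using disk_analytic_derivative[OF ha, of w] that R by (auto intro: has_field_derivative_at_within)
        show "cmod (disk_deriv h w) \<le> \<epsilon>" if "w \<in> cball 0 R" for w using small that by simp
      qed (use R R0 in auto)
      also have "\<dots> \<le> \<epsilon> * 1" using z0 \<epsilon> by (intro mult_left_mono) auto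
      finally show ?thesis by (simp add: h_def taylor_remainder_at_0)
    qed
    have [measurable]: "disk_deriv h \<in> borel_measurable borel" by (rule disk_deriv_borel[OF ha])
    have "(\<integral>\<^sup>+w. ennreal ((cmod (disk_deriv h w))\<^sup>2) \<partial>\<nu>) \<le>
        (\<integral>\<^sup>+w. ennreal (\<epsilon>\<^sup>2) * indicator unit_disk w + ennreal ((cmod (disk_deriv h w))\<^sup>2) * indicator {w \<in> unit_disk. R < cmod w} w \<partial>\<nu>)"
    proof (rule nn_integral_mono)
      fix w
      show "ennreal ((cmod (disk_deriv h w))\<^sup>2) \<le> ennreal (\<epsilon>\<^sup>2) * indicator unit_disk w + ennreal ((cmod (disk_deriv h w))\<^sup>2) * indicator {w \<in> unit_disk. R < cmod w} w"
      proof (cases "w \<in> unit_disk")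
        case True
        show ?thesis
        proof (cases "R < cmod w")
          case False
          then have "(cmod (disk_deriv h w))\<^sup>2 \<le> \<epsilon>\<^sup>2" using small[of w] by (intro power_mono) auto
          then show ?thesis using True False by (simp add: ennreal_leI)
        qed (use True in simp)
      qed (simp add: disk_deriv_def)
    qed
    also have "\<dots> = ennreal (\<epsilon>\<^sup>2) * emeasure \<nu> unit_disk + annulus_energy R (disk_deriv h)"
      unfolding annulus_energy_def by (subst nn_integral_add) (auto simp: nn_integral_cmult_indicator)
    also have "\<dots> \<le> ennreal (\<epsilon>\<^sup>2) * emeasure \<nu> unit_disk + annulus_norm R"
    proof (intro add_left_mono annulus_energy_le_norm)
      show "disk_deriv h \<in> disk_analytic"
        using disk_deriv_holomorphic[OF ha] by (simp add: disk_analytic_def disk_deriv_def)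
      show "energy \<alpha> (disk_deriv h) \<le> 1"
        unfolding h_def using energy_taylor_remainder_le[OF fa, of n] e1 by (rule order_trans)
    qed
    finally have *: "(\<integral>\<^sup>+w. ennreal ((cmod (disk_deriv h w))\<^sup>2) \<partial>\<nu>) \<le> ennreal (\<epsilon>\<^sup>2) * emeasure \<nu> unit_disk + annulus_norm R" .
    have "ennreal ((cmod (h z0))\<^sup>2) \<le> ennreal (\<epsilon>\<^sup>2)" using hz by (intro ennreal_leI power_mono) auto
    then show ?thesis using T_norm[OF h] * unfolding h_def by (simp add: add_mono)
  qed
  then show ?thesis by (rule that)
qed

abbreviation ess_norm :: real where
  "ess_norm \<equiv> essential_norm_on (dirichlet_space \<alpha>) (dirichlet_norm \<alpha>) T"

lemma ess_norm_nonneg: "0 \<le> ess_norm"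
  by (rule essential_norm_ge[OF T op_norm_diff_nonneg[OF T]])

lemma ess_norm_upper:
  assumes R: "cmod z0 \<le> R" "R < 1"
  shows "ennreal (ess_norm\<^sup>2) \<le> annulus_norm R"
proof (cases "annulus_norm R")
  case (real s)
  define M where "M = enn2real (emeasure \<nu> unit_disk)"
  have M: "emeasure \<nu> unit_disk = ennreal M" "0 \<le> M" using nu_disk_finite by (auto simp: M_def)
  have "ess_norm\<^sup>2 \<le> s + \<delta>" if d: "0 < \<delta>" for \<delta>
  proof -
    \<comment> \<open>makes the total error \<open>\<epsilon>\<^sup>2 + \<epsilon>\<^sup>2 M\<close> equal to \<open>\<delta>\<close>\<close>
    define \<epsilon> where "\<epsilon> = sqrt (\<delta> / (1 + M))"
    have \<epsilon>: "0 < \<epsilon>" "\<epsilon>\<^sup>2 * (1 + M) = \<delta>" using d M by (auto simp: \<epsilon>_def)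
    obtain n where n: "\<And>f. f \<in> dirichlet_space \<alpha> \<Longrightarrow> dirichlet_norm \<alpha> f \<le> 1 \<Longrightarrow>
      ennreal ((dirichlet_norm \<alpha> (T (taylor_remainder n f)))\<^sup>2) \<le> ennreal (\<epsilon>\<^sup>2) + (ennreal (\<epsilon>\<^sup>2) * emeasure \<nu> unit_disk + annulus_norm R)"
      by (rule T_remainder_bound[OF R \<epsilon>(1)]) (rule that)
    have tot: "ennreal (\<epsilon>\<^sup>2) + (ennreal (\<epsilon>\<^sup>2) * emeasure \<nu> unit_disk + annulus_norm R) = ennreal (s + \<delta>)"
    proof -
      have "ennreal (\<epsilon>\<^sup>2) + (ennreal (\<epsilon>\<^sup>2) * emeasure \<nu> unit_disk + annulus_norm R) = ennreal (\<epsilon>\<^sup>2 + (\<epsilon>\<^sup>2 * M + s))"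
        using real M by (simp add: ennreal_mult ennreal_plus)
      also have "\<epsilon>\<^sup>2 + (\<epsilon>\<^sup>2 * M + s) = s + \<delta>" using \<epsilon>(2) by (simp add: distrib_left)
      finally show ?thesis .
    qed
    have "ess_norm \<le> sqrt (s + \<delta>)"
    proof (rule essential_norm_le[OF T compact_taylor_image[of n]])
      fix f assume f: "f \<in> dirichlet_space \<alpha>" "dirichlet_norm \<alpha> f \<le> 1"
      have "(dirichlet_norm \<alpha> (T (taylor_remainder n f)))\<^sup>2 \<le> s + \<delta>"
        using n[OF f] unfolding tot by (subst (asm) ennreal_le_iff) (use real d in auto)
      then show "dirichlet_norm \<alpha> (\<lambda>z. T f z - (\<Sum>k<Suc n. taylor_coeff k f * T (disk_monomial k) z)) \<le> sqrt (s + \<delta>)"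
        unfolding T_taylor_remainder[OF f(1)] by (rule real_le_rsqrt)
    qed
    then have "ess_norm\<^sup>2 \<le> (sqrt (s + \<delta>))\<^sup>2" using ess_norm_nonneg by (rule power_mono)
    then show ?thesis using real d by simp
  qed
  then have "ess_norm\<^sup>2 \<le> s" by (rule field_le_epsilon)
  then show ?thesis using real by (simp add: ennreal_leI)
qed simp

section \<open>The lower bound\<close>

lemma annulus_energy_triangle:
  assumes [measurable]: "f \<in> borel_measurable borel" "g \<in> borel_measurable borel"
    and a: "0 \<le> a" "annulus_energy R f \<le> ennreal (a\<^sup>2)" and b: "0 \<le> b" "annulus_energy R g \<le> ennreal (b\<^sup>2)"
  shows "annulus_energy R (\<lambda>z. f z + g z) \<le> ennreal ((a + b)\<^sup>2)"
proof -
  define M where "M = density \<nu> (indicator {w \<in> unit_disk. R < cmod w})"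
  have M: "annulus_energy R h = (\<integral>\<^sup>+w. ennreal ((cmod (h w))\<^sup>2) \<partial>M)" if [measurable]: "h \<in> borel_measurable borel" for h
    unfolding annulus_energy_def M_def by (subst nn_integral_density) (auto simp: mult.commute)
  have fM: "(\<integral>\<^sup>+w. ennreal ((cmod (f w))\<^sup>2) \<partial>M) \<le> ennreal (a\<^sup>2)" using a(2) by (simp add: M)
  have gM: "(\<integral>\<^sup>+w. ennreal ((cmod (g w))\<^sup>2) \<partial>M) \<le> ennreal (b\<^sup>2)" using b(2) by (simp add: M)
  have ff: "(\<integral>\<^sup>+w. ennreal ((cmod (f w))\<^sup>2) \<partial>M) < \<infinity>" using fM by (rule le_less_trans) simp
  have gf: "(\<integral>\<^sup>+w. ennreal ((cmod (g w))\<^sup>2) \<partial>M) < \<infinity>" using gM by (rule le_less_trans) simp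
  have ms: "f \<in> borel_measurable M" "g \<in> borel_measurable M" by (simp_all add: M_def)
  have "(l2_norm M f)\<^sup>2 \<le> a\<^sup>2" using fM unfolding l2_norm_sq[OF ff] by simp
  then have la: "l2_norm M f \<le> a" using a(1) by (rule power2_le_imp_le)
  have "(l2_norm M g)\<^sup>2 \<le> b\<^sup>2" using gM unfolding l2_norm_sq[OF gf] by simp
  then have lb: "l2_norm M g \<le> b" using b(1) by (rule power2_le_imp_le)
  note tri = l2_norm_triangle[OF ms ff gf]
  have "annulus_energy R (\<lambda>z. f z + g z) = ennreal ((l2_norm M (\<lambda>z. f z + g z))\<^sup>2)"
    using l2_norm_sq[OF tri(1)] by (simp add: M)
  also have "\<dots> \<le> ennreal ((a + b)\<^sup>2)"
    using tri(2) la lb by (intro ennreal_leI power_mono) auto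
  finally show ?thesis .
qed

text \<open>The annuli decrease to the empty set and \<open>\<nu>\<close> has finite mass on the disk.\<close>

lemma annulus_mass_vanishes:
  assumes "0 < \<delta>"
  obtains R where "0 < R" "R < 1" "emeasure \<nu> {w \<in> unit_disk. R < cmod w} < \<delta>"
proof -
  define A where "A j = {w \<in> unit_disk. 1 - 1 / real (j + 2) < cmod w}" for j :: nat
  have lim0: "(\<lambda>j. 1 - 1 / real (j + 2)) \<longlonglongrightarrow> 1"
    using tendsto_diff[OF tendsto_const[of 1] LIMSEQ_ignore_initial_segment[OF lim_1_over_n, of 2]] by simp
  have "(\<lambda>j. emeasure \<nu> (A j)) \<longlonglongrightarrow> emeasure \<nu> (\<Inter>j. A j)"
  proof (rule Lim_emeasure_decseq)
    show "range A \<subseteq> sets \<nu>" by (auto simp: A_def)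
    show "decseq A"
    proof (rule decseq_SucI)
      fix j
      have "1 - 1 / real (j + 2) \<le> 1 - 1 / real (Suc j + 2)" by (simp add: frac_le)
      then show "A (Suc j) \<subseteq> A j" by (auto simp: A_def)
    qed
    show "emeasure \<nu> (A j) \<noteq> \<infinity>" for j
    proof -
      have "emeasure \<nu> (A j) \<le> emeasure \<nu> unit_disk" by (rule emeasure_mono) (auto simp: A_def)
      then show ?thesis using nu_disk_finite by (auto simp: top_unique)
    qed
  qed
  moreover have "(\<Inter>j. A j) = {}"
  proof -
    have "\<exists>j. w \<notin> A j" for w
    proof (cases "w \<in> unit_disk")
      case True
      then have "eventually (\<lambda>j. cmod w < 1 - 1 / real (j + 2)) sequentially"
        using order_tendstoD(1)[OF lim0, of "cmod w"] by simp
      then obtain j where "cmod w < 1 - 1 / real (j + 2)" using eventually_happens'[OF sequentially_bot] by blast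
      then show ?thesis by (intro exI[of _ j]) (simp add: A_def)
    qed (simp add: A_def)
    then show ?thesis by blast
  qed
  ultimately have "(\<lambda>j. emeasure \<nu> (A j)) \<longlonglongrightarrow> 0" by simp
  from order_tendstoD(2)[OF this assms] obtain j where j: "emeasure \<nu> (A j) < \<delta>"
    using eventually_happens'[OF sequentially_bot] by blast
  show ?thesis by (rule that[of "1 - 1 / real (j + 2)"]) (use j in \<open>auto simp: A_def\<close>)
qed

lemma energy_block_le:
  assumes "has_coeffs e g" "finite A"
  shows "energy \<alpha> (\<lambda>z. \<Sum>k\<in>A. e k * z ^ k) \<le> energy \<alpha> g"
  using energy_split[OF \<alpha> assms] by simp

text \<open>Since the bound on \<open>annulus_norm R\<close> holds for every \<open>R < 1\<close>, the annulus can be chosen so thin that the first \<open>n\<close> Taylor terms of any \<open>g\<close> of energy one contribute at most \<open>l1 - l\<close> to the \<open>L\<^sup>2\<close> norm there. Fatou's lemma then replaces the infinite tail by finitely many terms.\<close>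

lemma concentrated_block:
  assumes l: "0 \<le> l" and l1: "l < l1" "\<And>R. R < 1 \<Longrightarrow> ennreal (l1\<^sup>2) < annulus_norm R"
  shows "\<exists>m>n. \<exists>b. energy \<alpha> (disk_poly {n..<m} b) \<le> 1 \<and> ennreal (l\<^sup>2) \<le> (\<integral>\<^sup>+w. ennreal ((cmod (disk_poly {n..<m} b w))\<^sup>2) \<partial>\<nu>)"
proof -
  define \<delta> where "\<delta> = l1 - l"
  have \<delta>: "0 < \<delta>" using l1 by (simp add: \<delta>_def)
  obtain B where B: "0 \<le> B" "\<And>e g w. has_coeffs e g \<Longrightarrow> energy \<alpha> g \<le> 1 \<Longrightarrow> cmod w \<le> 1 \<Longrightarrow> cmod (\<Sum>k<n. e k * w ^ k) \<le> B"
    by (rule taylor_poly_bounded[OF \<alpha>, of n]) (rule that)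
  \<comment> \<open>with this mass of the annulus, a function bounded by \<open>B + 1\<close> has \<open>L\<^sup>2\<close> norm at most \<open>\<delta>\<close> on it; \<open>B\<close> itself might be zero\<close>
  have "0 < ennreal (\<delta>\<^sup>2 / (B + 1)\<^sup>2)" using \<delta> B by simp
  then obtain R where R: "0 < R" "R < 1" "emeasure \<nu> {w \<in> unit_disk. R < cmod w} < ennreal (\<delta>\<^sup>2 / (B + 1)\<^sup>2)"
    by (rule annulus_mass_vanishes)
  obtain g where g: "g \<in> disk_analytic" "energy \<alpha> g = 1" "ennreal (l1\<^sup>2) < annulus_energy R g"
    using l1(2)[OF R(2)] unfolding annulus_norm_def less_SUP_iff by blast
  define e where "e k = (deriv ^^ k) g 0 / fact k" for k
  have e: "has_coeffs e g"
    unfolding e_def by (rule holomorphic_has_coeffs[OF disk_analytic_holomorphic[OF g(1)]])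
  define t where "t z = g z - disk_poly {..<n} e z" for z
  have poly_borel: "disk_poly A b \<in> borel_measurable borel" for A b by (rule disk_analytic_borel[OF disk_poly_analytic])
  note [measurable] = poly_borel
  have [measurable]: "g \<in> borel_measurable borel" by (rule disk_analytic_borel[OF g(1)])
  have [measurable]: "t \<in> borel_measurable borel" unfolding t_def by measurable
  have "annulus_energy R (disk_poly {..<n} e) \<le> (\<integral>\<^sup>+w. ennreal ((B + 1)\<^sup>2) * indicator {w \<in> unit_disk. R < cmod w} w \<partial>\<nu>)"
    unfolding annulus_energy_def
  proof (rule nn_integral_mono)
    fix w
    show "ennreal ((cmod (disk_poly {..<n} e w))\<^sup>2) * indicator {w \<in> unit_disk. R < cmod w} w \<le> ennreal ((B + 1)\<^sup>2) * indicator {w \<in> unit_disk. R < cmod w} w"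
    proof (cases "w \<in> unit_disk")
      case True
      then have "cmod (disk_poly {..<n} e w) \<le> B + 1" using B(2)[OF e, of w] g(2) by (simp add: disk_poly_def)
      then show ?thesis by (intro mult_right_mono ennreal_leI power_mono) auto
    qed simp
  qed
  also have "\<dots> = ennreal ((B + 1)\<^sup>2) * emeasure \<nu> {w \<in> unit_disk. R < cmod w}" by (rule nn_integral_cmult_indicator) simp
  also have "\<dots> \<le> ennreal ((B + 1)\<^sup>2) * ennreal (\<delta>\<^sup>2 / (B + 1)\<^sup>2)" using R(3) by (intro mult_left_mono) auto
  also have "\<dots> = ennreal (\<delta>\<^sup>2)" using B(1) by (simp flip: ennreal_mult)
  finally have head: "annulus_energy R (disk_poly {..<n} e) \<le> ennreal (\<delta>\<^sup>2)" .
  have tail: "ennreal (l\<^sup>2) < annulus_energy R t"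
  proof (rule ccontr)
    assume "\<not> ?thesis"
    then have "annulus_energy R t \<le> ennreal (l\<^sup>2)" by simp
    then have "annulus_energy R (\<lambda>z. t z + disk_poly {..<n} e z) \<le> ennreal ((l + \<delta>)\<^sup>2)"
      using head l \<delta> by (intro annulus_energy_triangle) auto
    then show False using g(3) by (simp add: t_def \<delta>_def)
  qed
  define p where "p m = disk_poly {n..<m} e" for m
  have [measurable]: "p m \<in> borel_measurable borel" for m unfolding p_def by measurable
  have conv: "(\<lambda>m. p m w) \<longlonglongrightarrow> t w" if w: "w \<in> unit_disk" for w
  proof -
    have "(\<lambda>m. \<Sum>k<m. e k * w ^ k) \<longlonglongrightarrow> g w" using e w by (auto simp: has_coeffs_def sums_def)
    then have "(\<lambda>m. (\<Sum>k<m. e k * w ^ k) - (\<Sum>k<n. e k * w ^ k)) \<longlonglongrightarrow> t w"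
      using w by (auto simp: t_def disk_poly_def intro!: tendsto_diff)
    moreover have "eventually (\<lambda>m. (\<Sum>k<m. e k * w ^ k) - (\<Sum>k<n. e k * w ^ k) = p m w) sequentially"
      using eventually_ge_at_top[of n]
    proof eventually_elim
      case (elim m)
      have "(\<Sum>k<m. e k * w ^ k) = (\<Sum>k<n. e k * w ^ k) + (\<Sum>k=n..<m. e k * w ^ k)"
        using sum.atLeastLessThan_concat[of 0 n m "\<lambda>k. e k * w ^ k"] elim by (simp add: atLeast0LessThan)
      then show ?case using w by (simp add: p_def disk_poly_def)
    qed
    ultimately show ?thesis by (rule Lim_transform_eventually)
  qed
  have "annulus_energy R t \<le> liminf (\<lambda>m. annulus_energy R (p m))"
  proof -
    have "annulus_energy R t = (\<integral>\<^sup>+w. liminf (\<lambda>m. ennreal ((cmod (p m w))\<^sup>2) * indicator {w \<in> unit_disk. R < cmod w} w) \<partial>\<nu>)"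
      unfolding annulus_energy_def
    proof (rule nn_integral_cong)
      fix w
      have "(\<lambda>m. ennreal ((cmod (p m w))\<^sup>2) * indicator {w \<in> unit_disk. R < cmod w} w) \<longlonglongrightarrow> ennreal ((cmod (t w))\<^sup>2) * indicator {w \<in> unit_disk. R < cmod w} w"
      proof (cases "w \<in> unit_disk \<and> R < cmod w")
        case True
        then have "(\<lambda>m. ennreal ((cmod (p m w))\<^sup>2)) \<longlonglongrightarrow> ennreal ((cmod (t w))\<^sup>2)"
          by (intro tendsto_ennrealI tendsto_power tendsto_norm conv) auto
        then show ?thesis using True by simp
      qed auto
      from lim_imp_Liminf[OF _ this] show "ennreal ((cmod (t w))\<^sup>2) * indicator {w \<in> unit_disk. R < cmod w} w =
        liminf (\<lambda>m. ennreal ((cmod (p m w))\<^sup>2) * indicator {w \<in> unit_disk. R < cmod w} w)" by simp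
    qed
    also have "\<dots> \<le> liminf (\<lambda>m. annulus_energy R (p m))"
      unfolding annulus_energy_def by (rule nn_integral_liminf) measurable
    finally show ?thesis .
  qed
  then have "ennreal (l\<^sup>2) < liminf (\<lambda>m. annulus_energy R (p m))" using tail by (rule less_le_trans[rotated])
  then have "eventually (\<lambda>m. ennreal (l\<^sup>2) < annulus_energy R (p m)) sequentially" by (rule less_LiminfD)
  moreover have "eventually (\<lambda>m. n < m) sequentially" by (rule eventually_gt_at_top)
  ultimately have "eventually (\<lambda>m. ennreal (l\<^sup>2) < annulus_energy R (p m) \<and> n < m) sequentially" by (rule eventually_conj)
  then obtain m where m: "ennreal (l\<^sup>2) < annulus_energy R (p m)" "n < m"
    using eventually_happens'[OF sequentially_bot] by blast
  have "energy \<alpha> (disk_poly {n..<m} e) \<le> 1"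
    unfolding energy_disk_poly using energy_block_le[OF e, of "{n..<m}"] g(2) by simp
  moreover have "annulus_energy R (p m) \<le> (\<integral>\<^sup>+w. ennreal ((cmod (disk_poly {n..<m} e w))\<^sup>2) \<partial>\<nu>)"
    unfolding annulus_energy_def p_def by (intro nn_integral_mono) (auto simp: indicator_def)
  ultimately show ?thesis using m by (intro exI[of _ m] conjI exI[of _ e]) auto
qed

text \<open>Disjoint sets of exponents make the polynomials orthogonal.\<close>

lemma energy_sum_disjoint_blocks:
  assumes F: "finite F" and A: "\<And>j. j \<in> F \<Longrightarrow> finite (A j)" and dis: "disjoint_family_on A F"
    and le: "\<And>j. j \<in> F \<Longrightarrow> energy \<alpha> (disk_poly (A j) (b j)) \<le> 1"
  shows "energy \<alpha> (\<lambda>z. \<Sum>j\<in>F. disk_poly (A j) (b j) z) \<le> of_nat (card F)"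
  using F A dis le
proof (induction F rule: finite_induct)
  case empty
  then show ?case by (simp add: energy_def)
next
  case (insert i F)
  define h where "h = (\<lambda>z. \<Sum>j\<in>F. disk_poly (A j) (b j) z)"
  define e where "e k = (\<Sum>j\<in>F. if k \<in> A j then b j k else 0)" for k
  have h: "has_coeffs e h"
    unfolding has_coeffs_def
  proof
    fix z :: complex assume z: "z \<in> unit_disk"
    have "(\<lambda>k. (if k \<in> A j then b j k else 0) * z ^ k) sums (disk_poly (A j) (b j) z)" if "j \<in> F" for j
      using has_coeffs_poly[of "A j" "b j"] z that insert.prems by (simp add: has_coeffs_def disk_poly_def)
    from sums_sum[OF this] show "(\<lambda>k. e k * z ^ k) sums h z" by (simp add: e_def h_def sum_distrib_right)
  qed
  have e0: "e k = 0" if "k \<in> A i" for k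
    unfolding e_def using that insert.prems(2) insert.hyps by (intro sum.neutral) (auto simp: disjoint_family_on_def)
  have "energy \<alpha> (\<lambda>z. \<Sum>j\<in>insert i F. disk_poly (A j) (b j) z) = energy \<alpha> (\<lambda>z. (\<Sum>k\<in>A i. b i k * z ^ k) + h z)"
    by (rule energy_cong) (use insert.hyps in \<open>simp add: h_def disk_poly_def\<close>)
  also have "\<dots> = energy \<alpha> (disk_poly (A i) (b i)) + energy \<alpha> h"
    unfolding energy_disk_poly using insert.prems by (intro pythagoras[OF \<alpha> _ h e0]) auto
  also have "\<dots> \<le> 1 + of_nat (card F)"
  proof (rule add_mono)
    show "energy \<alpha> h \<le> of_nat (card F)" unfolding h_def
      using insert.prems by (intro insert.IH) (auto simp: disjoint_family_on_def)
  qed (use insert.prems in simp)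
  finally show ?case using insert.hyps by simp
qed

text \<open>Each block starts at the degree where the previous one ended, so the sequence of primitives satisfies the hypothesis of \<open>essential_norm_ge_orthogonal_sequence\<close>.\<close>

lemma ess_norm_ge_of_gap:
  assumes l: "0 \<le> l" and gap: "l < l1" "\<And>R. R < 1 \<Longrightarrow> ennreal (l1\<^sup>2) < annulus_norm R"
  shows "l \<le> ess_norm"
proof -
  have "\<forall>n. \<exists>m>n. \<exists>b. energy \<alpha> (disk_poly {n..<m} b) \<le> 1 \<and> ennreal (l\<^sup>2) \<le> (\<integral>\<^sup>+w. ennreal ((cmod (disk_poly {n..<m} b w))\<^sup>2) \<partial>\<nu>)"
    using concentrated_block[OF l gap] by blast
  then obtain m b where mb: "\<And>n. n < m n" "\<And>n. energy \<alpha> (disk_poly {n..<m n} (b n)) \<le> 1"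
    "\<And>n. ennreal (l\<^sup>2) \<le> (\<integral>\<^sup>+w. ennreal ((cmod (disk_poly {n..<m n} (b n) w))\<^sup>2) \<partial>\<nu>)" by metis
  \<comment> \<open>the degrees at which successive blocks start\<close>
  define s where "s j = (m ^^ j) 0" for j
  have s_Suc: "s (Suc j) = m (s j)" for j by (simp add: s_def)
  have s_mono: "mono s" by (rule incseq_SucI) (use mb(1) in \<open>simp add: s_Suc less_imp_le\<close>)
  define A where "A j = {s j..<s (Suc j)}" for j
  have disA: "disjoint_family_on A F" for F
  proof -
    have "A i \<inter> A j = {}" if "i < j" for i j
    proof -
      have "s (Suc i) \<le> s j" using monoD[OF s_mono, of "Suc i" j] that by simp
      then show ?thesis by (auto simp: A_def)
    qed
    then show ?thesis unfolding disjoint_family_on_def by (metis Int_commute linorder_neqE_nat)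
  qed
  define c where "c j = b (s j)" for j
  define u where "u j = disk_poly_primitive (A j) (c j)" for j
  have du: "disk_deriv (u j) = disk_poly (A j) (c j)" for j unfolding u_def by (rule disk_deriv_poly_primitive)
  have ua: "u j \<in> disk_analytic" for j unfolding u_def by (rule disk_poly_primitive_analytic)
  have e1: "energy \<alpha> (disk_poly (A j) (c j)) \<le> 1" for j using mb(2)[of "s j"] by (simp add: A_def c_def s_Suc)
  have uV: "u j \<in> dirichlet_space \<alpha>" for j
    unfolding dirichlet_space_iff du using ua e1[of j] by (auto intro: le_less_trans)
  show ?thesis
  proof (rule essential_norm_ge_orthogonal_sequence[OF T uV])
    fix F :: "nat set" assume F: "finite F"
    have SV: "(\<lambda>z. \<Sum>j\<in>F. u j z) \<in> dirichlet_space \<alpha>" by (intro sum_in F uV)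
    have dd: "disk_deriv (\<lambda>z. \<Sum>j\<in>F. u j z) = (\<lambda>z. indicator unit_disk z *\<^sub>R (\<Sum>j\<in>F. disk_poly (A j) (c j) z))"
      unfolding du[symmetric] by (intro disk_deriv_eqI DERIV_sum disk_analytic_derivative ua)
    have "energy \<alpha> (disk_deriv (\<lambda>z. \<Sum>j\<in>F. u j z)) = energy \<alpha> (\<lambda>z. \<Sum>j\<in>F. disk_poly (A j) (c j) z)"
      unfolding dd by (rule energy_cong) simp
    also have "\<dots> \<le> of_nat (card F)"
      by (rule energy_sum_disjoint_blocks[OF F _ disA e1]) (simp add: A_def)
    finally have "ennreal ((dirichlet_norm \<alpha> (\<lambda>z. \<Sum>j\<in>F. u j z))\<^sup>2) \<le> of_nat (card F)"
      unfolding dirichlet_norm_sq[OF SV] by (simp add: u_def disk_poly_primitive_def)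
    then have "ennreal ((dirichlet_norm \<alpha> (\<lambda>z. \<Sum>j\<in>F. u j z))\<^sup>2) \<le> ennreal (real (card F))"
      by (simp add: ennreal_of_nat_eq_real_of_nat)
    then show "(dirichlet_norm \<alpha> (\<lambda>z. \<Sum>j\<in>F. u j z))\<^sup>2 \<le> real (card F)" by simp
  next
    fix j
    have "ennreal (l\<^sup>2) \<le> (\<integral>\<^sup>+w. ennreal ((cmod (disk_deriv (u j) w))\<^sup>2) \<partial>\<nu>)"
      unfolding du using mb(3)[of "s j"] by (simp add: A_def c_def s_Suc)
    also have "\<dots> \<le> ennreal ((dirichlet_norm \<alpha> (T (u j)))\<^sup>2)" unfolding T_norm[OF uV] by simp
    finally have "l\<^sup>2 \<le> (dirichlet_norm \<alpha> (T (u j)))\<^sup>2" by simp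
    then show "l \<le> dirichlet_norm \<alpha> (T (u j))" using nrm_nonneg by (rule power2_le_imp_le)
  qed
qed

lemma ess_norm_lower:
  assumes L: "\<And>R. R < 1 \<Longrightarrow> L \<le> annulus_norm R"
  shows "L \<le> ennreal (ess_norm\<^sup>2)"
proof (rule ccontr)
  assume "\<not> ?thesis"
  then have "ennreal (ess_norm\<^sup>2) < L" by simp
  then obtain c where c: "ennreal (ess_norm\<^sup>2) < c" "c < L" using dense by blast
  then obtain d where d: "c < d" "d < L" using dense by blast
  obtain c' d' where cd: "c = ennreal c'" "0 \<le> c'" "d = ennreal d'" "0 \<le> d'"
    using c d by (metis ennreal_cases not_less_iff_gr_or_eq order_less_trans top.extremum_strict top.not_eq_extremum)
  have lt: "ess_norm\<^sup>2 < c'" "c' < d'" using c d cd by (simp_all add: ennreal_less_iff)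
  have "sqrt c' \<le> ess_norm"
  proof (rule ess_norm_ge_of_gap)
    show "sqrt c' < sqrt d'" using lt by simp
    show "ennreal ((sqrt d')\<^sup>2) < annulus_norm R" if "R < 1" for R
      using L[OF that] d(2) cd by (simp add: less_le_trans)
  qed (use cd in simp)
  then have "(sqrt c')\<^sup>2 \<le> ess_norm\<^sup>2" using cd by (intro power_mono) auto
  then show False using lt cd by simp
qed

section \<open>The essential norm of a composition operator\<close>

lemma ess_norm_eq: "ennreal (ess_norm\<^sup>2) = (INF R\<in>{..<1}. annulus_norm R)"
proof (rule antisym)
  show "ennreal (ess_norm\<^sup>2) \<le> (INF R\<in>{..<1}. annulus_norm R)"
  proof (rule INF_greatest)
    fix R :: real assume "R \<in> {..<1}"
    then have "ennreal (ess_norm\<^sup>2) \<le> annulus_norm (max R (cmod z0))" using z0 by (intro ess_norm_upper) auto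
    also have "\<dots> \<le> annulus_norm R" by (rule annulus_norm_antimono) simp
    finally show "ennreal (ess_norm\<^sup>2) \<le> annulus_norm R" .
  qed
  show "(INF R\<in>{..<1}. annulus_norm R) \<le> ennreal (ess_norm\<^sup>2)"
    by (rule ess_norm_lower) (auto intro: INF_lower)
qed

lemma annulus_norm_tendsto: "(annulus_norm \<longlongrightarrow> ennreal (ess_norm\<^sup>2)) (at_left 1)"
  unfolding ess_norm_eq
proof (rule order_tendstoI)
  fix a assume a: "a < (INF R\<in>{..<1}. annulus_norm R)"
  have "a < annulus_norm R" if "R < 1" for R
    using a INF_lower[of R "{..<1}" annulus_norm] that by (auto intro: less_le_trans)
  then show "eventually (\<lambda>R. a < annulus_norm R) (at_left 1)"
    by (auto simp: eventually_at_filter)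
next
  fix a assume "(INF R\<in>{..<1}. annulus_norm R) < a"
  then obtain S where S: "S < 1" "annulus_norm S < a" by (auto simp: INF_less_iff)
  have "eventually (\<lambda>R. S < R) (at_left (1::real))" using eventually_at_left_real[OF S(1)] by eventually_elim auto
  then show "eventually (\<lambda>R. annulus_norm R < a) (at_left 1)"
  proof eventually_elim
    case (elim R)
    then show ?case using annulus_norm_antimono[of S R] S(2) by (auto intro: le_less_trans)
  qed
qed

end

theorem proposition3p6:
  fixes \<alpha> :: real and \<phi> :: "complex \<Rightarrow> complex"
  assumes "\<alpha> > -1"
    and "\<phi> holomorphic_on unit_disk"
    and "\<phi> ` unit_disk \<subseteq> unit_disk"
    and "\<not> \<phi> constant_on unit_disk"
    and "bounded_op_on (dirichlet_space \<alpha>) (dirichlet_norm \<alpha>) (composition_op \<phi>)"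
  shows "\<exists>L :: ennreal.
    ((\<lambda>R :: real. SUP g\<in>{g \<in> bergman_space \<alpha>. bergman_norm \<alpha> g = 1}.
        (\<integral>\<^sup>+w\<in>{w \<in> unit_disk. cmod w > R}.
           (ennreal ((cmod (g w))\<^sup>2) * counting_function \<phi> \<alpha> w) \<partial>dA)) \<longlongrightarrow> L) (at_left 1) \<and>
    ennreal ((essential_norm_on (dirichlet_space \<alpha>) (dirichlet_norm \<alpha>) (composition_op \<phi>))\<^sup>2)
      = ennreal (1 + \<alpha>) * L"
proof -
  obtain \<nu> :: "complex measure" where sets_nu: "sets \<nu> = sets borel"
    and comp: "\<And>f. f \<in> disk_analytic \<Longrightarrow> composition_op \<phi> f \<in> disk_analytic \<and>
        energy \<alpha> (disk_deriv (composition_op \<phi> f)) = (\<integral>\<^sup>+w. ennreal ((cmod (disk_deriv f w))\<^sup>2) \<partial>\<nu>)"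
    and ann: "\<And>g R. g \<in> disk_analytic \<Longrightarrow>
        (\<integral>\<^sup>+w. ennreal ((cmod (g w))\<^sup>2) * indicator {w \<in> unit_disk. R < cmod w} w \<partial>\<nu>)
        = ennreal (1 + \<alpha>) * (\<integral>\<^sup>+w\<in>{w \<in> unit_disk. cmod w > R}. (ennreal ((cmod (g w))\<^sup>2) * counting_function \<phi> \<alpha> w) \<partial>dA)"
    by (rule composition_measure[OF assms(1-4)]) (rule that)
  \<comment> \<open>the Dirichlet norm of \<open>f \<circ> \<phi>\<close> splits into the value at the origin and the energy of its derivative\<close>
  interpret carleson_composition \<alpha> \<nu> "composition_op \<phi>" "\<phi> 0"
  proof
    show "\<phi> 0 \<in> unit_disk" using assms(3) by (auto simp: image_subset_iff)
    fix f assume f: "f \<in> dirichlet_space \<alpha>"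
    have "composition_op \<phi> f \<in> dirichlet_space \<alpha>" using assms(5) f by (auto simp: bounded_op_on_def linear_op_on_def)
    from dirichlet_norm_sq[OF this]
    show "ennreal ((dirichlet_norm \<alpha> (composition_op \<phi> f))\<^sup>2)
        = ennreal ((cmod (f (\<phi> 0)))\<^sup>2) + (\<integral>\<^sup>+w. ennreal ((cmod (disk_deriv f w))\<^sup>2) \<partial>\<nu>)"
      using comp[of f] f by (simp add: dirichlet_space_iff composition_op_def[of \<phi> f])
  qed (use assms sets_nu in auto)
  define c where "c = ennreal (1 / (1 + \<alpha>))"
  have c: "c * (ennreal (1 + \<alpha>) * x) = x" "ennreal (1 + \<alpha>) * (c * x) = x" for x
    using assms(1) by (simp_all add: c_def flip: mult.assoc ennreal_mult)
  let ?S = "\<lambda>R. SUP g\<in>{g \<in> bergman_space \<alpha>. bergman_norm \<alpha> g = 1}.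
        (\<integral>\<^sup>+w\<in>{w \<in> unit_disk. cmod w > R}. (ennreal ((cmod (g w))\<^sup>2) * counting_function \<phi> \<alpha> w) \<partial>dA)"
  have "?S R = c * annulus_norm R" for R
  proof -
    have "?S R = (SUP g\<in>{g \<in> disk_analytic. energy \<alpha> g = 1}. c * annulus_energy R g)"
    proof (rule SUP_cong)
      show "{g \<in> bergman_space \<alpha>. bergman_norm \<alpha> g = 1} = {g \<in> disk_analytic. energy \<alpha> g = 1}"
        by (simp add: bergman_norm_one_iff)
      show "(\<integral>\<^sup>+w\<in>{w \<in> unit_disk. cmod w > R}. (ennreal ((cmod (g w))\<^sup>2) * counting_function \<phi> \<alpha> w) \<partial>dA) = c * annulus_energy R g"
        if "g \<in> {g \<in> disk_analytic. energy \<alpha> g = 1}" for g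
        using that ann[of g R] unfolding annulus_energy_def by (simp add: c)
    qed
    also have "\<dots> = c * annulus_norm R" unfolding annulus_norm_def by (rule SUP_mult_left_ennreal[symmetric])
    finally show ?thesis .
  qed
  then have "?S = (\<lambda>R. c * annulus_norm R)" by auto
  moreover have "((\<lambda>R. c * annulus_norm R) \<longlongrightarrow> c * ennreal (ess_norm\<^sup>2)) (at_left 1)"
    by (rule ennreal_tendsto_cmult[OF _ annulus_norm_tendsto]) (simp add: c_def)
  ultimately show ?thesis
    by (intro exI[of _ "c * ennreal (ess_norm\<^sup>2)"]) (simp add: c)
qed

end
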